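(* Let $J,K$ be positive integers. Let $\mathcal{B}_{\Lambda(A\otimes B)}$ be the set of all $2\times J\times K$ integer arrays of the form $$z=\mathbf{e}_{j_1k_1}-\mathbf{e}_{j_2k_2}-\mathbf{e}_{j_3k_3}+\mathbf{e}_{j_4k_4},$$ with $(j_1,k_1),(j_2,k_2),(j_3,k_3),(j_4,k_4)\in\{1,\dots,J\}\times\{1,\dots,K\}$ satisfying $$(j_1,k_1)-(j_2,k_2)=(j_3,k_3)-(j_4,k_4).$$ Then $\mathcal{B}_{\Lambda(A\otimes B)}$ connects every fiber of the bivariate logistic regression model satisfying $X_{+jk}>0$ for all $j=1,\dots,J$ and $k=1,\dots,K$. That is, whenever $x$ and $y$ are two tables in such a fiber, there is a finite sequence of tables $x=x^{(0)},x^{(1)},\dots,x^{(N)}=y$, all with nonnegative integer entries, such that $x^{(s)}-x^{(s-1)}\in\mathcal{B}_{\Lambda(A\otimes B)}$ for $s=1,\dots,N$.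
   Context: A table is an array $X=(X_{ijk})$, $i\in\{1,2\}$, $j\in\{1,\dots,J\}$, $k\in\{1,\dots,K\}$, of nonnegative integers ($X_{1jk}$, $X_{2jk}$ are numbers of successes and failures at covariate level $(j,k)$). A subscript $+$ denotes summation over that index. The bivariate logistic regression model is $\log\frac{p_{1jk}}{1-p_{1jk}}=\mu+\alpha j+\beta k$; its sufficient statistic is the collection $$X_{1++},\quad \sum_{j=1}^J jX_{1j+},\quad \sum_{k=1}^K kX_{1+k},\quad X_{+jk}=X_{1jk}+X_{2jk}\ \ (\text{all } j,k).$$ A fiber is the set of all tables of nonnegative integers with a given common value of the sufficient statistic. $\mathbf{e}_{jk}$ denotes the $2\times J\times K$ integer array with $1$ at cell $(1,j,k)$, $-1$ at cell $(2,j,k)$ and $0$ everywhere else. *)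

theory Defs
  imports "HOL-Library.Function_Algebras"
begin

text \<open>
  Integer arrays \<open>X i j k\<close> with \<open>i \<in> {1,2}\<close>, \<open>j \<in> {1..J}\<close>, \<open>k \<in> {1..K}\<close> are total functions
  that vanish outside the index range; equality of such functions is then equality of arrays,
  and \<open>+\<close> and \<open>-\<close> act pointwise.
\<close>

type_synonym array3 = "nat \<Rightarrow> nat \<Rightarrow> nat \<Rightarrow> int"

definition arrays :: "nat \<Rightarrow> nat \<Rightarrow> array3 set" where
  "arrays J K = {X. \<forall>i j k. (i, j, k) \<notin> {1, 2} \<times> {1..J} \<times> {1..K} \<longrightarrow> X i j k = 0}"

definition tables :: "nat \<Rightarrow> nat \<Rightarrow> array3 set" where
  "tables J K = {X \<in> arrays J K. \<forall>i j k. 0 \<le> X i j k}"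

definition cell_total :: "array3 \<Rightarrow> nat \<Rightarrow> nat \<Rightarrow> int" where
  "cell_total X j k = (\<Sum>i\<in>{1, 2}. X i j k)"

text \<open>
  The components are \<open>X\<^sub>1\<^sub>+\<^sub>+\<close>, \<open>\<Sum>j. j X\<^sub>1\<^sub>j\<^sub>+\<close>, \<open>\<Sum>k. k X\<^sub>1\<^sub>+\<^sub>k\<close> and the family \<open>X\<^sub>+\<^sub>j\<^sub>k\<close>.
\<close>

definition suff_stat ::
    "nat \<Rightarrow> nat \<Rightarrow> array3 \<Rightarrow> int \<times> int \<times> int \<times> (nat \<times> nat \<Rightarrow> int)" where
  "suff_stat J K X =
     (\<Sum>j=1..J. \<Sum>k=1..K. X 1 j k,
      \<Sum>j=1..J. int j * (\<Sum>k=1..K. X 1 j k),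
      \<Sum>k=1..K. int k * (\<Sum>j=1..J. X 1 j k),
      \<lambda>(j, k). if j \<in> {1..J} \<and> k \<in> {1..K} then cell_total X j k else 0)"

definition fiber ::
    "nat \<Rightarrow> nat \<Rightarrow> int \<times> int \<times> int \<times> (nat \<times> nat \<Rightarrow> int) \<Rightarrow> array3 set" where
  "fiber J K t = {X \<in> tables J K. suff_stat J K X = t}"

definition unit_move :: "nat \<Rightarrow> nat \<Rightarrow> array3" where
  "unit_move j k = (\<lambda>i j' k'.
     if (i, j', k') = (1, j, k) then 1
     else if (i, j', k') = (2, j, k) then - 1
     else 0)"

definition lawrence_moves :: "nat \<Rightarrow> nat \<Rightarrow> array3 set" where
  "lawrence_moves J K =
     {unit_move j1 k1 - unit_move j2 k2 - unit_move j3 k3 + unit_move j4 k4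
      | j1 k1 j2 k2 j3 k3 j4 k4.
        {(j1, k1), (j2, k2), (j3, k3), (j4, k4)} \<subseteq> {1..J} \<times> {1..K} \<and>
        int j1 - int j2 = int j3 - int j4 \<and> int k1 - int k2 = int k3 - int k4}"

definition connects :: "nat \<Rightarrow> nat \<Rightarrow> array3 set \<Rightarrow> array3 set \<Rightarrow> bool" where
  "connects J K B F \<longleftrightarrow>
     (\<forall>x\<in>F. \<forall>y\<in>F. \<exists>(N::nat) (p :: nat \<Rightarrow> array3).
        p 0 = x \<and> p N = y \<and>
        (\<forall>s\<le>N. p s \<in> tables J K) \<and>
        (\<forall>s\<in>{1..N}. p s - p (s - 1) \<in> B))"

end

theory Submission
  imports Complex_Main Defs "HOL-Library.Product_Plus"
begin

text \<open>
  A table of the fiber is determined by its array of success counts, a configuration of units on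
  the cells of a grid with at most \<open>n p\<close> units on cell \<open>p\<close>, where
  \<open>n \<ge> 1\<close> is the array of cell totals. A move takes one unit from each of two
  cells \<open>a, c\<close> and puts one on each of two cells \<open>b, d\<close> with
  \<open>a + c = b + d\<close>. The claim is that two configurations with the same number of units
  and the same sum of positions are joined by such moves (\<open>balanced_imp_conn\<close>).

  Suppose not, and take a disconnected pair \<open>x, y\<close> with \<open>z = x - y\<close> of
  least \<open>\<ell>\<^sub>1\<close> norm. If \<open>z\<close> is positive at \<open>a, c\<close>
  and negative at \<open>b\<close>, consider the fourth corner \<open>d = a + c - b\<close>. As
  \<open>n d \<ge> 1\<close>, either \<open>x\<close> has room at \<open>d\<close>, and
  \<open>a, c \<rightarrow> b, d\<close> can be applied to \<open>x\<close>, or \<open>y\<close>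
  has a unit at \<open>d\<close> (unless \<open>z d > 0\<close>), and the reverse can be applied
  to \<open>y\<close>. Both bring the configurations closer. Hence \<open>z d > 0\<close> whenever
  \<open>d\<close> is in the grid, and the same holds for \<open>-z\<close>. There is one
  exception: \<open>d = b\<close> is the midpoint of \<open>a\<close> and \<open>c\<close> and
  \<open>z b = -1\<close>, so that two units cannot go there.

  Without the exception, convexity gives \<open>z = 0\<close>
  (\<open>exchange_closed_balanced_eq_0\<close>). A circuit in the support of \<open>z\<close> is
  either a pair of crossing segments, possibly degenerate, or a triangle around a point. Crossing
  segments are ruled out by a Euclidean algorithm on their weights (\<open>no_crossing\<close>),
  because one corner can always be reflected inside the quadrilateral. For a triangle of positive
  cells, all negative cells lie in it, and in a rectangle some vertex of the triangle can be
  reflected at the midpoint of any two of them into a negative cell farther away from this vertex,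
  which contradicts a suitable extremal choice of the two cells (\<open>no_triangle\<close>).

  So the exception occurs: there is a pivot, an \<open>m\<close> with \<open>z m = -1\<close> and
  \<open>z (m + u), z (m - u) > 0\<close>. It cannot be avoided. On the rectangle
  \<open>{-4..3} \<times> {-2..2}\<close> the array with value \<open>1\<close> at
  \<open>(3,2)\<close>, \<open>(-3,-2)\<close>, \<open>(-2,1)\<close> and \<open>-1\<close> at
  \<open>(0,0)\<close>, \<open>(2,-1)\<close>, \<open>(-4,2)\<close> is balanced, and if
  \<open>n = 1\<close> on these six cells no single move reduces the distance. Therefore the cells
  where \<open>x\<close> and \<open>y\<close> agree have to be used as well. If they offer a pair
  \<open>h, h + u\<close> with a unit on \<open>h\<close> and room on \<open>h + u\<close>, one
  move of \<open>x\<close> and one of \<open>y\<close> together have the effect of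
  \<open>m + u, m - u \<rightarrow> m, m\<close>, which reduces the distance. So \<open>x\<close>
  is constantly full or constantly empty along every parallel to \<open>u\<close> that avoids
  \<open>m\<close> and has at least two cells (\<open>full_along_u\<close>). A similar detour
  shows that the vector sum of two full cells relative to \<open>m\<close> is full, if the
  reflection of one of them at \<open>m\<close> is not (\<open>full_sum\<close>). If moreover
  \<open>u\<close> is as short as possible, just one of the two lines next to \<open>m\<close> is
  full, for \<open>x\<close> or for the complement of \<open>y\<close> (\<open>definite\<close>),
  and then this configuration is full on one side of the line through \<open>m\<close> and empty
  on the other (\<open>threshold\<close>). Balance forces \<open>z\<close> to vanish off this
  line, and the one-dimensional problem on the line is solved by \<open>no_pivot_on_line\<close>.
  Directions \<open>u\<close> that are multiples of another vector or parallel to an axis are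
  excluded separately.
\<close>

section \<open>Balanced arrays and crossing segments\<close>

(* Cells are to be treated as vectors, not as pairs of variables. *)
declare split_paired_All [simp del] split_paired_Ex [simp del]

type_synonym cell = "int \<times> int"

text \<open>
  Two units of the positive part of \<open>z\<close>, counted with multiplicity: a cell that is used twice has
  to carry two units.
\<close>
definition two_units :: "(cell \<Rightarrow> int) \<Rightarrow> cell \<Rightarrow> cell \<Rightarrow> bool" where
  "two_units z a c \<longleftrightarrow> 0 < z a \<and> 0 < z c \<and> (a = c \<longrightarrow> 2 \<le> z a)"

lemma two_units_commute: "two_units z a c \<Longrightarrow> two_units z c a"
  by (auto simp: two_units_def)

locale grid =
  fixes l1 r1 l2 r2 :: int
begin

definition D :: "cell set" where "D = {l1..r1} \<times> {l2..r2}"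

lemma finite_D [simp]: "finite D" by (simp add: D_def)

lemma D_iff: "p \<in> D \<longleftrightarrow> l1 \<le> fst p \<and> fst p \<le> r1 \<and> l2 \<le> snd p \<and> snd p \<le> r2"
  by (cases p) (auto simp: D_def)

text \<open>
  The integer kernel of the sufficient statistic of the success counts: \<open>x\<close> and \<open>y\<close> have the same
  statistic iff \<open>x - y\<close> is balanced.
\<close>
definition balanced :: "(cell \<Rightarrow> int) \<Rightarrow> bool" where
  "balanced z \<longleftrightarrow> (\<forall>p. p \<notin> D \<longrightarrow> z p = 0) \<and>
     (\<Sum>p\<in>D. z p) = 0 \<and> (\<Sum>p\<in>D. fst p * z p) = 0 \<and> (\<Sum>p\<in>D. snd p * z p) = 0"

text \<open>
  Closure under completing a parallelogram whose diagonal joins two positive units and whose third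
  corner is negative; this is what remains when no move reduces the distance.
\<close>
definition exchange_closed_up :: "(cell \<Rightarrow> int) \<Rightarrow> bool" where
  "exchange_closed_up z \<longleftrightarrow> (\<forall>a c b. two_units z a c \<longrightarrow> z b < 0 \<longrightarrow> a + c - b \<in> D \<longrightarrow> 0 < z (a + c - b))"

definition exchange_closed :: "(cell \<Rightarrow> int) \<Rightarrow> bool" where
  "exchange_closed z \<longleftrightarrow> exchange_closed_up z \<and> exchange_closed_up (- z)"

lemma balanced_uminus: "balanced z \<Longrightarrow> balanced (- z)"
  by (simp add: balanced_def sum_negf)

lemma exchange_closed_uminus: "exchange_closed z \<Longrightarrow> exchange_closed (- z)"
  by (simp add: exchange_closed_def)

lemma balanced_in_D: "balanced z \<Longrightarrow> z p \<noteq> 0 \<Longrightarrow> p \<in> D"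
  unfolding balanced_def by metis

lemma balanced_affine:
  assumes "balanced z" shows "(\<Sum>p\<in>D. (\<alpha> + \<beta> * fst p + \<gamma> * snd p) * z p) = 0"
proof -
  have "(\<Sum>p\<in>D. (\<alpha> + \<beta> * fst p + \<gamma> * snd p) * z p)
     = \<alpha> * (\<Sum>p\<in>D. z p) + \<beta> * (\<Sum>p\<in>D. fst p * z p) + \<gamma> * (\<Sum>p\<in>D. snd p * z p)"
    by (simp add: sum.distrib sum_distrib_left algebra_simps)
  then show ?thesis using assms by (simp add: balanced_def)
qed

lemma exchange_closed_down:
  assumes "exchange_closed z" "two_units (- z) b e" "0 < z a" "b + e - a \<in> D"
  shows "z (b + e - a) < 0"
  using assms unfolding exchange_closed_def exchange_closed_up_def by fastforce

text \<open>
  The grid is convex. Weights are integers with common denominator \<open>M\<close>.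
\<close>
lemma convex_combination_in_D:
  assumes "M * fst f = \<alpha> * fst p + \<beta> * fst q + \<gamma> * fst r"
    and "M * snd f = \<alpha> * snd p + \<beta> * snd q + \<gamma> * snd r"
    and "M = \<alpha> + \<beta> + \<gamma>" "0 < M" "0 \<le> \<alpha>" "0 \<le> \<beta>" "0 \<le> \<gamma>"
    and "p \<in> D" "q \<in> D" "r \<in> D"
  shows "f \<in> D"
proof -
  have *: "lo \<le> t \<and> t \<le> hi"
    if "M * t = \<alpha> * tp + \<beta> * tq + \<gamma> * tr" "lo \<le> tp" "tp \<le> hi" "lo \<le> tq" "tq \<le> hi" "lo \<le> tr" "tr \<le> hi"
    for t tp tq tr lo hi :: int
  proof -
    have "\<alpha> * lo \<le> \<alpha> * tp" "\<beta> * lo \<le> \<beta> * tq" "\<gamma> * lo \<le> \<gamma> * tr"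
      "\<alpha> * tp \<le> \<alpha> * hi" "\<beta> * tq \<le> \<beta> * hi" "\<gamma> * tr \<le> \<gamma> * hi"
      using assms that by (simp_all add: mult_left_mono)
    then have "M * lo \<le> M * t" "M * t \<le> M * hi"
      using that(1) assms(3) by (simp_all add: distrib_right)
    then show ?thesis using assms(4) by simp
  qed
  show ?thesis
    using *[OF assms(1), of l1 r1] *[OF assms(2), of l2 r2] assms(8-10) by (simp add: D_iff)
qed

text \<open>
  The segments \<open>a1 a2\<close> and \<open>b1 b2\<close> cross in a point with weights proportional to \<open>A1, A2\<close> and
  \<open>B1, B2\<close>. If \<open>a2\<close> has the least weight, the reflection \<open>f\<close> of \<open>a1\<close> at the midpoint of \<open>b1 b2\<close> is a
  convex combination of the other three points, so it lies in the grid and is negative. Rewriting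
  the relation by \<open>b2 = f + a1 - b1\<close> subtracts \<open>B2\<close> from the total weight, as in Euclid's algorithm.
\<close>
lemma crossing_step:
  assumes cl: "exchange_closed z" and sub: "\<And>p. z p \<noteq> 0 \<Longrightarrow> p \<in> D"
    and a: "two_units z a1 a2" and b: "two_units (- z) b1 b2"
    and w: "A1 + A2 = B1 + B2" "0 < A1 + A2" "0 \<le> A2" "A2 \<le> B2" "B2 \<le> B1"
    and m1: "A1 * fst a1 + A2 * fst a2 = B1 * fst b1 + B2 * fst b2"
    and m2: "A1 * snd a1 + A2 * snd a2 = B1 * snd b1 + B2 * snd b2"
  defines "f \<equiv> b1 + b2 - a1"
  shows "0 < B2" "two_units (- z) b1 f"
    "(A1 - B2) * fst a1 + A2 * fst a2 = (B1 - B2) * fst b1 + B2 * fst f"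
    "(A1 - B2) * snd a1 + A2 * snd a2 = (B1 - B2) * snd b1 + B2 * snd f"
proof -
  have ne: "a1 \<noteq> b1" "a1 \<noteq> b2" using a b by (auto simp: two_units_def)
  show pos: "0 < B2"
  proof (rule ccontr)
    assume "\<not> 0 < B2"
    then have z0: "B2 = 0" "A2 = 0" using w by auto
    then have "A1 = B1" "0 < A1" using w by auto
    then have "a1 = b1" using m1 m2 z0 by (simp add: prod_eq_iff)
    with ne show False by simp
  qed
  have "f \<in> D"
  proof (rule convex_combination_in_D[where M = A1 and \<alpha> = "A1 - B1" and \<beta> = "A1 - B2" and \<gamma> = A2])
    show "A1 * fst f = (A1 - B1) * fst b1 + (A1 - B2) * fst b2 + A2 * fst a2"
      using m1 by (simp add: f_def algebra_simps)
    show "A1 * snd f = (A1 - B1) * snd b1 + (A1 - B2) * snd b2 + A2 * snd a2"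
      using m2 by (simp add: f_def algebra_simps)
    show "A1 = A1 - B1 + (A1 - B2) + A2" "0 < A1" "0 \<le> A1 - B1" "0 \<le> A1 - B2" "0 \<le> A2"
      using w pos by linarith+
    show "b1 \<in> D" "b2 \<in> D" "a2 \<in> D" using sub a b by (auto simp: two_units_def)
  qed
  then have "z f < 0" using exchange_closed_down[OF cl b] a by (simp add: f_def two_units_def)
  moreover have "f \<noteq> b1" using ne by (simp add: f_def algebra_simps)
  ultimately show "two_units (- z) b1 f" using b by (auto simp: two_units_def)
  show "(A1 - B2) * fst a1 + A2 * fst a2 = (B1 - B2) * fst b1 + B2 * fst f"
    using m1 by (simp add: f_def algebra_simps)
  show "(A1 - B2) * snd a1 + A2 * snd a2 = (B1 - B2) * snd b1 + B2 * snd f"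
    using m2 by (simp add: f_def algebra_simps)
qed

text \<open>
  Descent on the total weight. The roles of the two segments and of their end points are exchanged
  until \<open>crossing_step\<close> applies; the hypothesis is symmetric under \<open>z \<mapsto> -z\<close>. Zero weights are
  allowed, so a positive cell on a segment between two negative ones is covered.
\<close>
lemma no_crossing:
  assumes "exchange_closed z" "\<And>p. z p \<noteq> 0 \<Longrightarrow> p \<in> D"
    and "two_units z a1 a2" "two_units (- z) b1 b2"
    and "A1 + A2 = B1 + B2" "0 < A1 + A2" "0 \<le> A1" "0 \<le> A2" "0 \<le> B1" "0 \<le> B2"
    and "A1 * fst a1 + A2 * fst a2 = B1 * fst b1 + B2 * fst b2"
    and "A1 * snd a1 + A2 * snd a2 = B1 * snd b1 + B2 * snd b2"
  shows False
proof -
  have main: "\<forall>z a1 a2 b1 b2 A1 A2 B1 B2. exchange_closed z \<longrightarrow> (\<forall>p. z p \<noteq> 0 \<longrightarrow> p \<in> D) \<longrightarrow>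
      two_units z a1 a2 \<longrightarrow> two_units (- z) b1 b2 \<longrightarrow> A1 + A2 = int M \<longrightarrow> B1 + B2 = int M \<longrightarrow> 0 < M \<longrightarrow>
      0 \<le> A1 \<longrightarrow> 0 \<le> A2 \<longrightarrow> 0 \<le> B1 \<longrightarrow> 0 \<le> B2 \<longrightarrow>
      A1 * fst a1 + A2 * fst a2 = B1 * fst b1 + B2 * fst b2 \<longrightarrow>
      A1 * snd a1 + A2 * snd a2 = B1 * snd b1 + B2 * snd b2 \<longrightarrow> False" for M
  proof (induction M rule: less_induct)
    case (less M)
    have ordered: False
      if H: "exchange_closed z" "\<forall>p. z p \<noteq> 0 \<longrightarrow> p \<in> D" "two_units z a1 a2" "two_units (- z) b1 b2"
        "A1 + A2 = int M" "B1 + B2 = int M" "0 < M" "0 \<le> A1" "0 \<le> A2" "0 \<le> B1" "0 \<le> B2"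
        "A1 * fst a1 + A2 * fst a2 = B1 * fst b1 + B2 * fst b2"
        "A1 * snd a1 + A2 * snd a2 = B1 * snd b1 + B2 * snd b2"
        and O: "A2 \<le> B2" "B2 \<le> B1" for z a1 a2 b1 b2 A1 A2 B1 B2
    proof -
      note st = crossing_step[OF H(1) _ H(3,4) _ _ H(9) O H(12,13)]
      let ?f = "b1 + b2 - a1"
      have "0 < B2" "two_units (- z) b1 ?f"
        "(A1 - B2) * fst a1 + A2 * fst a2 = (B1 - B2) * fst b1 + B2 * fst ?f"
        "(A1 - B2) * snd a1 + A2 * snd a2 = (B1 - B2) * snd b1 + B2 * snd ?f"
        using st H by auto
      moreover have "nat (int M - B2) < M" "(A1 - B2) + A2 = int (nat (int M - B2))"
        "(B1 - B2) + B2 = int (nat (int M - B2))" "0 < nat (int M - B2)" "0 \<le> A1 - B2" "0 \<le> B1 - B2"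
        using H O \<open>0 < B2\<close> by auto
      ultimately show False
        using less.IH H(1,2,3,9,11) by blast
    qed
    have ordered': False
      if H: "exchange_closed z" "\<forall>p. z p \<noteq> 0 \<longrightarrow> p \<in> D" "two_units z a1 a2" "two_units (- z) b1 b2"
        "A1 + A2 = int M" "B1 + B2 = int M" "0 < M" "0 \<le> A1" "0 \<le> A2" "0 \<le> B1" "0 \<le> B2"
        "A1 * fst a1 + A2 * fst a2 = B1 * fst b1 + B2 * fst b2"
        "A1 * snd a1 + A2 * snd a2 = B1 * snd b1 + B2 * snd b2"
        and O: "A2 \<le> A1" "B2 \<le> B1" for z a1 a2 b1 b2 A1 A2 B1 B2
    proof (cases "A2 \<le> B2")
      case True
      then show False using ordered[OF H] O by blast
    next
      case False
      have "two_units (- (- z)) a1 a2" "\<forall>p. (- z) p \<noteq> 0 \<longrightarrow> p \<in> D" using H by auto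
      from ordered[OF exchange_closed_uminus[OF H(1)] this(2) H(4) this(1) H(6,5,7,10,11,8,9) H(12)[symmetric] H(13)[symmetric]]
      show False using False O by auto
    qed
    show ?case
    proof (intro allI impI)
      fix z a1 a2 b1 b2 A1 A2 B1 B2
      assume H: "exchange_closed z" "\<forall>p. z p \<noteq> 0 \<longrightarrow> p \<in> D" "two_units z a1 a2" "two_units (- z) b1 b2"
        "A1 + A2 = int M" "B1 + B2 = int M" "0 < M" "0 \<le> A1" "0 \<le> A2" "0 \<le> B1" "0 \<le> B2"
        "A1 * fst a1 + A2 * fst a2 = B1 * fst b1 + B2 * fst b2"
        "A1 * snd a1 + A2 * snd a2 = B1 * snd b1 + B2 * snd b2"
      note sw = two_units_commute[OF H(3)] two_units_commute[OF H(4)]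
      consider "A2 \<le> A1" "B2 \<le> B1" | "A2 \<le> A1" "B1 \<le> B2" | "A1 \<le> A2" "B2 \<le> B1" | "A1 \<le> A2" "B1 \<le> B2"
        by linarith
      then show False
      proof cases
        case 1 then show ?thesis using ordered'[OF H] by blast
      next
        case 2 then show ?thesis
          using ordered'[of z a1 a2 b2 b1 A1 A2 B2 B1] H sw by (simp add: add.commute)
      next
        case 3 then show ?thesis
          using ordered'[of z a2 a1 b1 b2 A2 A1 B1 B2] H sw by (simp add: add.commute)
      next
        case 4 then show ?thesis
          using ordered'[of z a2 a1 b2 b1 A2 A1 B2 B1] H sw by (simp add: add.commute)
      qed
    qed
  qed
  have "A1 + A2 = int (nat (A1 + A2))" "B1 + B2 = int (nat (A1 + A2))" "0 < nat (A1 + A2)"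
    using assms(5,6) by simp_all
  then show False
    using main[rule_format, OF assms(1) _ assms(3,4) _ _ _ assms(7-12)] assms(2) by blast
qed

end

section \<open>Circuits\<close>

context grid begin

definition conformal :: "(cell \<Rightarrow> int) \<Rightarrow> (cell \<Rightarrow> int) \<Rightarrow> bool" where
  "conformal w z \<longleftrightarrow> (\<forall>p. (0 < w p \<longrightarrow> 0 < z p) \<and> (w p < 0 \<longrightarrow> z p < 0))"

text \<open>
  A nonzero balanced array of minimal support, as in the theory of oriented matroids: any other
  balanced array supported there has the same support.
\<close>
definition circuit :: "(cell \<Rightarrow> int) \<Rightarrow> bool" where
  "circuit w \<longleftrightarrow> balanced w \<and> (\<exists>p. w p \<noteq> 0) \<and>
     (\<forall>v. balanced v \<longrightarrow> (\<exists>p. v p \<noteq> 0) \<longrightarrow> (\<forall>p. w p = 0 \<longrightarrow> v p = 0) \<longrightarrow> (\<forall>p. v p = 0 \<longrightarrow> w p = 0))"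

lemma balanced_combination:
  assumes "balanced v" "balanced w" shows "balanced (\<lambda>p. \<alpha> * w p - \<beta> * v p)"
proof -
  have *: "(\<Sum>p\<in>D. c p * (\<alpha> * w p - \<beta> * v p)) = \<alpha> * (\<Sum>p\<in>D. c p * w p) - \<beta> * (\<Sum>p\<in>D. c p * v p)" for c
    by (simp add: sum_subtractf sum_distrib_left algebra_simps)
  show ?thesis
    using assms *[of "\<lambda>_. 1"] *[of fst] *[of snd] by (simp add: balanced_def)
qed

text \<open>
  Subtract the largest multiple of \<open>v\<close> that changes no sign of \<open>w\<close>; it annihilates some cell \<open>r\<close> of
  the support, the one with the least ratio, while \<open>q\<close> survives because \<open>v q = 0\<close>.
\<close>
lemma shrink_support:
  assumes v: "balanced v" and w: "balanced w" and sub: "\<And>p. w p = 0 \<Longrightarrow> v p = 0"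
    and p0: "v p0 \<noteq> 0" and q: "v q = 0" "w q \<noteq> 0"
  obtains w' r where "balanced w'" "conformal w' w" "w' q \<noteq> 0" "w r \<noteq> 0" "w' r = 0"
proof -
  note result = that
  have gen: thesis if v: "balanced v" and sub: "\<And>p. w p = 0 \<Longrightarrow> v p = 0" and vq: "v q = 0"
      and p0: "0 < v p0 * w p0" for v
  proof -
    let ?S = "{p \<in> D. 0 < v p * w p}"
    have inS: "p \<in> ?S" if "0 < v p * w p" for p
    proof -
      have "w p \<noteq> 0" using that by auto
      then show ?thesis using that balanced_in_D[OF w] by simp
    qed
    let ?ratio = "\<lambda>p. of_int \<bar>w p\<bar> / of_int \<bar>v p\<bar> :: real"
    have ne: "finite ?S" "?S \<noteq> {}" using inS[OF p0] by (simp, blast)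
    then have "Min (?ratio ` ?S) \<in> ?ratio ` ?S" by (intro Min_in) auto
    then obtain r where r: "r \<in> ?S" "Min (?ratio ` ?S) = ?ratio r" by (rule imageE)
    have least: "?ratio r \<le> ?ratio p" if "p \<in> ?S" for p
      using r(2) Min_le[of "?ratio ` ?S" "?ratio p"] ne that by simp
    have pos: "0 < \<bar>v r\<bar>" "0 < \<bar>w r\<bar>" using r(1) by auto
    have cmp: "\<bar>w r\<bar> * \<bar>v p\<bar> \<le> \<bar>v r\<bar> * \<bar>w p\<bar>" if "0 < v p * w p" for p
    proof -
      have "p \<in> ?S" using that by (rule inS)
      moreover have "0 < \<bar>v p\<bar>" using that by auto
      ultimately have "of_int (\<bar>w r\<bar> * \<bar>v p\<bar>) \<le> (of_int (\<bar>v r\<bar> * \<bar>w p\<bar>) :: real)"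
        using least[of p] pos by (simp add: field_simps)
      then show ?thesis by (simp only: of_int_le_iff)
    qed
    let ?w = "\<lambda>p. \<bar>v r\<bar> * w p - \<bar>w r\<bar> * v p"
    have "conformal ?w w" unfolding conformal_def
    proof (intro allI conjI impI)
      fix p
      have c: "0 < v p \<Longrightarrow> 0 < w p \<Longrightarrow> \<bar>w r\<bar> * v p \<le> \<bar>v r\<bar> * w p"
        "v p < 0 \<Longrightarrow> w p < 0 \<Longrightarrow> \<bar>v r\<bar> * w p \<le> \<bar>w r\<bar> * v p"
        using cmp[of p] by (simp_all add: mult_neg_neg)
      have d: "0 \<le> v p \<Longrightarrow> w p < 0 \<Longrightarrow> ?w p < 0" "v p \<le> 0 \<Longrightarrow> 0 < w p \<Longrightarrow> 0 < ?w p"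
        using pos by (smt (verit) mult_nonneg_nonneg mult_pos_neg mult_pos_pos mult_nonneg_nonpos)+
      show "0 < ?w p \<Longrightarrow> 0 < w p" "?w p < 0 \<Longrightarrow> w p < 0"
        using c d sub[of p] by (cases "w p = 0"; force)+
    qed
    moreover have "?w q \<noteq> 0" using vq q pos by simp
    moreover have "?w r = 0" using r(1) by (auto simp: abs_if zero_less_mult_iff)
    ultimately show thesis
      using result[of ?w r] balanced_combination[OF v w] pos by auto
  qed
  show thesis
  proof (cases "0 < v p0 * w p0")
    case True then show ?thesis using gen v sub q by blast
  next
    case False
    have "v p0 * w p0 \<noteq> 0" using p0 sub[of p0] by auto
    then have "0 < (- v) p0 * w p0" using False by (simp add: not_less order_less_le)
    then show ?thesis using gen[of "- v"] balanced_uminus[OF v] sub q by auto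
  qed
qed

lemma ex_circuit:
  assumes z: "balanced z" and "z p \<noteq> 0"
  obtains w where "circuit w" "conformal w z"
proof -
  let ?P = "\<lambda>w. balanced w \<and> (\<exists>p. w p \<noteq> 0) \<and> conformal w z"
  have "?P z" using assms(1) exI[of "\<lambda>p. z p \<noteq> 0" p, OF assms(2)] by (simp add: conformal_def)
  then obtain w where w: "?P w" and least: "\<And>w'. ?P w' \<Longrightarrow> card {p. w p \<noteq> 0} \<le> card {p. w' p \<noteq> 0}"
    using ex_has_least_nat[of ?P z "\<lambda>w. card {p. w p \<noteq> 0}"] by blast
  have "circuit w" unfolding circuit_def
  proof (intro conjI allI impI)
    fix v q assume v: "balanced v" "\<exists>p. v p \<noteq> 0" "\<forall>p. w p = 0 \<longrightarrow> v p = 0" "v q = 0"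
    show "w q = 0"
    proof (rule ccontr)
      assume q: "w q \<noteq> 0"
      obtain p0 where p0: "v p0 \<noteq> 0" using v(2) by blast
      have w1: "balanced w" and sub: "\<And>p. w p = 0 \<Longrightarrow> v p = 0" using w v(3) by blast+
      obtain w' r where w': "balanced w'" "conformal w' w" "w' q \<noteq> 0" "w r \<noteq> 0" "w' r = 0"
        by (rule shrink_support[OF v(1) w1 sub p0 v(4) q])
      have wz: "conformal w z" using w by blast
      have "conformal w' z" unfolding conformal_def
        using w'(2)[unfolded conformal_def] wz[unfolded conformal_def] by simp
      then have "?P w'" using w'(1,3) by blast
      then have "card {p. w p \<noteq> 0} \<le> card {p. w' p \<noteq> 0}" by (rule least)
      moreover have "{p. w' p \<noteq> 0} \<subseteq> {p. w p \<noteq> 0} - {r}"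
      proof
        fix p assume "p \<in> {p. w' p \<noteq> 0}"
        then have "w' p < 0 \<or> 0 < w' p" by auto
        then have "w p \<noteq> 0" using w'(2)[unfolded conformal_def, rule_format, of p] by auto
        then show "p \<in> {p. w p \<noteq> 0} - {r}" using \<open>w' p < 0 \<or> 0 < w' p\<close> w'(5) by auto
      qed
      moreover have fin: "finite {p. w p \<noteq> 0}"
        by (rule finite_subset[OF _ finite_D]) (use balanced_in_D[OF w1] in blast)
      ultimately show False
        using card_mono[of "{p. w p \<noteq> 0} - {r}" "{p. w' p \<noteq> 0}"] card_Diff1_less[OF fin, of r] w'(4) by simp
    qed
  qed (use w in blast)+
  moreover have "conformal w z" using w by blast
  ultimately show thesis by (rule that)
qed

text \<open>
Twice the signed area of the triangle \<open>p q r\<close>.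
\<close>
definition area :: "cell \<Rightarrow> cell \<Rightarrow> cell \<Rightarrow> int" where
  "area p q r = (fst q - fst p) * (snd r - snd p) - (fst r - fst p) * (snd q - snd p)"

lemma balanced_points:
  assumes "set ps \<subseteq> D" "sum_list (map d ps) = 0" "sum_list (map (\<lambda>p. fst p * d p) ps) = 0"
    "sum_list (map (\<lambda>p. snd p * d p) ps) = 0" "distinct ps"
  shows "balanced (\<lambda>p. if p \<in> set ps then d p else 0)"
proof -
  have "(\<Sum>p\<in>D. c p * (if p \<in> set ps then d p else 0)) = sum_list (map (\<lambda>p. c p * d p) ps)" for c
  proof -
    have "(\<Sum>p\<in>D. c p * (if p \<in> set ps then d p else 0)) = (\<Sum>p\<in>D. if p \<in> set ps then c p * d p else 0)"
      by (intro sum.cong) auto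
    also have "\<dots> = (\<Sum>p\<in>D \<inter> set ps. c p * d p)" by (simp add: sum.If_cases)
    also have "D \<inter> set ps = set ps" using assms by auto
    finally show ?thesis using assms by (simp add: sum_list_distinct_conv_sum_set)
  qed
  from this[of "\<lambda>_. 1"] this[of fst] this[of snd] show ?thesis
    using assms by (auto simp: balanced_def)
qed

text \<open>
  The coefficients are differences of whichever coordinate \<open>c\<close> separates \<open>p\<close> from \<open>q\<close>; the equation
  for the other coordinate is the vanishing of the area.
\<close>
lemma collinear_dependent:
  assumes "area p q r = 0" "p \<in> D" "q \<in> D" "r \<in> D" "p \<noteq> q" "p \<noteq> r" "q \<noteq> r"
  obtains v where "balanced v" "\<exists>s. v s \<noteq> 0" "\<And>s. s \<notin> {p, q, r} \<Longrightarrow> v s = 0"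
proof -
  note result = that
  have gen: thesis if c: "c p * (c r - c q) + c q * (c p - c r) + c r * (c q - c p) = 0"
     "fst p * (c r - c q) + fst q * (c p - c r) + fst r * (c q - c p) = 0"
     "snd p * (c r - c q) + snd q * (c p - c r) + snd r * (c q - c p) = 0" "c p \<noteq> c q" for c :: "cell \<Rightarrow> int"
  proof -
    let ?d = "\<lambda>s. if s = p then c r - c q else if s = q then c p - c r else c q - c p"
    have "balanced (\<lambda>s. if s \<in> set [p, q, r] then ?d s else 0)"
      using assms c by (intro balanced_points) (auto simp: algebra_simps)
    moreover have "(if r \<in> set [p, q, r] then ?d r else 0) \<noteq> 0" using c(4) assms by simp
    then have "\<exists>s. (if s \<in> set [p, q, r] then ?d s else 0) \<noteq> 0" by (rule exI)
    ultimately show thesis by (rule result) simp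
  qed
  show thesis
  proof (cases "fst p = fst q")
    case True
    then have "snd p \<noteq> snd q" using assms by (simp add: prod_eq_iff)
    then show ?thesis using gen[of snd] assms(1) by (simp add: area_def algebra_simps)
  next
    case False
    then show ?thesis using gen[of fst] assms(1) by (simp add: area_def algebra_simps)
  qed
qed

text \<open>
  Cramer's rule: the coefficients are the signed areas of the triangles formed by the other three
  points.
\<close>
lemma four_dependent:
  assumes "p \<in> D" "q \<in> D" "r \<in> D" "s \<in> D" "distinct [p, q, r, s]"
  obtains v where "balanced v" "\<exists>t. v t \<noteq> 0" "\<And>t. t \<notin> {p, q, r, s} \<Longrightarrow> v t = 0"
proof (cases "area q r s = 0")
  case True
  then show ?thesis using collinear_dependent[OF True] assms that
    by (metis distinct_length_2_or_more insert_iff)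
next
  case False
  let ?d = "\<lambda>t. if t = p then area q r s else if t = q then - area p r s
    else if t = r then area p q s else - area p q r"
  have "balanced (\<lambda>t. if t \<in> set [p, q, r, s] then ?d t else 0)"
    using assms by (intro balanced_points) (auto simp: area_def algebra_simps)
  moreover have "(if p \<in> set [p, q, r, s] then ?d p else 0) \<noteq> 0" using False by simp
  then have "\<exists>t. (if t \<in> set [p, q, r, s] then ?d t else 0) \<noteq> 0" by (rule exI)
  ultimately show thesis by (rule that) simp
qed

lemma circuit_card:
  assumes w: "circuit w" shows "card {p. w p \<noteq> 0} \<le> 4"
proof (rule ccontr)
  assume "\<not> card {p. w p \<noteq> 0} \<le> 4"
  then have "5 \<le> card {p. w p \<noteq> 0}" by simp
  then obtain T where T: "T \<subseteq> {p. w p \<noteq> 0}" "card T = 5" "finite T"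
    by (metis obtain_subset_with_card_n)
  then obtain xs where xs: "set xs = T" "distinct xs" "length xs = 5"
    by (metis distinct_card finite_distinct_list)
  then obtain p q r s t where l: "xs = [p, q, r, s, t]"
    by (auto simp: eval_nat_numeral length_Suc_conv)
  have "{p, q, r, s, t} \<subseteq> D" using T xs l w balanced_in_D unfolding circuit_def by auto
  then have inD: "p \<in> D" "q \<in> D" "r \<in> D" "s \<in> D" by simp_all
  have "distinct [p, q, r, s]" using xs(2) l by simp
  from four_dependent[OF inD this] obtain v
    where v: "balanced v" "\<exists>t. v t \<noteq> 0" "\<And>t. t \<notin> {p, q, r, s} \<Longrightarrow> v t = 0" by metis
  have "v t = 0" using v(3)[of t] xs l by auto
  moreover have "w t \<noteq> 0" using xs l T by auto
  moreover have "\<forall>y. w y = 0 \<longrightarrow> v y = 0"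
  proof (intro allI impI)
    fix y assume "w y = 0"
    then have "y \<notin> {p, q, r, s}" using xs l T by auto
    then show "v y = 0" by (rule v(3))
  qed
  ultimately show False using w v(1,2) unfolding circuit_def by metis
qed

end

section \<open>Triangles\<close>

context grid begin

text \<open>
  A single positive unit would be opposed by a single negative one with the same position.
\<close>
lemma second_unit:
  assumes z: "balanced z" and a: "0 < z a"
  obtains c where "two_units z a c"
proof (cases "2 \<le> z a")
  case True then show ?thesis using a that[of a] by (simp add: two_units_def)
next
  case False
  then have za: "z a = 1" using a by simp
  show ?thesis
  proof (cases "\<exists>c. c \<noteq> a \<and> 0 < z c")
    case True then show ?thesis using a that by (auto simp: two_units_def)
  next
    case False
    then have nonpos: "z c \<le> 0" if "c \<noteq> a" for c using that not_less by metis
    have aD: "a \<in> D" using balanced_in_D[OF z, of a] a by simp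
    have s: "(\<Sum>p\<in>D - {a}. z p) = -1"
      using z za sum.remove[OF finite_D aD, of z] by (simp add: balanced_def)
    then obtain b where b: "b \<in> D - {a}" "z b \<noteq> 0" by (metis sum.neutral zero_neq_neg_one)
    have "(\<Sum>p\<in>D - {a} - {b}. z p) = -1 - z b"
      using s b sum.remove[of "D - {a}" b z] by simp
    moreover have "(\<Sum>p\<in>D - {a} - {b}. z p) \<le> 0" using nonpos by (intro sum_nonpos) simp
    moreover have "z b \<le> -1" using nonpos[of b] b by simp
    ultimately have zb: "z b = -1" and "(\<Sum>p\<in>D - {a} - {b}. - z p) = 0"
      by (simp_all add: sum_negf)
    then have rest: "\<forall>p\<in>D - {a} - {b}. - z p = 0"
      using nonpos by (subst (asm) sum_nonneg_eq_0_iff) auto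
    have "(\<Sum>p\<in>D. f p * z p) = f a - f b" for f :: "cell \<Rightarrow> int"
    proof -
      have "(\<Sum>p\<in>D - {a} - {b}. f p * z p) = 0" using rest by (intro sum.neutral) simp
      then have "(\<Sum>p\<in>D - {a}. f p * z p) = - f b"
        using sum.remove[of "D - {a}" b "\<lambda>p. f p * z p"] b zb by simp
      then show ?thesis using sum.remove[OF finite_D aD, of "\<lambda>p. f p * z p"] za by simp
    qed
    from this[of fst] this[of snd] z have "a = b" by (simp add: balanced_def prod_eq_iff)
    then show ?thesis using b by simp
  qed
qed

text \<open>
  \<open>L1, L2, L3\<close> are barycentric coordinates for the triangle \<open>a1 a2 a3\<close>, scaled by \<open>\<Delta>\<close> to be integers.
  The last clause is what affine linearity and \<open>Li ai = \<Delta>\<close> yield for reflections.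
\<close>
definition bary where
  "bary \<Delta> a1 a2 a3 L1 L2 L3 \<longleftrightarrow> 0 < \<Delta> \<and>
    (\<forall>e :: cell. L1 e + L2 e + L3 e = (\<Delta>::int) \<and>
       \<Delta> * fst e = L1 e * fst a1 + L2 e * fst a2 + L3 e * fst a3 \<and>
       \<Delta> * snd e = L1 e * snd a1 + L2 e * snd a2 + L3 e * snd a3) \<and>
    (\<forall>p q :: cell. L1 (p + q - a1) = L1 p + L1 q - \<Delta> \<and> L2 (p + q - a2) = L2 p + L2 q - \<Delta> \<and>
       L3 (p + q - a3) = L3 p + L3 q - \<Delta>)"

lemma bary_rotate: "bary \<Delta> a1 a2 a3 L1 L2 L3 \<Longrightarrow> bary \<Delta> a2 a3 a1 L2 L3 L1"
  unfolding bary_def by (simp_all add: ac_simps)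

lemma bary_area:
  assumes "0 < area a1 a2 a3"
  shows "bary (area a1 a2 a3) a1 a2 a3 (\<lambda>e. area e a2 a3) (\<lambda>e. area a1 e a3) (\<lambda>e. area a1 a2 e)"
  using assms unfolding bary_def by (auto simp: area_def algebra_simps)

text \<open>
  The segment from \<open>b\<close>, inside the triangle \<open>a1 a2 a3\<close>, to \<open>e\<close> leaves the triangle. If it reaches the
  line \<open>a2 a3\<close> not later than the lines of the other two edges, it crosses the edge \<open>a2 a3\<close>, which is
  impossible. The weights of the crossing are the barycentric coordinates of the exit point.
\<close>
lemma exit_edge:
  assumes cl: "exchange_closed z" and sub: "\<And>p. z p \<noteq> 0 \<Longrightarrow> p \<in> D"
    and B: "bary \<Delta> a1 a2 a3 L1 L2 L3"
    and a: "0 < z a2" "0 < z a3" "a2 \<noteq> a3" and be: "two_units (- z) b e"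
    and Lb: "0 < L1 b" and Le: "L1 e \<le> 0"
    and "L1 e * L2 b \<le> L1 b * L2 e" "L1 e * L3 b \<le> L1 b * L3 e"
  shows False
proof -
  have \<Delta>: "0 < \<Delta>" and s: "\<And>e. L1 e + L2 e + L3 e = \<Delta>"
    and f: "\<And>e. \<Delta> * fst e = L1 e * fst a1 + L2 e * fst a2 + L3 e * fst a3"
    and g: "\<And>e. \<Delta> * snd e = L1 e * snd a1 + L2 e * snd a2 + L3 e * snd a3"
    using B unfolding bary_def by blast+
  have aa: "two_units z a2 a3" using a by (simp add: two_units_def)
  \<comment> \<open>\<open>L1 b * e - L1 e * b\<close> has first coordinate \<open>0\<close>, so it is a combination of \<open>a2\<close> and \<open>a3\<close>\<close>
  have lin: "(L1 b * L2 e - L1 e * L2 b) * c2 + (L1 b * L3 e - L1 e * L3 b) * c3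
     = \<Delta> * (- L1 e) * cb + \<Delta> * L1 b * ce"
    if "\<Delta> * cb = L1 b * c1 + L2 b * c2 + L3 b * c3" "\<Delta> * ce = L1 e * c1 + L2 e * c2 + L3 e * c3"
    for c1 c2 c3 cb ce :: int
  proof -
    have "\<Delta> * (- L1 e) * cb + \<Delta> * L1 b * ce = L1 b * (\<Delta> * ce) - L1 e * (\<Delta> * cb)" by simp
    then show ?thesis unfolding that by (simp add: algebra_simps)
  qed
  show False
  proof (rule no_crossing[OF cl sub aa be])
    show "(L1 b * L2 e - L1 e * L2 b) + (L1 b * L3 e - L1 e * L3 b) = \<Delta> * (- L1 e) + \<Delta> * L1 b"
      using lin[of 1 1 1 1 1] s[of b] s[of e] by simp
    then show "0 < (L1 b * L2 e - L1 e * L2 b) + (L1 b * L3 e - L1 e * L3 b)"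
      using \<Delta> Lb Le by (simp add: add_nonneg_pos mult_nonneg_nonpos)
  qed (use lin[OF f f] lin[OF g g] \<Delta> Lb Le assms(10,11) in \<open>simp_all add: mult_nonneg_nonpos\<close>)
qed

text \<open>
  The edge through which the segment from \<open>b\<close> to \<open>e\<close> leaves is the one whose ratio of coordinates
  \<open>Li e / Li b\<close> is least.
\<close>
lemma inside_triangle:
  assumes cl: "exchange_closed z" and sub: "\<And>p. z p \<noteq> 0 \<Longrightarrow> p \<in> D"
    and B: "bary \<Delta> a1 a2 a3 L1 L2 L3"
    and a: "0 < z a1" "0 < z a2" "0 < z a3" "a1 \<noteq> a2" "a1 \<noteq> a3" "a2 \<noteq> a3"
    and b: "z b < 0" "0 < L1 b" "0 < L2 b" "0 < L3 b" and e: "z e < 0"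
  shows "0 < L1 e \<and> 0 < L2 e \<and> 0 < L3 e"
proof (rule ccontr)
  assume out: "\<not> ?thesis"
  then have "e \<noteq> b" using b by auto
  then have be: "two_units (- z) b e" using b e by (simp add: two_units_def)
  have comp: "u / v \<le> w / x \<longleftrightarrow> u * x \<le> w * v" if "0 < v" "0 < x" for u v w x :: real
    using that by (simp add: divide_le_eq pos_le_divide_eq field_simps)
  let ?t1 = "of_int (L1 e) / of_int (L1 b) :: real"
  let ?t2 = "of_int (L2 e) / of_int (L2 b) :: real"
  let ?t3 = "of_int (L3 e) / of_int (L3 b) :: real"
  have c: "?t1 \<le> ?t2 \<longleftrightarrow> L1 e * L2 b \<le> L1 b * L2 e" "?t1 \<le> ?t3 \<longleftrightarrow> L1 e * L3 b \<le> L1 b * L3 e"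
    "?t2 \<le> ?t1 \<longleftrightarrow> L2 e * L1 b \<le> L2 b * L1 e" "?t2 \<le> ?t3 \<longleftrightarrow> L2 e * L3 b \<le> L2 b * L3 e"
    "?t3 \<le> ?t1 \<longleftrightarrow> L3 e * L1 b \<le> L3 b * L1 e" "?t3 \<le> ?t2 \<longleftrightarrow> L3 e * L2 b \<le> L3 b * L2 e"
    using b by (simp_all add: comp mult.commute flip: of_int_mult)
  have le: "?t1 \<le> 0 \<longleftrightarrow> L1 e \<le> 0" "?t2 \<le> 0 \<longleftrightarrow> L2 e \<le> 0" "?t3 \<le> 0 \<longleftrightarrow> L3 e \<le> 0"
    using b by (simp_all add: divide_le_0_iff)
  have out': "?t1 \<le> 0 \<or> ?t2 \<le> 0 \<or> ?t3 \<le> 0" using out unfolding le by auto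
  consider "?t1 \<le> ?t2" "?t1 \<le> ?t3" | "?t2 \<le> ?t1" "?t2 \<le> ?t3" | "?t3 \<le> ?t1" "?t3 \<le> ?t2"
    by linarith
  then show False
  proof cases
    case 1
    then have "L1 e \<le> 0" using out' le by linarith
    then show False using exit_edge[OF cl sub B a(2,3,6) be b(2)] 1 c by blast
  next
    case 2
    then have "L2 e \<le> 0" using out' le by linarith
    then show False
      using exit_edge[OF cl sub bary_rotate[OF B] a(3,1) a(5)[symmetric] be b(3)] 2 c by blast
  next
    case 3
    then have "L3 e \<le> 0" using out' le by linarith
    then show False
      using exit_edge[OF cl sub bary_rotate[OF bary_rotate[OF B]] a(1,2,4) be b(4)] 3 c by blast
  qed
qed

text \<open>
  The weights \<open>\<Delta> - mi\<close> are positive with sum \<open>\<Delta>\<close>, and the average of the pair sums with these weights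
  is exactly \<open>s\<close>.
\<close>
lemma not_all_pair_sums:
  fixes s :: int
  assumes "\<Delta> * s = m1 * t1 + m2 * t2 + m3 * t3" "m1 + m2 + m3 = 2 * \<Delta>" "m1 < \<Delta>" "m2 < \<Delta>" "m3 < \<Delta>"
  shows "\<not> (t1 + t2 < s \<and> t1 + t3 < s \<and> t2 + t3 < s)"
proof
  assume lt: "t1 + t2 < s \<and> t1 + t3 < s \<and> t2 + t3 < s"
  have "(\<Delta> - m3) * (t1 + t2) < (\<Delta> - m3) * s" "(\<Delta> - m2) * (t1 + t3) < (\<Delta> - m2) * s"
    "(\<Delta> - m1) * (t2 + t3) < (\<Delta> - m1) * s"
    using lt assms by simp_all
  then have "(\<Delta> - m3) * (t1 + t2) + (\<Delta> - m2) * (t1 + t3) + (\<Delta> - m1) * (t2 + t3)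
      < (3 * \<Delta> - (m1 + m2 + m3)) * s" by (simp add: algebra_simps)
  moreover have "(\<Delta> - m3) * (t1 + t2) + (\<Delta> - m2) * (t1 + t3) + (\<Delta> - m1) * (t2 + t3)
     = (2 * \<Delta> - (m1 + m2 + m3)) * (t1 + t2 + t3) + (m1 * t1 + m2 * t2 + m3 * t3)"
    by (simp add: algebra_simps)
  ultimately show False unfolding assms(2) assms(1)[symmetric] by simp
qed

text \<open>
  In one coordinate at most one of the three vertices is reflected out of the range of the grid. A
  reflection of \<open>t1\<close> that is too large makes \<open>s\<close> exceed both pair sums containing \<open>t1\<close>, and similarly
  for \<open>t2\<close>; as the sum \<open>t1 + t2\<close> is common to both, the two errors have the same direction, and \<open>s\<close>
  would exceed all three pair sums or fall short of all of them.
\<close>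
lemma one_bad_reflection:
  fixes s :: int
  assumes "\<Delta> * s = m1 * t1 + m2 * t2 + m3 * t3" "m1 + m2 + m3 = 2 * \<Delta>" "m1 < \<Delta>" "m2 < \<Delta>" "m3 < \<Delta>"
    and "lo \<le> t1" "t1 \<le> hi" "lo \<le> t2" "t2 \<le> hi" "lo \<le> t3" "t3 \<le> hi"
    and "\<not> (lo \<le> s - t1 \<and> s - t1 \<le> hi)"
  shows "lo \<le> s - t2 \<and> s - t2 \<le> hi"
proof (rule ccontr)
  assume "\<not> ?thesis"
  moreover have "\<not> (t1 + t2 < s \<and> t1 + t3 < s \<and> t2 + t3 < s)"
    using assms by (intro not_all_pair_sums)
  moreover have "\<not> (- t1 + - t2 < - s \<and> - t1 + - t3 < - s \<and> - t2 + - t3 < - s)"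
    using assms by (intro not_all_pair_sums[of \<Delta> _ m1 _ m2 _ m3]) auto
  ultimately show False using assms by linarith
qed

text \<open>
  If the midpoint of \<open>p q\<close> has barycentric coordinate at least one half at some vertex, the reflection
  of this vertex stays in the triangle. Otherwise each of the two coordinates spoils at most one of
  the three vertices, so one vertex is left. This pigeonhole is where the proof is bound to
  dimension two.
\<close>
lemma some_reflection_in_D:
  assumes B: "bary \<Delta> a1 a2 a3 L1 L2 L3" and aD: "a1 \<in> D" "a2 \<in> D" "a3 \<in> D"
    and p: "0 < L1 p" "0 < L2 p" "0 < L3 p" and q: "0 < L1 q" "0 < L2 q" "0 < L3 q"
  shows "p + q - a1 \<in> D \<or> p + q - a2 \<in> D \<or> p + q - a3 \<in> D"
proof -
  have \<Delta>: "0 < \<Delta>" and s: "\<And>e. L1 e + L2 e + L3 e = \<Delta>"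
    and f: "\<And>e. \<Delta> * fst e = L1 e * fst a1 + L2 e * fst a2 + L3 e * fst a3"
    and g: "\<And>e. \<Delta> * snd e = L1 e * snd a1 + L2 e * snd a2 + L3 e * snd a3"
    using B unfolding bary_def by blast+
  define m1 m2 m3 where "m1 = L1 p + L1 q" and "m2 = L2 p + L2 q" and "m3 = L3 p + L3 q"
  have m: "0 < m1" "0 < m2" "0 < m3" "m1 + m2 + m3 = 2 * \<Delta>"
    using p q s[of p] s[of q] by (simp_all add: m1_def m2_def m3_def)
  have F: "\<Delta> * fst (p + q) = m1 * fst a1 + m2 * fst a2 + m3 * fst a3"
    using f[of p] f[of q] by (simp add: m1_def m2_def m3_def algebra_simps)
  have G: "\<Delta> * snd (p + q) = m1 * snd a1 + m2 * snd a2 + m3 * snd a3"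
    using g[of p] g[of q] by (simp add: m1_def m2_def m3_def algebra_simps)
  consider "\<Delta> \<le> m1" | "\<Delta> \<le> m2" | "\<Delta> \<le> m3" | "m1 < \<Delta>" "m2 < \<Delta>" "m3 < \<Delta>" by linarith
  then show ?thesis
  proof cases
    case 1
    have "p + q - a1 \<in> D"
      by (rule convex_combination_in_D[where M = \<Delta> and \<alpha> = "m1 - \<Delta>" and \<beta> = m2 and \<gamma> = m3, OF _ _ _ _ _ _ _ aD])
        (use 1 \<Delta> m F G in \<open>simp_all add: algebra_simps\<close>)
    then show ?thesis by simp
  next
    case 2
    have "p + q - a2 \<in> D"
      by (rule convex_combination_in_D[where M = \<Delta> and \<alpha> = m1 and \<beta> = "m2 - \<Delta>" and \<gamma> = m3, OF _ _ _ _ _ _ _ aD])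
        (use 2 \<Delta> m F G in \<open>simp_all add: algebra_simps\<close>)
    then show ?thesis by simp
  next
    case 3
    have "p + q - a3 \<in> D"
      by (rule convex_combination_in_D[where M = \<Delta> and \<alpha> = m1 and \<beta> = m2 and \<gamma> = "m3 - \<Delta>", OF _ _ _ _ _ _ _ aD])
        (use 3 \<Delta> m F G in \<open>simp_all add: algebra_simps\<close>)
    then show ?thesis by simp
  next
    case 4
    have "m2 + m1 + m3 = 2 * \<Delta>" "m1 + m3 + m2 = 2 * \<Delta>" "m2 + m3 + m1 = 2 * \<Delta>" using m by simp_all
    note rot = m(4) this
    have F': "\<Delta> * fst (p + q) = m1 * fst a1 + m3 * fst a3 + m2 * fst a2"
      "\<Delta> * fst (p + q) = m2 * fst a2 + m3 * fst a3 + m1 * fst a1"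
      "\<Delta> * snd (p + q) = m1 * snd a1 + m3 * snd a3 + m2 * snd a2"
      "\<Delta> * snd (p + q) = m2 * snd a2 + m3 * snd a3 + m1 * snd a1" using F G by simp_all
    define X where "X a \<longleftrightarrow> l1 \<le> fst (p + q) - fst a \<and> fst (p + q) - fst a \<le> r1" for a :: cell
    define Y where "Y a \<longleftrightarrow> l2 \<le> snd (p + q) - snd a \<and> snd (p + q) - snd a \<le> r2" for a :: cell
    note lim = aD[unfolded D_iff]
    have "X a1 \<or> X a2" "Y a1 \<or> Y a2"
      using one_bad_reflection[OF F rot(1) 4, of l1 r1] one_bad_reflection[OF G rot(1) 4, of l2 r2] lim
      unfolding X_def Y_def by (simp, linarith)+
    moreover have "X a1 \<or> X a3" "Y a1 \<or> Y a3"
      using one_bad_reflection[OF F'(1) rot(3) 4(1,3,2), of l1 r1]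
        one_bad_reflection[OF F'(3) rot(3) 4(1,3,2), of l2 r2] lim
      unfolding X_def Y_def by (simp, linarith)+
    moreover have "X a2 \<or> X a3" "Y a2 \<or> Y a3"
      using one_bad_reflection[OF F'(2) rot(4) 4(2,3,1), of l1 r1]
        one_bad_reflection[OF F'(4) rot(4) 4(2,3,1), of l2 r2] lim
      unfolding X_def Y_def by (simp, linarith)+
    moreover have "p + q - a \<in> D \<longleftrightarrow> X a \<and> Y a" for a
      unfolding D_iff X_def Y_def fst_diff snd_diff by blast
    ultimately show ?thesis by blast
  qed
qed

text \<open>
  By \<open>some_reflection_in_D\<close>, for any two negative units \<open>p, q\<close> some \<open>p + q - ai\<close> is negative again,
  with a coordinate \<open>Li\<close> smaller than those of \<open>p\<close> and \<open>q\<close>; so neither of them minimises \<open>Li\<close> among the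
  negative cells. For the minimisers \<open>p1, p2, p3\<close> of the three coordinates this determines which
  vertex belongs to each pair, and adding up the resulting inequalities exceeds the total \<open>3 \<Delta>\<close> of
  their coordinates.
\<close>
lemma no_triangle:
  assumes cl: "exchange_closed z" and z: "balanced z"
    and B: "bary \<Delta> a1 a2 a3 L1 L2 L3"
    and a: "0 < z a1" "0 < z a2" "0 < z a3" "a1 \<noteq> a2" "a1 \<noteq> a3" "a2 \<noteq> a3"
    and b: "z b < 0" "0 < L1 b" "0 < L2 b" "0 < L3 b"
  shows False
proof -
  have sub: "p \<in> D" if "z p \<noteq> 0" for p using balanced_in_D[OF z that] .
  have s: "L1 e + L2 e + L3 e = \<Delta>" for e using B unfolding bary_def by blast
  have refl: "L1 (p + q - a1) = L1 p + L1 q - \<Delta>" "L2 (p + q - a2) = L2 p + L2 q - \<Delta>"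
    "L3 (p + q - a3) = L3 p + L3 q - \<Delta>" for p q using B unfolding bary_def by blast+
  have inside: "0 < L1 e" "0 < L2 e" "0 < L3 e" if "z e < 0" for e
    using inside_triangle[OF cl sub B a b that] by blast+
  define N where "N = {p \<in> D. z p < 0}"
  have N: "p \<in> N" if "z p < 0" for p using that sub[of p] by (simp add: N_def)
  have "finite N" "b \<in> N" using N b by (auto simp: N_def)
  then have argmin: "\<exists>p. z p < 0 \<and> (\<forall>q. z q < 0 \<longrightarrow> L p \<le> L q)" for L :: "cell \<Rightarrow> int"
    using ex_min_if_finite[of "L ` N"] N
    by (metis (mono_tags, lifting) N_def empty_iff finite_imageI imageE image_eqI mem_Collect_eq not_less)
  obtain p1 where p1: "z p1 < 0" "\<And>q. z q < 0 \<Longrightarrow> L1 p1 \<le> L1 q" using argmin[of L1] by blast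
  obtain p2 where p2: "z p2 < 0" "\<And>q. z q < 0 \<Longrightarrow> L2 p2 \<le> L2 q" using argmin[of L2] by blast
  obtain p3 where p3: "z p3 < 0" "\<And>q. z q < 0 \<Longrightarrow> L3 p3 \<le> L3 q" using argmin[of L3] by blast
  \<comment> \<open>the vertex that can be reflected is not one whose coordinate is least at \<open>p\<close> or \<open>q\<close>\<close>
  have pair: "(\<Delta> < L1 p + L1 q \<and> p \<noteq> p1 \<and> q \<noteq> p1) \<or> (\<Delta> < L2 p + L2 q \<and> p \<noteq> p2 \<and> q \<noteq> p2)
      \<or> (\<Delta> < L3 p + L3 q \<and> p \<noteq> p3 \<and> q \<noteq> p3)" if pq: "two_units (- z) p q" for p q
  proof -
    have zpq: "z p < 0" "z q < 0" using pq by (auto simp: two_units_def)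
    have aD: "a1 \<in> D" "a2 \<in> D" "a3 \<in> D" using sub a by auto
    consider "p + q - a1 \<in> D" | "p + q - a2 \<in> D" | "p + q - a3 \<in> D"
      using some_reflection_in_D[OF B aD inside[OF zpq(1)] inside[OF zpq(2)]] by blast
    then show ?thesis
    proof cases
      case 1
      have f: "z (p + q - a1) < 0" using exchange_closed_down[OF cl pq a(1) 1] .
      then show ?thesis using inside[OF f] p1(2)[OF f] refl(1)[of p q] inside[OF zpq(1)] inside[OF zpq(2)] s[of p] s[of q] by auto
    next
      case 2
      have f: "z (p + q - a2) < 0" using exchange_closed_down[OF cl pq a(2) 2] .
      then show ?thesis using inside[OF f] p2(2)[OF f] refl(2)[of p q] inside[OF zpq(1)] inside[OF zpq(2)] s[of p] s[of q] by auto
    next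
      case 3
      have f: "z (p + q - a3) < 0" using exchange_closed_down[OF cl pq a(3) 3] .
      then show ?thesis using inside[OF f] p3(2)[OF f] refl(3)[of p q] inside[OF zpq(1)] inside[OF zpq(2)] s[of p] s[of q] by auto
    qed
  qed
  have distance: "two_units (- z) p q" if "z p < 0" "z q < 0" "p \<noteq> q" for p q
    using that by (simp add: two_units_def)
  show False
  proof (cases "p1 = p2 \<and> p2 = p3")
    case True
    obtain e where "two_units (- z) p1 e"
      using second_unit[OF balanced_uminus[OF z], of p1] p1 by auto
    from pair[OF this] True show False by blast
  next
    case False
    show False
    proof (cases "p1 \<noteq> p2 \<and> p1 \<noteq> p3 \<and> p2 \<noteq> p3")
      case True
      then show False
        using pair[OF distance[OF p1(1) p2(1)]] pair[OF distance[OF p1(1) p3(1)]] pair[OF distance[OF p2(1) p3(1)]]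
          inside[OF p1(1)] inside[OF p2(1)] inside[OF p3(1)] s[of p1] s[of p2] s[of p3] by auto
    next
      case F: False
      then consider "p1 = p2" "p1 \<noteq> p3" | "p1 = p3" "p1 \<noteq> p2" | "p2 = p3" "p1 \<noteq> p2"
        using False by blast
      then show False
      proof cases
        case 1 then show False using pair[OF distance[OF p1(1) p3(1)]] by blast
      next
        case 2 then show False using pair[OF distance[OF p1(1) p2(1)]] by blast
      next
        case 3 then show False using pair[OF distance[OF p1(1) p2(1)]] by blast
      qed
    qed
  qed
qed

end

context grid begin

lemma circuit_uminus: "circuit w \<Longrightarrow> circuit (- w)"
  unfolding circuit_def fun_Compl_def neg_equal_0_iff_equal
  using balanced_uminus[of w, unfolded fun_Compl_def] by metis

lemma conformal_uminus: "conformal w z \<Longrightarrow> conformal (- w) (- z)"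
  unfolding conformal_def fun_Compl_def neg_0_less_iff_less neg_less_0_iff_less by metis

lemma two_point_support:
  assumes z: "balanced z" and wz: "conformal w z"
    and c: "card {p. 0 < w p} \<le> 2" and fin: "finite {p. 0 < w p}" and ne: "0 < w a"
  obtains a1 a2 A1 A2 where "two_units z a1 a2" "0 \<le> A1" "0 \<le> A2" "0 < A1 + A2"
    "\<And>f :: cell \<Rightarrow> int. (\<Sum>p | 0 < w p. f p * w p) = A1 * f a1 + A2 * f a2"
proof -
  have "a \<in> {p. 0 < w p}" using ne by simp
  then have "{p. 0 < w p} \<noteq> {}" by (metis empty_iff)
  then have "0 < card {p. 0 < w p}" using fin by (simp add: card_gt_0_iff)
  then consider "card {p. 0 < w p} = 1" | "card {p. 0 < w p} = 2" using c by linarith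
  then show ?thesis
  proof cases
    case 1
    then obtain b where b: "{p. 0 < w p} = {b}" by (rule card_1_singletonE)
    then have "b \<in> {p. 0 < w p}" by simp
    then have "0 < w b" by simp
    then have "0 < z b" using wz by (simp add: conformal_def)
    then obtain e where "two_units z b e" by (rule second_unit[OF z])
    then show ?thesis using that[of b e "w b" 0] \<open>0 < w b\<close> b by (simp add: mult.commute)
  next
    case 2
    then obtain b e where b: "{p. 0 < w p} = {b, e}" "b \<noteq> e" by (metis card_2_iff)
    then have "b \<in> {p. 0 < w p}" "e \<in> {p. 0 < w p}" by simp_all
    then have w: "0 < w b" "0 < w e" by simp_all
    then have "two_units z b e" using wz b by (simp add: two_units_def conformal_def)
    then show ?thesis using that[of b e "w b" "w e"] w b by (simp add: mult.commute)
  qed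
qed

lemma area_affine:
  assumes "M * fst b = \<alpha> * fst p + \<beta> * fst q + \<gamma> * fst r" "M * snd b = \<alpha> * snd p + \<beta> * snd q + \<gamma> * snd r"
    "M = \<alpha> + \<beta> + \<gamma>"
  shows "M * area b s t = \<alpha> * area p s t + \<beta> * area q s t + \<gamma> * area r s t"
proof -
  have *: "area x s t = area 0 s t + fst x * (snd s - snd t) + snd x * (fst t - fst s)" for x
    by (simp add: area_def algebra_simps)
  have "M * area b s t = M * area 0 s t + (M * fst b) * (snd s - snd t) + (M * snd b) * (fst t - fst s)"
    by (simp add: *[of b] algebra_simps)
  also have "\<dots> = (\<alpha> + \<beta> + \<gamma>) * area 0 s t
      + (\<alpha> * fst p + \<beta> * fst q + \<gamma> * fst r) * (snd s - snd t)
      + (\<alpha> * snd p + \<beta> * snd q + \<gamma> * snd r) * (fst t - fst s)"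
    by (simp only: assms(1,2)) (simp only: assms(3))
  also have "\<dots> = \<alpha> * area p s t + \<beta> * area q s t + \<gamma> * area r s t"
    by (simp add: *[of p] *[of q] *[of r] algebra_simps)
  finally show ?thesis .
qed

lemma area_rotate: "area p q r = area q r p"
  by (simp add: area_def algebra_simps)

lemma circuit_sums:
  assumes "circuit w"
  shows "(\<Sum>p | 0 < w p. w p) = (\<Sum>p | w p < 0. - w p)"
    "(\<Sum>p | 0 < w p. fst p * w p) = (\<Sum>p | w p < 0. fst p * - w p)"
    "(\<Sum>p | 0 < w p. snd p * w p) = (\<Sum>p | w p < 0. snd p * - w p)"
    "finite {p. 0 < w p}" "finite {p. w p < 0}"
    "card {p. 0 < w p} + card {p. w p < 0} \<le> 4"
proof -
  have w: "balanced w" using assms by (simp add: circuit_def)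
  have sub: "{p. 0 < w p} \<subseteq> D" "{p. w p < 0} \<subseteq> D" using balanced_in_D[OF w] by force+
  show fin: "finite {p. 0 < w p}" "finite {p. w p < 0}" using sub finite_subset finite_D by blast+
  have "(\<Sum>p\<in>D. f p * w p) = (\<Sum>p | 0 < w p. f p * w p) - (\<Sum>p | w p < 0. f p * - w p)" for f
  proof -
    have "(\<Sum>p\<in>D. f p * w p) = (\<Sum>p\<in>{p. 0 < w p} \<union> {p. w p < 0}. f p * w p)"
      using sub by (intro sum.mono_neutral_right) (auto simp: not_less order_antisym)
    also have "\<dots> = (\<Sum>p | 0 < w p. f p * w p) + (\<Sum>p | w p < 0. f p * w p)"
      using fin by (intro sum.union_disjoint) auto
    finally show ?thesis by (simp add: sum_negf)
  qed
  from this[of "\<lambda>_. 1"] this[of fst] this[of snd] w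
  show "(\<Sum>p | 0 < w p. w p) = (\<Sum>p | w p < 0. - w p)"
    "(\<Sum>p | 0 < w p. fst p * w p) = (\<Sum>p | w p < 0. fst p * - w p)"
    "(\<Sum>p | 0 < w p. snd p * w p) = (\<Sum>p | w p < 0. snd p * - w p)"
    by (simp_all add: balanced_def)
  have "{p. w p \<noteq> 0} = {p. 0 < w p} \<union> {p. w p < 0}" by auto
  then show "card {p. 0 < w p} + card {p. w p < 0} \<le> 4"
    using circuit_card[OF assms] card_Un_disjoint[OF fin] by force
qed

text \<open>
  Minimality of the support makes the triangle nondegenerate, and the relation expresses the
  barycentric coordinates of \<open>b\<close> as positive multiples of its area.
\<close>
lemma no_three_one_circuit:
  assumes cl: "exchange_closed z" and z: "balanced z" and w: "circuit w" and wz: "conformal w z"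
    and c3: "card {p. 0 < w p} = 3" and c1: "card {p. w p < 0} = 1"
  shows False
proof -
  obtain a1 a2 a3 where P: "{p. 0 < w p} = {a1, a2, a3}" "a1 \<noteq> a2" "a1 \<noteq> a3" "a2 \<noteq> a3"
    using c3 by (metis card_3_iff)
  obtain b where N: "{p. w p < 0} = {b}" using c1 by (rule card_1_singletonE)
  have wa: "0 < w a1" "0 < w a2" "0 < w a3" using P by blast+
  have wb: "w b < 0" using N by blast
  have za: "0 < z a1" "0 < z a2" "0 < z a3" and zb: "z b < 0"
    using wz wa wb by (simp_all add: conformal_def)
  note S = circuit_sums(1-3)[OF w, unfolded P(1) N]
  have M: "- w b = w a1 + w a2 + w a3"
    and F: "- w b * fst b = w a1 * fst a1 + w a2 * fst a2 + w a3 * fst a3"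
    and G: "- w b * snd b = w a1 * snd a1 + w a2 * snd a2 + w a3 * snd a3"
    using S P(2-4) by (simp_all add: mult.commute)
  have bw: "balanced w" using w by (simp add: circuit_def)
  have inD: "a1 \<in> D" "a2 \<in> D" "a3 \<in> D" using balanced_in_D[OF bw] wa by simp_all
  have nz: "area a1 a2 a3 \<noteq> 0"
  proof
    assume "area a1 a2 a3 = 0"
    then obtain v where v: "balanced v" "\<exists>s. v s \<noteq> 0" "\<And>s. s \<notin> {a1, a2, a3} \<Longrightarrow> v s = 0"
      using collinear_dependent[OF _ inD P(2-4)] by metis
    have "v y = 0" if "w y = 0" for y using v(3)[of y] that wa by fastforce
    moreover have "v b = 0" using v(3)[of b] wa wb by fastforce
    ultimately show False using w v wb unfolding circuit_def by (metis less_irrefl)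
  qed
  have pos: False
    if "0 < area a1 a2 a3" "0 < z a1" "0 < z a2" "0 < z a3" "a1 \<noteq> a2" "a1 \<noteq> a3" "a2 \<noteq> a3"
      "0 < w a1" "0 < w a2" "0 < w a3" and M: "- w b = w a1 + w a2 + w a3"
      and F: "- w b * fst b = w a1 * fst a1 + w a2 * fst a2 + w a3 * fst a3"
      and G: "- w b * snd b = w a1 * snd a1 + w a2 * snd a2 + w a3 * snd a3"
    for a1 a2 a3
  proof -
    have z0: "area p q q = 0" "area q p q = 0" "area p p q = 0" for p q by (simp_all add: area_def)
    note aff = area_affine[OF F G M]
    have "- w b * area b a2 a3 = w a1 * area a1 a2 a3"
      "- w b * area b a3 a1 = w a2 * area a2 a3 a1"
      "- w b * area b a1 a2 = w a3 * area a3 a1 a2"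
      unfolding aff by (simp_all add: z0)
    then have "- w b * area b a2 a3 = w a1 * area a1 a2 a3"
      "- w b * area a1 b a3 = w a2 * area a1 a2 a3" "- w b * area a1 a2 b = w a3 * area a1 a2 a3"
      by (metis area_rotate)+
    then have "0 < - w b * area b a2 a3" "0 < - w b * area a1 b a3" "0 < - w b * area a1 a2 b"
      using that by simp_all
    then have "0 < area b a2 a3" "0 < area a1 b a3" "0 < area a1 a2 b"
      using wb by (simp_all add: mult_less_0_iff)
    then show False
      using no_triangle[OF cl z bary_area[OF that(1)] that(2-7) zb] by blast
  qed
  show False
  proof (cases "0 < area a1 a2 a3")
    case True
    then show False using pos[of a1 a2 a3] za P(2-4) wa M F G by blast
  next
    case False
    then have "0 < area a1 a3 a2" using nz by (simp add: area_def algebra_simps)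
    then show False using pos[of a1 a3 a2] za P(2-4) wa M F G by (simp add: ac_simps)
  qed
qed

text \<open>
  Four points of the plane are always dependent, so a circuit has at most four points: two against
  at most two, which is a crossing, or three against one.
\<close>
lemma exchange_closed_balanced_eq_0:
  assumes cl: "exchange_closed z" and z: "balanced z"
  shows "z p = 0"
proof (rule ccontr)
  assume "z p \<noteq> 0"
  then obtain w where w: "circuit w" and wz: "conformal w z" using ex_circuit[OF z] by metis
  have bw: "balanced w" using w by (simp add: circuit_def)
  note S = circuit_sums[OF w]
  obtain q where q: "w q \<noteq> 0" using w unfolding circuit_def by blast
  have sign: "w q = 0" if "\<And>p. p \<in> D \<Longrightarrow> 0 \<le> \<sigma> * w p" "\<sigma> \<noteq> 0" for \<sigma> :: int
  proof -
    have "(\<Sum>p\<in>D. \<sigma> * w p) = 0" using bw by (simp add: balanced_def flip: sum_distrib_left)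
    then have "\<forall>p\<in>D. \<sigma> * w p = 0" using that(1) by (subst (asm) sum_nonneg_eq_0_iff) simp_all
    then show ?thesis using that(2) balanced_in_D[OF bw, of q] by fastforce
  qed
  have "\<exists>p. 0 < w p"
  proof (rule ccontr)
    assume "\<nexists>p. 0 < w p"
    then show False using sign[of "- 1"] q by (simp add: not_less)
  qed
  moreover have "\<exists>p. w p < 0"
  proof (rule ccontr)
    assume "\<nexists>p. w p < 0"
    then show False using sign[of 1] q by (simp add: not_less)
  qed
  ultimately obtain a b where a: "0 < w a" and b: "w b < 0" by blast
  have "{p. 0 < w p} \<noteq> {}" "{p. w p < 0} \<noteq> {}" using a b by blast+
  then have c: "0 < card {p. 0 < w p}" "0 < card {p. w p < 0}"
    using S(4,5) by (simp_all add: card_gt_0_iff)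
  consider "card {p. 0 < w p} \<le> 2" "card {p. w p < 0} \<le> 2"
    | "card {p. 0 < w p} = 3" "card {p. w p < 0} = 1"
    | "card {p. 0 < w p} = 1" "card {p. w p < 0} = 3"
    using c S(6) by linarith
  then show False
  proof cases
    case 1
    obtain a1 a2 A1 A2 where A: "two_units z a1 a2" "0 \<le> A1" "0 \<le> A2" "0 < A1 + A2"
      "\<And>f :: cell \<Rightarrow> int. (\<Sum>p | 0 < w p. f p * w p) = A1 * f a1 + A2 * f a2"
      by (rule two_point_support[OF z wz 1(1) S(4) a]) blast
    have neg: "(- w) p = - w p" "0 < - w p \<longleftrightarrow> w p < 0" for p by simp_all
    have b': "0 < (- w) b" using b by simp
    note tp = two_point_support[OF balanced_uminus[OF z] conformal_uminus[OF wz] _ _ b', unfolded neg, OF 1(2) S(5)]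
    obtain b1 b2 B1 B2 where B: "two_units (- z) b1 b2" "0 \<le> B1" "0 \<le> B2" "0 < B1 + B2"
      "\<And>f :: cell \<Rightarrow> int. (\<Sum>p | w p < 0. f p * - w p) = B1 * f b1 + B2 * f b2"
      by (rule tp) blast
    show False
    proof (rule no_crossing[OF cl _ A(1) B(1)])
      show "A1 + A2 = B1 + B2" using A(5)[of "\<lambda>_. 1"] B(5)[of "\<lambda>_. 1"] S(1) by simp
      show "A1 * fst a1 + A2 * fst a2 = B1 * fst b1 + B2 * fst b2"
        using A(5)[of fst] B(5)[of fst] S(2) by simp
      show "A1 * snd a1 + A2 * snd a2 = B1 * snd b1 + B2 * snd b2"
        using A(5)[of snd] B(5)[of snd] S(3) by simp
    qed (use A(2-4) B(2,3) balanced_in_D[OF z] in blast)+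
  next
    case 2
    then show False using no_three_one_circuit[OF cl z w wz] by blast
  next
    case 3
    then show False
      using no_three_one_circuit[OF exchange_closed_uminus[OF cl] balanced_uminus[OF z]
          circuit_uminus[OF w] conformal_uminus[OF wz]] by simp
  qed
qed

end

section \<open>Pivots on a line\<close>

definition smul :: "int \<Rightarrow> cell \<Rightarrow> cell" where "smul k u = (k * fst u, k * snd u)"

lemma fst_smul [simp]: "fst (smul k u) = k * fst u" and snd_smul [simp]: "snd (smul k u) = k * snd u"
  by (simp_all add: smul_def)

lemma smul_0 [simp]: "smul 0 u = 0" and smul_1 [simp]: "smul 1 u = u"
  and smul_m1 [simp]: "smul (- 1) u = - u" and smul_minus: "smul k (- u) = smul (- k) u"
  by (simp_all add: prod_eq_iff)

lemma smul_eq_iff: "u \<noteq> 0 \<Longrightarrow> smul j u = smul k u \<longleftrightarrow> j = k"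
  by (auto simp: prod_eq_iff)

lemma smul_add: "smul (j + k) u = smul j u + smul k u" and smul_diff: "smul (j - k) u = smul j u - smul k u"
  by (simp_all add: prod_eq_iff algebra_simps)

text \<open>
  The only configuration in which completing the parallelogram from two positive units and a negative
  one may fail: the fourth corner is the negative cell itself, which has room for one unit only.
\<close>
definition pivot :: "(cell \<Rightarrow> int) \<Rightarrow> cell \<Rightarrow> cell \<Rightarrow> bool" where
  "pivot z m u \<longleftrightarrow> u \<noteq> 0 \<and> 0 < z (m + u) \<and> 0 < z (m - u) \<and> z m = - 1"

lemma pivot_uminus: "pivot z m u \<Longrightarrow> pivot z m (- u)"
  by (simp add: pivot_def)

context grid begin

text \<open>
The closure property of \<open>exchange_closed_up\<close> except at pivots.
\<close>
definition nearly_exchange_closed_up :: "(cell \<Rightarrow> int) \<Rightarrow> bool" where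
  "nearly_exchange_closed_up z \<longleftrightarrow> (\<forall>a c b. two_units z a c \<longrightarrow> z b < 0 \<longrightarrow> a + c - b \<in> D \<longrightarrow>
     (a + c - b = b \<longrightarrow> z b \<le> - 2) \<longrightarrow> 0 < z (a + c - b))"

definition nearly_exchange_closed :: "(cell \<Rightarrow> int) \<Rightarrow> bool" where
  "nearly_exchange_closed z \<longleftrightarrow> nearly_exchange_closed_up z \<and> nearly_exchange_closed_up (- z)"

lemma nearly_exchange_closed_pos:
  assumes "nearly_exchange_closed z" "two_units z a c" "z b < 0" "d = a + c - b" "d \<in> D" "d \<noteq> b \<or> z b \<le> - 2"
  shows "0 < z d"
  using assms unfolding nearly_exchange_closed_def nearly_exchange_closed_up_def by blast

lemma nearly_exchange_closed_neg:
  assumes nc: "nearly_exchange_closed z" and "two_units (- z) b e" "0 < z a" "d = b + e - a" "d \<in> D" "d \<noteq> a \<or> 2 \<le> z a"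
  shows "z d < 0"
proof -
  have "nearly_exchange_closed_up (- z)" using nc by (simp add: nearly_exchange_closed_def)
  then have "0 < (- z) (b + e - a)"
    unfolding nearly_exchange_closed_up_def using assms(2-) by (metis fun_Compl_def neg_less_0_iff_less neg_le_iff_le)
  then show ?thesis using assms(4) by simp
qed

lemma between_in_D:
  assumes "m + smul i u \<in> D" "m + smul j u \<in> D" "i \<le> k" "k \<le> j"
  shows "m + smul k u \<in> D"
proof -
  have *: "lo \<le> a + k * x \<and> a + k * x \<le> hi"
    if "lo \<le> a + i * x" "a + i * x \<le> hi" "lo \<le> a + j * x" "a + j * x \<le> hi" for a x lo hi :: int
  proof (cases "0 \<le> x")
    case True
    then have "i * x \<le> k * x" "k * x \<le> j * x" using assms(3,4) by (simp_all add: mult_right_mono)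
    then show ?thesis using that by linarith
  next
    case False
    then have "j * x \<le> k * x" "k * x \<le> i * x" using assms(3,4) by (simp_all add: mult_right_mono_neg)
    then show ?thesis using that by linarith
  qed
  show ?thesis using assms(1,2) *[of l1 "fst m" "fst u" r1] *[of l2 "snd m" "snd u" r2] by (simp add: D_iff)
qed

context
  fixes z m u
  assumes z: "balanced z" and nc: "nearly_exchange_closed z" and pv: "pivot z m u"
begin

lemma pivot_in_D: "m \<in> D" "m + u \<in> D" "m - u \<in> D"
  using balanced_in_D[OF z] pv by (auto simp: pivot_def)

lemma not_all_nonneg: "\<exists>e. e \<noteq> m \<and> z e < 0"
proof (rule ccontr)
  assume "\<not> ?thesis"
  then have nn: "0 \<le> z e" if "e \<noteq> m" for e using that not_less by blast
  have d: "m + u \<noteq> m" "m - u \<noteq> m" "m - u \<noteq> m + u"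
    using pv by (auto simp: pivot_def prod_eq_iff)
  have "0 = (\<Sum>p\<in>D. z p)" using z by (simp add: balanced_def)
  also have "\<dots> = (\<Sum>p\<in>D - {m, m + u, m - u}. z p) + (\<Sum>p\<in>{m, m + u, m - u}. z p)"
    using pivot_in_D by (intro sum.subset_diff) auto
  also have "(\<Sum>p\<in>{m, m + u, m - u}. z p) = z m + z (m + u) + z (m - u)"
    using d by simp
  finally have "0 = (\<Sum>p\<in>D - {m, m + u, m - u}. z p) + (z m + z (m + u) + z (m - u))" .
  moreover have "0 \<le> (\<Sum>p\<in>D - {m, m + u, m - u}. z p)" using nn by (intro sum_nonneg) auto
  moreover have "0 < z (m + u)" "0 < z (m - u)" "z m = - 1" using pv by (auto simp: pivot_def)
  ultimately show False by linarith
qed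

text \<open>
  Outside the pivot, signs propagate inwards along the line: a negative cell is moved by the pair
  \<open>m, m + u\<close> and a positive one by the pair \<open>m - u, m\<close>.
\<close>
lemma ray_sign:
  assumes "3 \<le> k"
  shows "z (m + smul k u) < 0 \<Longrightarrow> z (m + smul (k - 1) u) < 0"
    "0 < z (m + smul k u) \<Longrightarrow> 0 < z (m + smul (k - 1) u)"
proof -
  have u0: "u \<noteq> 0" using pv by (simp add: pivot_def)
  have inD: "m + smul (k - 1) u \<in> D" if "z (m + smul k u) \<noteq> 0"
    using between_in_D[of m 0 u k "k - 1"] pivot_in_D balanced_in_D[OF z that] assms by simp
  have eq: "m + smul (k - 1) u = m + smul k u + m - (m + u)"
    "m + smul (k - 1) u = m + smul k u + (m - u) - m" by (simp_all add: smul_diff)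
  have ne: "m + smul k u \<noteq> m" "m + smul (k - 1) u \<noteq> m + u" "m + smul k u \<noteq> m - u" "m + smul (k - 1) u \<noteq> m"
    using smul_eq_iff[OF u0, of k 0] smul_eq_iff[OF u0, of "k - 1" 1] smul_eq_iff[OF u0, of k "- 1"]
      smul_eq_iff[OF u0, of "k - 1" 0] assms by auto
  show "z (m + smul (k - 1) u) < 0" if "z (m + smul k u) < 0"
    using nearly_exchange_closed_neg[OF nc _ _ eq(1) inD] that ne pv
    by (simp add: two_units_def pivot_def)
  show "0 < z (m + smul (k - 1) u)" if "0 < z (m + smul k u)"
    using nearly_exchange_closed_pos[OF nc _ _ eq(2) inD] that ne pv
    by (simp add: two_units_def pivot_def)
qed

lemma ray_sign_2:
  assumes "2 \<le> k"
  shows "(z (m + smul k u) < 0 \<longrightarrow> z (m + smul 2 u) < 0) \<and> (0 < z (m + smul k u) \<longrightarrow> 0 < z (m + smul 2 u))"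
  using assms
proof (induction k rule: int_ge_induct)
  case base then show ?case by simp
next
  case (step k)
  then show ?case using ray_sign[of "k + 1"] by simp
qed

end

text \<open>
  A negative cell beyond \<open>m + u\<close> makes \<open>m + 2 u\<close> negative. Then \<open>z (m + u) = 1\<close>, all cells beyond
  \<open>m + u\<close> are nonpositive, and all cells beyond \<open>m - u\<close> are nonnegative, for a negative cell there
  would make \<open>m - 2 u\<close> negative, whereas it is the fourth corner of \<open>m + u, m - u\<close> and \<open>m + 2 u\<close>. So
  the first moment along the line is negative.
\<close>
lemma ray_nonneg:
  assumes z: "balanced z" and nc: "nearly_exchange_closed z" and pv: "pivot z m u"
    and line: "\<And>p. z p \<noteq> 0 \<Longrightarrow> \<exists>k. p = m + smul k u" and k: "2 \<le> k"
  shows "0 \<le> z (m + smul k u)"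
proof (rule ccontr)
  let ?c = "\<lambda>k. m + smul k u"
  assume "\<not> ?thesis"
  then have z2: "z (?c 2) < 0" using ray_sign_2[OF z nc pv k] by simp
  have u0: "u \<noteq> 0" and zp: "0 < z (?c 1)" "0 < z (?c (- 1))" "z m = - 1"
    using pv by (simp_all add: pivot_def)
  have c2: "?c 2 = m + u + u" by (simp add: prod_eq_iff)
  have z1: "z (?c 1) = 1"
  proof (rule ccontr)
    assume "z (?c 1) \<noteq> 1"
    then have "2 \<le> z (?c 1)" using zp by simp
    moreover have "two_units (- z) (?c 2) m"
      using z2 zp smul_eq_iff[OF u0, of 2 0] by (simp add: two_units_def)
    ultimately have "z (?c 1) < 0"
      using nearly_exchange_closed_neg[OF nc, of "?c 2" m "?c 1" "?c 1"] pivot_in_D[OF z nc pv] c2 by simp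
    then show False using zp by simp
  qed
  have right: "z (?c j) \<le> 0" if "2 \<le> j" for j
    using ray_sign_2[OF z nc pv that] z2 by force
  have left: "0 \<le> z (?c j)" if "j \<le> - 2" for j
  proof (rule ccontr)
    assume "\<not> ?thesis"
    then have zm2: "z (?c (- 2)) < 0"
      using ray_sign_2[OF z nc pivot_uminus[OF pv], of "- j"] that by (simp add: smul_minus)
    have "m - u \<noteq> m + u" "?c (- 2) \<noteq> ?c 2" using u0 by (auto simp: prod_eq_iff)
    then have "two_units z (m + u) (m - u)" using pv by (simp add: two_units_def pivot_def)
    moreover have "?c (- 2) = m + u + (m - u) - ?c 2" by (simp add: prod_eq_iff)
    moreover have "?c (- 2) \<in> D" using balanced_in_D[OF z] zm2 by simp
    ultimately have "0 < z (?c (- 2))"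
      using nearly_exchange_closed_pos[OF nc _ z2] \<open>?c (- 2) \<noteq> ?c 2\<close> by blast
    then show False using zm2 by simp
  qed
  \<comment> \<open>\<open>t\<close> is the moment along \<open>u\<close>; on the line it equals \<open>j * q * z\<close> at \<open>m + j u\<close>\<close>
  define q where "q = fst u * fst u + snd u * snd u"
  have q: "0 < q" using u0 by (auto simp: q_def prod_eq_iff sum_squares_gt_zero_iff)
  define t where "t p = (fst u * (fst p - fst m) + snd u * (snd p - snd m)) * z p" for p
  have tc: "t (?c j) = j * q * z (?c j)" for j by (simp add: t_def q_def algebra_simps)
  have t: "(\<Sum>p\<in>D. t p) = 0"
    using balanced_affine[OF z, of "- fst u * fst m - snd u * snd m" "fst u" "snd u"]
    by (simp add: t_def algebra_simps)
  let ?S = "{?c 1, ?c (- 1), ?c 2}"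
  have S: "?S \<subseteq> D" using pivot_in_D[OF z nc pv] balanced_in_D[OF z, of "?c 2"] z2 by simp
  have "t p \<le> 0" if p: "p \<in> D - ?S" for p
  proof (cases "z p = 0")
    case False
    then obtain j where j: "p = ?c j" using line by blast
    then have "j = 0 \<or> 2 \<le> j \<or> j \<le> - 2" using p by (smt (verit, best) Diff_iff insertCI)
    then show ?thesis using right[of j] left[of j] q
      by (auto simp: j tc mult_nonneg_nonpos mult_nonpos_nonneg)
  qed (simp add: t_def)
  then have "(\<Sum>p\<in>D - ?S. t p) \<le> 0" by (intro sum_nonpos) blast
  moreover have "?c 1 \<noteq> ?c (- 1)" "?c 1 \<noteq> ?c 2" "?c (- 1) \<noteq> ?c 2"
    using smul_eq_iff[OF u0, of 1 "- 1"] smul_eq_iff[OF u0, of 1 2] smul_eq_iff[OF u0, of "- 1" 2] by simp_all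
  then have "(\<Sum>p\<in>?S. t p) = t (?c 1) + t (?c (- 1)) + t (?c 2)" by simp
  moreover have "t (?c 1) = q" "t (?c (- 1)) \<le> - q" "t (?c 2) < 0"
  proof -
    show "t (?c 1) = q" using tc[of 1] z1 by simp
    have "q * 1 \<le> q * z (?c (- 1))" using q zp(2) by (intro mult_left_mono) auto
    then show "t (?c (- 1)) \<le> - q" using tc[of "- 1"] by simp
    show "t (?c 2) < 0" using tc[of 2] z2 q by (simp add: mult_pos_neg)
  qed
  ultimately show False using t sum.subset_diff[OF S finite_D, of t] by simp
qed

text \<open>
  If both rays are nonnegative, the total of \<open>z\<close> is at least \<open>1 - 1 + 1\<close>.
\<close>
lemma no_pivot_on_line:
  assumes z: "balanced z" and nc: "nearly_exchange_closed z" and pv: "pivot z m u"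
    and line: "\<And>p. z p \<noteq> 0 \<Longrightarrow> \<exists>k. p = m + smul k u"
  shows False
proof -
  obtain e where e: "e \<noteq> m" "z e < 0" using not_all_nonneg[OF z nc pv] by blast
  then obtain k where k: "e = m + smul k u" using line[of e] by auto
  have line': "\<exists>k. p = m + smul k (- u)" if "z p \<noteq> 0" for p
    using line[OF that] by (metis minus_minus smul_minus)
  have "k \<noteq> 0" "k \<noteq> 1" "k \<noteq> - 1" using e k pv by (auto simp: pivot_def)
  then consider "2 \<le> k" | "2 \<le> - k" by linarith
  then show False
  proof cases
    case 1 then show False using ray_nonneg[OF z nc pv line 1] e k by simp
  next
    case 2 then show False
      using ray_nonneg[OF z nc pivot_uminus[OF pv] line' 2] e k by (simp add: smul_minus)
  qed
qed

end

section \<open>Pivots parallel to an axis\<close>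

context grid begin

context
  fixes z m
  assumes z: "balanced z" and nc: "nearly_exchange_closed z" and pv: "pivot z m (0, 1)"
begin

text \<open>
  Coordinates relative to the centre \<open>m\<close> of a vertical pivot. The pivot makes the sign of \<open>z\<close> constant
  on every other column, so the argument is a subtractive Euclidean algorithm on column numbers.
\<close>
private abbreviation C :: "int \<Rightarrow> int \<Rightarrow> cell" where "C r k \<equiv> (fst m + r, snd m + k)"

private lemma around: "C 0 0 = m" "C 0 1 = m + (0, 1)" "C 0 (- 1) = m - (0, 1)"
  by (simp_all add: prod_eq_iff)

private lemma mid: "z (C 0 0) = - 1" "0 < z (C 0 1)" "0 < z (C 0 (- 1))"
  using pv unfolding pivot_def around by blast+

private lemma mid_in_D: "C 0 0 \<in> D" "C 0 1 \<in> D" "C 0 (- 1) \<in> D"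
  using pivot_in_D[OF z nc pv] unfolding around by blast+

private lemma col_in_D: "C r k \<in> D \<Longrightarrow> -1 \<le> j \<Longrightarrow> j \<le> 1 \<Longrightarrow> C r j \<in> D"
  using mid_in_D by (auto simp: D_iff)

private lemma pos:
  assumes "0 < z (C r k)" "0 < z (C s k')" "(r, k) \<noteq> (s, k')" "z (C t j) < 0"
    "r + s - t = r'" "k + k' - j = j'" "C r' j' \<in> D" "(r', j') \<noteq> (t, j)"
  shows "0 < z (C r' j')"
  by (rule nearly_exchange_closed_pos[OF nc, of "C r k" "C s k'" "C t j"])
    (use assms in \<open>auto simp: two_units_def\<close>)

private lemma neg:
  assumes "z (C r k) < 0" "z (C s k') < 0" "(r, k) \<noteq> (s, k')" "0 < z (C t j)"
    "r + s - t = r'" "k + k' - j = j'" "C r' j' \<in> D" "(r', j') \<noteq> (t, j)"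
  shows "z (C r' j') < 0"
  by (rule nearly_exchange_closed_neg[OF nc, of "C r k" "C s k'" "C t j"])
    (use assms in \<open>auto simp: two_units_def\<close>)

private lemma column_step:
  assumes r: "r \<noteq> 0" and "C r (k + 1) \<in> D" "C r k \<in> D"
  shows "0 < z (C r k) \<longleftrightarrow> 0 < z (C r (k + 1))" "z (C r k) < 0 \<longleftrightarrow> z (C r (k + 1)) < 0"
proof -
  show "0 < z (C r k) \<longleftrightarrow> 0 < z (C r (k + 1))"
    using pos[of r k 0 1 0 0 r "k + 1"] pos[of r "k + 1" 0 "- 1" 0 0 r k] assms mid by auto
  show "z (C r k) < 0 \<longleftrightarrow> z (C r (k + 1)) < 0"
    using neg[of r k 0 0 0 "- 1" r "k + 1"] neg[of r "k + 1" 0 0 0 1 r k] assms mid by auto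
qed

private lemma column_uniform_up:
  assumes r: "r \<noteq> 0" and "k \<le> j" "C r k \<in> D" "C r j \<in> D"
  shows "(0 < z (C r k) \<longleftrightarrow> 0 < z (C r j)) \<and> (z (C r k) < 0 \<longleftrightarrow> z (C r j) < 0)"
  using assms(2-)
proof (induction j rule: int_ge_induct)
  case base then show ?case by simp
next
  case (step j)
  then have "C r j \<in> D" by (auto simp: D_iff)
  then show ?case using step column_step[OF r, of j] by simp
qed

private lemma column_uniform:
  assumes "r \<noteq> 0" "C r k \<in> D" "C r j \<in> D"
  shows "0 < z (C r k) \<Longrightarrow> 0 < z (C r j)" "z (C r k) < 0 \<Longrightarrow> z (C r j) < 0"
  using column_uniform_up[OF assms(1), of k j] column_uniform_up[OF assms(1), of j k] assms
  by (meson linear)+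

private definition P where "P r \<longleftrightarrow> r \<noteq> 0 \<and> (\<exists>k. 0 < z (C r k))"
private definition N where "N r \<longleftrightarrow> r \<noteq> 0 \<and> (\<exists>k. z (C r k) < 0)"

private lemma P_D: "P r \<Longrightarrow> r \<noteq> 0 \<and> (\<exists>k. C r k \<in> D) \<and> (\<forall>j. C r j \<in> D \<longrightarrow> 0 < z (C r j))"
  unfolding P_def using balanced_in_D[OF z] column_uniform(1) by (metis less_irrefl)

private lemma N_D: "N r \<Longrightarrow> r \<noteq> 0 \<and> (\<exists>k. C r k \<in> D) \<and> (\<forall>j. C r j \<in> D \<longrightarrow> z (C r j) < 0)"
  unfolding N_def using balanced_in_D[OF z] column_uniform(2) by (metis less_irrefl)

private lemma P_at: "P r \<Longrightarrow> -1 \<le> j \<Longrightarrow> j \<le> 1 \<Longrightarrow> C r j \<in> D \<and> 0 < z (C r j)"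
  using P_D col_in_D by blast

private lemma N_at: "N r \<Longrightarrow> -1 \<le> j \<Longrightarrow> j \<le> 1 \<Longrightarrow> C r j \<in> D \<and> z (C r j) < 0"
  using N_D col_in_D by blast

private lemma between_cols:
  "C r k \<in> D \<Longrightarrow> C s j \<in> D \<Longrightarrow> min r s \<le> t \<Longrightarrow> t \<le> max r s \<Longrightarrow> -1 \<le> i \<Longrightarrow> i \<le> 1 \<Longrightarrow> C t i \<in> D"
  using mid_in_D by (auto simp: D_iff min_def max_def split: if_splits)

text \<open>
  From a positive column \<open>r\<close> and a negative column \<open>s\<close> on the same side, the larger distance can be
  replaced by the difference, which keeps its sign. The offset \<open>1\<close> within the column avoids the
  exceptional case.
\<close>
private lemma same_side: "P r \<Longrightarrow> N s \<Longrightarrow> 0 < r * s \<Longrightarrow> False"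
proof (induction "nat (\<bar>r\<bar> + \<bar>s\<bar>)" arbitrary: r s rule: less_induct)
  case less
  have rs: "0 < r \<and> 0 < s \<or> r < 0 \<and> s < 0" using less.prems(3) by (simp add: zero_less_mult_iff)
  have r0: "C r 0 \<in> D" "0 < z (C r 0)" and s0: "C s 0 \<in> D" "z (C s 0) < 0" "z (C s 1) < 0"
    using P_at[OF less.prems(1), of 0] N_at[OF less.prems(2), of 0] N_at[OF less.prems(2), of 1] by auto
  consider "r = s" | "\<bar>s\<bar> < \<bar>r\<bar>" | "\<bar>r\<bar> < \<bar>s\<bar>" using rs by linarith
  then show False
  proof cases
    case 1 then show False using r0 s0 by simp
  next
    case 2
    have "C (r - s) 1 \<in> D" using between_cols[OF r0(1) mid_in_D(1), of "r - s" 1] rs 2 by (auto simp: min_def max_def)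
    then have "0 < z (C (r - s) 1)"
      using pos[of r 0 0 1 s 0 "r - s" 1] r0 s0 mid rs by auto
    then have "P (r - s)" unfolding P_def using 2 by auto
    moreover have "nat (\<bar>r - s\<bar> + \<bar>s\<bar>) < nat (\<bar>r\<bar> + \<bar>s\<bar>)" "0 < (r - s) * s"
      using rs 2 by (auto simp: zero_less_mult_iff)
    ultimately show False using less.hyps less.prems(2) by blast
  next
    case 3
    have "C (s - r) 1 \<in> D" using between_cols[OF s0(1) mid_in_D(1), of "s - r" 1] rs 3 by (auto simp: min_def max_def)
    then have "z (C (s - r) 1) < 0"
      using neg[of s 1 0 0 r 0 "s - r" 1] r0 s0 mid rs by auto
    then have "N (s - r)" unfolding N_def using 3 by auto
    moreover have "nat (\<bar>r\<bar> + \<bar>s - r\<bar>) < nat (\<bar>r\<bar> + \<bar>s\<bar>)" "0 < r * (s - r)"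
      using rs 3 by (auto simp: zero_less_mult_iff)
    ultimately show False using less.hyps less.prems(1) by blast
  qed
qed

text \<open>
  The sum of two negative columns is a negative column as long as it is not the column of \<open>m\<close>; when it
  is, \<open>m - (0, 1)\<close> would be negative.
\<close>
private lemma neg_both_sides: "N r \<Longrightarrow> N s \<Longrightarrow> s < 0 \<Longrightarrow> 0 < r \<Longrightarrow> False"
proof (induction "nat (r - s)" arbitrary: r s rule: less_induct)
  case less
  have n: "C r 0 \<in> D" "z (C r 0) < 0" "C s 0 \<in> D" "z (C s 0) < 0" "z (C s 1) < 0"
    using N_at[OF less.prems(1), of 0] N_at[OF less.prems(2), of 0] N_at[OF less.prems(2), of 1] by auto
  show False
  proof (cases "r + s = 0")
    case True
    then have "z (C 0 (- 1)) < 0"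
      using neg[of r 0 s 0 0 1 0 "- 1"] n mid mid_in_D less.prems by auto
    then show False using mid by simp
  next
    case False
    have "C (r + s) 0 \<in> D" using between_cols[OF n(1,3), of "r + s" 0] less.prems by auto
    then have "z (C (r + s) 0) < 0"
      using neg[of r 0 s 1 0 1 "r + s" 0] n mid False less.prems by auto
    then have "N (r + s)" unfolding N_def using False by blast
    then show False
      using less.hyps[of "r + s" s] less.hyps[of r "r + s"] less.prems False
      by (cases "0 < r + s") auto
  qed
qed

text \<open>
  Likewise for positive columns, with \<open>m\<close> as the cell that would change sign. Reaching \<open>m\<close> takes a
  negative cell of its column other than \<open>m\<close>.
\<close>
private lemma pos_both_sides: "P r \<Longrightarrow> P s \<Longrightarrow> s < 0 \<Longrightarrow> 0 < r \<Longrightarrow> z (C 0 k) < 0 \<Longrightarrow> k \<noteq> 0 \<Longrightarrow> False"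
proof (induction "nat (r - s)" arbitrary: r s rule: less_induct)
  case less
  have p: "C r 0 \<in> D" "0 < z (C r 0)" "C s 0 \<in> D" "0 < z (C s 0)"
    using P_at[OF less.prems(1), of 0] P_at[OF less.prems(2), of 0] by auto
  show False
  proof (cases "r + s = 0")
    case True
    have "C 0 k \<in> D" using balanced_in_D[OF z] less.prems(5) by simp
    then have "C s k \<in> D" using p by (simp add: D_iff)
    then have "0 < z (C s k)" using P_D[OF less.prems(2)] by blast
    then have "0 < z (C 0 0)"
      using pos[of r 0 s k 0 k 0 0] p mid mid_in_D less.prems True by auto
    then show False using mid by simp
  next
    case False
    have "C (r + s) 0 \<in> D" using between_cols[OF p(1,3), of "r + s" 0] less.prems by auto
    then have "0 < z (C (r + s) 0)"
      using pos[of r 0 s 0 0 0 "r + s" 0] p mid False less.prems by auto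
    then have "P (r + s)" unfolding P_def using False by blast
    then show False
      using less.hyps[of "r + s" s] less.hyps[of r "r + s"] less.prems False
      by (cases "0 < r + s") auto
  qed
qed

text \<open>
  The horizontal moment \<open>t\<close> is balanced, so a negative column on one side needs a positive column on
  the same side or a negative one on the other side; both are excluded. A positive column then needs
  one on the other side, which is excluded by the negative cell that balances the total. What
  remains lives on the column of \<open>m\<close>.
\<close>
lemma no_vertical_pivot: False
proof -
  \<comment> \<open>the horizontal moment about \<open>m\<close>\<close>
  define t where "t p = (fst p - fst m) * z p" for p
  have "(\<Sum>p\<in>D. t p) = 0" using balanced_affine[OF z, of "- fst m" 1 0] by (simp add: t_def algebra_simps)
  then have bal: "\<exists>q. \<sigma> * t q < 0" if "0 < \<sigma> * t p" for \<sigma> p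
  proof -
    assume s: "(\<Sum>p\<in>D. t p) = 0"
    show ?thesis
    proof (rule ccontr)
      assume "\<not> ?thesis"
      then have nn: "0 \<le> \<sigma> * t q" for q by (simp add: not_less)
      have "z p \<noteq> 0" using that by (auto simp: t_def)
      then have "p \<in> D" by (rule balanced_in_D[OF z])
      then have "0 < (\<Sum>q\<in>D. \<sigma> * t q)" using nn that by (intro sum_pos2[of _ p]) auto
      then show False using s by (simp flip: sum_distrib_left)
    qed
  qed
  have C: "p = C (fst p - fst m) (snd p - snd m)" for p by simp
  have PI: "P (fst p - fst m)" if "0 < z p" "fst p \<noteq> fst m" for p
    unfolding P_def using that C[of p] by (metis right_minus_eq)
  have NI: "N (fst p - fst m)" if "z p < 0" "fst p \<noteq> fst m" for p
    unfolding N_def using that C[of p] by (metis right_minus_eq)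
  have tz: "0 < t p \<Longrightarrow> (P (fst p - fst m) \<and> 0 < fst p - fst m) \<or> (N (fst p - fst m) \<and> fst p - fst m < 0)"
    "t p < 0 \<Longrightarrow> (P (fst p - fst m) \<and> fst p - fst m < 0) \<or> (N (fst p - fst m) \<and> 0 < fst p - fst m)" for p
    using PI[of p] NI[of p] by (auto simp: t_def zero_less_mult_iff mult_less_0_iff)
  have noN: "fst p = fst m" if n: "z p < 0" for p
  proof (rule ccontr)
    assume ne: "fst p \<noteq> fst m"
    define r where "r = fst p - fst m"
    have r: "N r" "r \<noteq> 0" using NI[OF n ne] ne by (simp_all add: r_def)
    consider "0 < r" | "r < 0" using r by linarith
    then show False
    proof cases
      case 1
      then have "0 < - 1 * t p" using n by (simp add: t_def r_def mult_pos_neg)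
      then obtain q where "0 < t q" using bal[of "- 1" p] by auto
      then show False
        using tz(1)[of q] same_side[OF _ r(1)] neg_both_sides[OF r(1)] 1 by (meson mult_pos_pos)
    next
      case 2
      then have "0 < 1 * t p" using n by (simp add: t_def r_def mult_neg_neg)
      then obtain q where "t q < 0" using bal[of 1 p] by auto
      then show False
        using tz(2)[of q] same_side[OF _ r(1)] neg_both_sides[OF _ r(1)] 2 by (meson mult_neg_neg)
    qed
  qed
  have noN': "\<not> N r" for r
  proof
    assume "N r"
    then obtain k where "r \<noteq> 0" "z (C r k) < 0" by (auto simp: N_def)
    then show False using noN[of "C r k"] by simp
  qed
  obtain e where e: "e \<noteq> m" "z e < 0" using not_all_nonneg[OF z nc pv] by blast
  then have e1: "fst e = fst m" using noN by blast
  define k where "k = snd e - snd m"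
  have "C 0 k = e" using e1 by (simp add: k_def prod_eq_iff)
  have ek: "z (C 0 k) < 0" "k \<noteq> 0"
    unfolding \<open>C 0 k = e\<close> using e e1 by (auto simp: k_def prod_eq_iff)
  have noP: "fst p = fst m" if n: "0 < z p" for p
  proof (rule ccontr)
    assume ne: "fst p \<noteq> fst m"
    define r where "r = fst p - fst m"
    have r: "P r" "r \<noteq> 0" using PI[OF n ne] ne by (simp_all add: r_def)
    consider "0 < r" | "r < 0" using r by linarith
    then show False
    proof cases
      case 1
      then have "0 < 1 * t p" using n by (simp add: t_def r_def)
      then obtain q where "t q < 0" using bal[of 1 p] by auto
      then show False using tz(2)[of q] noN' pos_both_sides[OF r(1) _ _ 1 ek] by blast
    next
      case 2
      then have "0 < - 1 * t p" using n by (simp add: t_def r_def mult_neg_pos)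
      then obtain q where "0 < t q" using bal[of "- 1" p] by auto
      then show False using tz(1)[of q] noN' pos_both_sides[OF _ r(1) 2 _ ek] by blast
    qed
  qed
  have "\<exists>k. p = m + smul k (0, 1)" if "z p \<noteq> 0" for p
  proof -
    have "fst p = fst m" using noN[of p] noP[of p] that by linarith
    then have "p = m + smul (snd p - snd m) (0, 1)" by (simp add: prod_eq_iff)
    then show ?thesis ..
  qed
  then show False using no_pivot_on_line[OF z nc pv] by blast
qed

end

end

text \<open>
Transposing the grid turns the pivot into a vertical one.
\<close>
lemma no_horizontal_pivot:
  assumes z: "grid.balanced l1 r1 l2 r2 z" and nc: "grid.nearly_exchange_closed l1 r1 l2 r2 z" and pv: "pivot z m (1, 0)"
  shows False
proof -
  let ?s = "prod.swap :: cell \<Rightarrow> cell"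
  have D: "p \<in> grid.D l2 r2 l1 r1 \<longleftrightarrow> ?s p \<in> grid.D l1 r1 l2 r2" for p
    by (auto simp: grid.D_iff)
  have lin: "?s (p + q - r) = ?s p + ?s q - ?s r" and eq: "?s p = ?s q \<longleftrightarrow> p = q" for p q r
    by (auto simp: prod_eq_iff)
  have tu: "two_units (z \<circ> ?s) a c \<longleftrightarrow> two_units z (?s a) (?s c)"
    "two_units (- (z \<circ> ?s)) a c \<longleftrightarrow> two_units (- z) (?s a) (?s c)" for a c
    by (simp_all add: two_units_def eq)
  have "(\<Sum>p\<in>grid.D l2 r2 l1 r1. f p * (z \<circ> ?s) p) = (\<Sum>p\<in>grid.D l1 r1 l2 r2. f (?s p) * z p)" for f
    by (rule sum.reindex_bij_witness[of _ ?s ?s]) (auto simp: D)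
  from this[of "\<lambda>_. 1"] this[of fst] this[of snd] have 1: "grid.balanced l2 r2 l1 r1 (z \<circ> ?s)"
    using z unfolding grid.balanced_def D by simp
  have 2: "grid.nearly_exchange_closed l2 r2 l1 r1 (z \<circ> ?s)"
    unfolding grid.nearly_exchange_closed_def grid.nearly_exchange_closed_up_def
  proof (intro conjI allI impI)
    fix a c b
    assume "two_units (z \<circ> ?s) a c" "(z \<circ> ?s) b < 0" "a + c - b \<in> grid.D l2 r2 l1 r1"
      "a + c - b = b \<longrightarrow> (z \<circ> ?s) b \<le> - 2"
    then have H: "two_units z (?s a) (?s c)" "z (?s b) < 0" "?s (a + c - b) \<in> grid.D l1 r1 l2 r2"
      "?s (a + c - b) \<noteq> ?s b \<or> z (?s b) \<le> - 2"
      unfolding tu D eq comp_apply by blast+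
    show "0 < (z \<circ> ?s) (a + c - b)"
      unfolding comp_def by (rule grid.nearly_exchange_closed_pos[OF nc H(1,2) lin H(3,4)])
  next
    fix a c b
    assume "two_units (- (z \<circ> ?s)) a c" "(- (z \<circ> ?s)) b < 0" "a + c - b \<in> grid.D l2 r2 l1 r1"
      "a + c - b = b \<longrightarrow> (- (z \<circ> ?s)) b \<le> - 2"
    then have H: "two_units (- z) (?s a) (?s c)" "0 < z (?s b)" "?s (a + c - b) \<in> grid.D l1 r1 l2 r2"
      "?s (a + c - b) \<noteq> ?s b \<or> 2 \<le> z (?s b)"
      unfolding tu D eq uminus_apply comp_apply neg_less_0_iff_less neg_le_iff_le by blast+
    have "z (?s (a + c - b)) < 0"
      by (rule grid.nearly_exchange_closed_neg[OF nc H(1,2) lin H(3,4)])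
    then show "0 < (- (z \<circ> ?s)) (a + c - b)" by simp
  qed
  have "?s m + (0, 1) = ?s (m + (1, 0))" "?s m - (0, 1) = ?s (m - (1, 0))" by (simp_all add: prod_eq_iff)
  then have 3: "pivot (z \<circ> ?s) (?s m) (0, 1)" using pv by (simp add: pivot_def zero_prod_def)
  show False using grid.no_vertical_pivot[OF 1 2 3] .
qed

section \<open>Configurations and their moves\<close>

definition unit :: "cell \<Rightarrow> cell \<Rightarrow> int" where "unit p = (\<lambda>q. if q = p then 1 else 0)"

lemma unit_same [simp]: "unit p p = 1" and unit_other [simp]: "q \<noteq> p \<Longrightarrow> unit p q = 0"
  by (simp_all add: unit_def)

definition shift :: "(cell \<Rightarrow> int) \<Rightarrow> cell \<Rightarrow> cell \<Rightarrow> cell \<Rightarrow> cell \<Rightarrow> cell \<Rightarrow> int" where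
  "shift f a c b d = f - unit a - unit c + unit b + unit d"

lemma shift_diff: "shift x a c b d - y = shift (x - y) a c b d" "x - shift y a c b d = shift (x - y) b d a c"
  by (simp_all add: shift_def algebra_simps)

locale margins = grid +
  fixes n :: "cell \<Rightarrow> int"
  assumes n_pos: "p \<in> D \<Longrightarrow> 1 \<le> n p"
begin

definition states :: "(cell \<Rightarrow> int) set" where
  "states = {f. (\<forall>p\<in>D. 0 \<le> f p \<and> f p \<le> n p) \<and> (\<forall>p. p \<notin> D \<longrightarrow> f p = 0)}"

definition step :: "(cell \<Rightarrow> int) \<Rightarrow> (cell \<Rightarrow> int) \<Rightarrow> bool" where
  "step f g \<longleftrightarrow> f \<in> states \<and> g \<in> states \<and>
     (\<exists>a c b d. a \<in> D \<and> c \<in> D \<and> b \<in> D \<and> d \<in> D \<and> a + c = b + d \<and> g = shift f a c b d)"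

abbreviation conn :: "(cell \<Rightarrow> int) \<Rightarrow> (cell \<Rightarrow> int) \<Rightarrow> bool" where "conn \<equiv> step\<^sup>*\<^sup>*"

lemma shift_shift: "shift (shift f a c b d) b d a c = f"
  by (simp add: shift_def algebra_simps)

lemma step_sym: "step f g \<Longrightarrow> step g f"
  unfolding step_def by (metis shift_shift)

lemma conn_sym: "conn f g \<Longrightarrow> conn g f"
  by (induction rule: rtranclp_induct) (auto intro: converse_rtranclp_into_rtranclp dest: step_sym)

text \<open>
  The capacities permit moving units from \<open>a, c\<close> to \<open>b, d\<close>, including the cases where the two source
  cells or the two target cells coincide.
\<close>
definition can_shift :: "(cell \<Rightarrow> int) \<Rightarrow> cell \<Rightarrow> cell \<Rightarrow> cell \<Rightarrow> cell \<Rightarrow> bool" where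
  "can_shift f a c b d \<longleftrightarrow> a \<in> D \<and> c \<in> D \<and> b \<in> D \<and> d \<in> D \<and> a \<noteq> b \<and> a \<noteq> d \<and> c \<noteq> b \<and> c \<noteq> d \<and>
     1 \<le> f a \<and> 1 \<le> f c \<and> (a = c \<longrightarrow> 2 \<le> f a) \<and> f b < n b \<and> f d < n d \<and> (b = d \<longrightarrow> f b + 2 \<le> n b)"

lemma shift_apply:
  assumes "a \<noteq> b" "a \<noteq> d" "c \<noteq> b" "c \<noteq> d"
  shows "shift f a c b d p = (if p = a then f p - (if a = c then 2 else 1) else if p = c then f p - 1
     else if p = b then f p + (if b = d then 2 else 1) else if p = d then f p + 1 else f p)"
  using assms by (simp add: shift_def unit_def)

lemma shift_in_states:
  assumes "f \<in> states" "can_shift f a c b d"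
  shows "shift f a c b d \<in> states"
  using assms unfolding states_def can_shift_def
  by (auto simp: shift_apply)

lemma conn_shift:
  assumes "f \<in> states" "can_shift f a c b d" "a + c = b + d"
  shows "conn f (shift f a c b d)"
proof -
  have "step f (shift f a c b d)"
    using assms shift_in_states[OF assms(1,2)] unfolding step_def can_shift_def by blast
  then show ?thesis by simp
qed

definition distance :: "(cell \<Rightarrow> int) \<Rightarrow> int" where "distance z = (\<Sum>p\<in>D. \<bar>z p\<bar>)"

lemma distance_minus_unit:
  assumes "p \<in> D" shows "distance (z - unit p) = distance z + (if 1 \<le> z p then - 1 else 1)"
proof -
  have "distance (z - unit p) = \<bar>z p - 1\<bar> + (\<Sum>q\<in>D - {p}. \<bar>z q\<bar>)"
    unfolding distance_def by (subst sum.remove[OF finite_D assms]) (simp add: unit_def)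
  moreover have "distance z = \<bar>z p\<bar> + (\<Sum>q\<in>D - {p}. \<bar>z q\<bar>)"
    unfolding distance_def by (rule sum.remove[OF finite_D assms])
  ultimately show ?thesis by auto
qed

lemma distance_plus_unit:
  assumes "p \<in> D" shows "distance (z + unit p) = distance z + (if z p \<le> - 1 then - 1 else 1)"
proof -
  have "distance (z + unit p) = \<bar>z p + 1\<bar> + (\<Sum>q\<in>D - {p}. \<bar>z q\<bar>)"
    unfolding distance_def by (subst sum.remove[OF finite_D assms]) (simp add: unit_def)
  moreover have "distance z = \<bar>z p\<bar> + (\<Sum>q\<in>D - {p}. \<bar>z q\<bar>)"
    unfolding distance_def by (rule sum.remove[OF finite_D assms])
  ultimately show ?thesis by auto
qed

lemma distance_shift:
  assumes "a \<in> D" "c \<in> D" "b \<in> D" "d \<in> D" "a \<noteq> b" "a \<noteq> d" "c \<noteq> b" "c \<noteq> d"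
  shows "distance (shift z a c b d) = distance z + (if 1 \<le> z a then - 1 else 1)
     + (if (if a = c then 2 else 1) \<le> z c then - 1 else 1)
     + (if z b \<le> - 1 then - 1 else 1) + (if z d \<le> (if b = d then - 2 else - 1) then - 1 else 1)"
proof -
  let ?w1 = "z - unit a" let ?w2 = "?w1 - unit c" let ?w3 = "?w2 + unit b"
  have "distance (shift z a c b d) = distance z + (if 1 \<le> z a then - 1 else 1) + (if 1 \<le> ?w1 c then - 1 else 1)
     + (if ?w2 b \<le> - 1 then - 1 else 1) + (if ?w3 d \<le> - 1 then - 1 else 1)"
    unfolding shift_def
    by (simp only: distance_minus_unit[OF assms(1)] distance_minus_unit[OF assms(2)] distance_plus_unit[OF assms(3)]
        distance_plus_unit[OF assms(4)])
  moreover have "?w1 c = z c - (if a = c then 1 else 0)" "?w2 b = z b" "?w3 d = z d + (if b = d then 1 else 0)"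
    using assms(5-8) by (simp_all add: unit_def)
  ultimately show ?thesis by (smt (verit))
qed

lemma distance_uminus: "distance (- z) = distance z" by (simp add: distance_def)

lemma sum_shift:
  assumes "a \<in> D" "c \<in> D" "b \<in> D" "d \<in> D"
  shows "(\<Sum>p\<in>D. f p * shift z a c b d p) = (\<Sum>p\<in>D. f p * z p) - f a - f c + f b + f d"
proof -
  have u: "(\<Sum>p\<in>D. f p * unit q p) = f q" if "q \<in> D" for q
    using that by (simp add: unit_def if_distrib cong: if_cong)
  have "(\<Sum>p\<in>D. f p * shift z a c b d p) = (\<Sum>p\<in>D. f p * z p) - (\<Sum>p\<in>D. f p * unit a p)
     - (\<Sum>p\<in>D. f p * unit c p) + (\<Sum>p\<in>D. f p * unit b p) + (\<Sum>p\<in>D. f p * unit d p)"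
    by (simp add: shift_def sum.distrib sum_subtractf distrib_left right_diff_distrib)
  then show ?thesis using assms by (simp add: u)
qed

lemma balanced_shift:
  assumes "balanced z" "a \<in> D" "c \<in> D" "b \<in> D" "d \<in> D" "a + c = b + d"
  shows "balanced (shift z a c b d)"
proof -
  have "fst a + fst c = fst b + fst d" "snd a + snd c = snd b + snd d"
    using arg_cong[OF assms(6), of fst] arg_cong[OF assms(6), of snd] by simp_all
  moreover have "shift z a c b d p = 0" if "p \<notin> D" for p
  proof -
    have "p \<noteq> a" "p \<noteq> b" "p \<noteq> c" "p \<noteq> d" using that assms by auto
    then show ?thesis using that assms(1) by (simp add: shift_def balanced_def)
  qed
  ultimately show ?thesis
    using assms(1) sum_shift[OF assms(2-5), of "\<lambda>_. 1" z] sum_shift[OF assms(2-5), of fst z]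
      sum_shift[OF assms(2-5), of snd z]
    by (simp add: balanced_def)
qed

lemma conn_balanced:
  assumes "conn x x'" "balanced (x - y)" shows "balanced (x' - y)"
  using assms
proof (induction rule: rtranclp_induct)
  case (step x' x'')
  then obtain a c b d where h: "a \<in> D" "c \<in> D" "b \<in> D" "d \<in> D" "a + c = b + d" "x'' = shift x' a c b d"
    unfolding step_def by blast
  have "balanced (x' - y)" by (rule step.IH[OF step.prems])
  then show ?case unfolding h(6) shift_diff by (rule balanced_shift[OF _ h(1-5)])
qed

lemma conn_states: "conn x x' \<Longrightarrow> x \<in> states \<Longrightarrow> x' \<in> states"
  by (induction rule: rtranclp_induct) (auto simp: step_def)

definition disconnected :: "(cell \<Rightarrow> int) \<Rightarrow> (cell \<Rightarrow> int) \<Rightarrow> bool" where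
  "disconnected x y \<longleftrightarrow> x \<in> states \<and> y \<in> states \<and> balanced (x - y) \<and> \<not> conn x y"

text \<open>
  The minimum is over all disconnected pairs, not over a fixed pair of components, so that the notion
  is preserved under moves of \<open>x\<close> and \<open>y\<close> and under passing to complements.
\<close>
definition closest :: "(cell \<Rightarrow> int) \<Rightarrow> (cell \<Rightarrow> int) \<Rightarrow> bool" where
  "closest x y \<longleftrightarrow> disconnected x y \<and> (\<forall>x' y'. disconnected x' y' \<longrightarrow> distance (x - y) \<le> distance (x' - y'))"

lemma disconnected_sym: "disconnected x y \<Longrightarrow> disconnected y x"
  using balanced_uminus[of "x - y"] conn_sym by (auto simp: disconnected_def)

lemma distance_diff_commute: "distance (y - x) = distance (x - y)"
  using distance_uminus[of "x - y"] by simp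

lemma closest_sym: "closest x y \<Longrightarrow> closest y x"
  unfolding closest_def using disconnected_sym by (simp add: distance_diff_commute[of y x])

lemma disconnected_conn:
  assumes "disconnected x y" "conn x x'" "conn y y'"
  shows "disconnected x' y'"
proof -
  have "balanced (x' - y)" using conn_balanced assms by (auto simp: disconnected_def)
  then have "balanced (y - x')" using balanced_uminus[of "x' - y"] by simp
  then have "balanced (y' - x')" using conn_balanced assms(3) by blast
  then have "balanced (x' - y')" using balanced_uminus[of "y' - x'"] by simp
  moreover have "\<not> conn x' y'"
    using assms conn_sym[OF assms(3)] unfolding disconnected_def by (meson rtranclp_trans)
  ultimately show ?thesis using assms conn_states by (auto simp: disconnected_def)
qed

lemma closest_le:
  assumes "closest x y" "conn x x'" "conn y y'"
  shows "distance (x - y) \<le> distance (x' - y')"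
  using assms disconnected_conn unfolding closest_def by blast

lemma closest_conn:
  assumes "closest x y" "conn x x'" "conn y y'" "distance (x' - y') \<le> distance (x - y)"
  shows "closest x' y'"
proof -
  have "distance (x' - y') \<le> distance (x'' - y'')" if "disconnected x'' y''" for x'' y''
    using assms(1,4) that unfolding closest_def by (meson order_trans)
  moreover have "disconnected x' y'" using disconnected_conn assms(1-3) unfolding closest_def by blast
  ultimately show ?thesis unfolding closest_def by blast
qed

lemma closest_bounds:
  assumes "closest x y" "p \<in> D"
  shows "0 \<le> x p" "x p \<le> n p" "0 \<le> y p" "y p \<le> n p"
  using assms by (auto simp: closest_def disconnected_def states_def)

lemma closest_states: "closest x y \<Longrightarrow> x \<in> states \<and> y \<in> states \<and> balanced (x - y)"
  by (simp add: closest_def disconnected_def)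

lemma diff_in_D: "closest x y \<Longrightarrow> x p - y p \<noteq> 0 \<Longrightarrow> p \<in> D"
  using balanced_in_D[of "x - y" p] closest_states by simp

lemma closest_shift_le:
  assumes "closest x y"
  shows "can_shift x a c b d \<Longrightarrow> a + c = b + d \<Longrightarrow> distance (x - y) \<le> distance (shift (x - y) a c b d)"
    "can_shift y b d a c \<Longrightarrow> a + c = b + d \<Longrightarrow> distance (x - y) \<le> distance (shift (x - y) a c b d)"
  using closest_le[OF assms, of "shift x a c b d" y] closest_le[OF assms, of x "shift y b d a c"]
    conn_shift[of x a c b d] conn_shift[of y b d a c] closest_states[OF assms]
  by (auto simp: shift_diff)

text \<open>
  If \<open>z\<close> is not positive at the fourth corner \<open>d\<close>, the exchange between \<open>a, c\<close> and \<open>b, d\<close> reduces the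
  distance. It is possible in \<open>x\<close> when there is room at \<open>d\<close>; otherwise \<open>x d = n d \<ge> 1\<close> forces a unit of
  \<open>y\<close> at \<open>d\<close>, and the reverse exchange is possible in \<open>y\<close>.
\<close>
lemma closest_nearly_exchange_closed_up:
  assumes cl: "closest x y" shows "nearly_exchange_closed_up (x - y)"
  unfolding nearly_exchange_closed_up_def
proof (intro allI impI)
  fix a c b :: cell
  let ?z = "x - y" and ?d = "a + c - b"
  assume ac: "two_units ?z a c" and b: "?z b < 0" and dD: "?d \<in> D" and db: "?d = b \<longrightarrow> ?z b \<le> - 2"
  show "0 < ?z ?d"
  proof (rule ccontr)
    assume nd: "\<not> 0 < ?z ?d"
    have z: "1 \<le> x a - y a" "1 \<le> x c - y c" "a = c \<longrightarrow> 2 \<le> x a - y a" "x b - y b \<le> - 1"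
      "x ?d - y ?d \<le> 0" "b = ?d \<longrightarrow> x b - y b \<le> - 2"
      using ac b nd db by (auto simp: two_units_def)
    have D: "a \<in> D" "c \<in> D" "b \<in> D" "?d \<in> D" using diff_in_D[OF cl] z dD by auto
    note bd = closest_bounds[OF cl D(1)] closest_bounds[OF cl D(2)] closest_bounds[OF cl D(3)] closest_bounds[OF cl D(4)]
    have ne: "a \<noteq> b" "c \<noteq> b" "a \<noteq> ?d" "c \<noteq> ?d" using z by force+
    have sum: "a + c = b + ?d" by simp
    have "distance (shift ?z a c b ?d) < distance ?z"
      using distance_shift[OF D ne(1,3,2,4), of ?z] z by auto
    moreover have "can_shift x a c b ?d \<or> can_shift y b ?d a c"
    proof (cases "x ?d < n ?d \<and> (b = ?d \<longrightarrow> x b + 2 \<le> n b)")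
      case True
      then show ?thesis using D ne z bd unfolding can_shift_def by linarith
    next
      case False
      have "b \<noteq> ?d" "x ?d = n ?d" using False z bd by (smt (verit))+
      then show ?thesis using D ne z bd n_pos[OF dD] unfolding can_shift_def by (smt (verit))
    qed
    ultimately show False using closest_shift_le[OF cl _ sum] closest_shift_le(2)[OF cl _ sum] by linarith
  qed
qed

lemma closest_nearly_exchange_closed: "closest x y \<Longrightarrow> nearly_exchange_closed (x - y)"
  unfolding nearly_exchange_closed_def
  using closest_nearly_exchange_closed_up[of x y] closest_nearly_exchange_closed_up[OF closest_sym, of x y] by simp

lemma pivot_of_not_exchange_closed_up:
  assumes "nearly_exchange_closed_up z" "\<not> exchange_closed_up z"
  shows "\<exists>m u. pivot z m u"
proof -
  obtain a c b where h: "two_units z a c" "z b < 0" "a + c - b \<in> D" "\<not> 0 < z (a + c - b)"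
    using assms(2) unfolding exchange_closed_up_def by blast
  then have "a + c - b = b \<and> \<not> z b \<le> - 2" using assms(1) unfolding nearly_exchange_closed_up_def by blast
  moreover from this have "b - (a - b) = c" by (metis add_diff_cancel_left' diff_add_cancel diff_diff_eq2 add.commute)
  moreover have "a \<noteq> b" using h by (auto simp: two_units_def)
  ultimately have "pivot z b (a - b)" using h by (auto simp: pivot_def two_units_def)
  then show ?thesis by blast
qed

lemma closest_has_pivot:
  assumes cl: "closest x y" shows "\<exists>x y m u. closest x y \<and> pivot (x - y) m u"
proof -
  have nc: "nearly_exchange_closed (x - y)" by (rule closest_nearly_exchange_closed[OF cl])
  have "x \<noteq> y" using cl by (auto simp: closest_def disconnected_def)
  then obtain p where "(x - y) p \<noteq> 0" by (metis eq_iff_diff_eq_0 ext zero_fun_apply)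
  then have "\<not> exchange_closed (x - y)" using exchange_closed_balanced_eq_0 closest_states[OF cl] by blast
  then consider "\<not> exchange_closed_up (x - y)" | "\<not> exchange_closed_up (y - x)" by (auto simp: exchange_closed_def)
  then show ?thesis
  proof cases
    case 1 then show ?thesis using pivot_of_not_exchange_closed_up nc cl unfolding nearly_exchange_closed_def by blast
  next
    case 2 then show ?thesis
      using pivot_of_not_exchange_closed_up[of "y - x"] nc closest_sym[OF cl] unfolding nearly_exchange_closed_def by auto
  qed
qed

end

section \<open>What a pivot implies about the configurations\<close>

definition l1_norm :: "cell \<Rightarrow> int" where "l1_norm u = \<bar>fst u\<bar> + \<bar>snd u\<bar>"

context margins begin

text \<open>
  Exchanging units and holes. As \<open>complement y - complement x = x - y\<close>, every statement about \<open>x\<close> and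
  a pivot has a dual one about \<open>y\<close>.
\<close>
definition complement :: "(cell \<Rightarrow> int) \<Rightarrow> cell \<Rightarrow> int" where
  "complement f = (\<lambda>p. if p \<in> D then n p - f p else 0)"

lemma complement_in_D [simp]: "p \<in> D \<Longrightarrow> complement f p = n p - f p"
  by (simp add: complement_def)

lemma complement_states: "f \<in> states \<Longrightarrow> complement f \<in> states"
  by (simp add: states_def complement_def)

lemma complement_complement: "f \<in> states \<Longrightarrow> complement (complement f) = f"
  by (simp add: states_def complement_def fun_eq_iff)

lemma complement_step: assumes "step f g" shows "step (complement f) (complement g)"
proof -
  obtain a c b d where h: "a \<in> D" "c \<in> D" "b \<in> D" "d \<in> D" "a + c = b + d" "g = shift f a c b d"
    using assms unfolding step_def by blast
  have "complement g = shift (complement f) b d a c"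
    using h(1-4) by (auto simp: h(6) complement_def shift_def unit_def fun_eq_iff)
  then show ?thesis
    using assms complement_states h(1-5) unfolding step_def by metis
qed

lemma complement_conn: "conn f g \<Longrightarrow> conn (complement f) (complement g)"
  by (induction rule: rtranclp_induct) (auto intro: rtranclp.rtrancl_into_rtrancl dest: complement_step)

lemma complement_diff: "x \<in> states \<Longrightarrow> y \<in> states \<Longrightarrow> complement y - complement x = x - y"
  by (simp add: states_def complement_def fun_eq_iff)

lemma closest_complement: assumes "closest x y" shows "closest (complement y) (complement x)"
proof -
  have s: "x \<in> states" "y \<in> states" using closest_states assms by blast+
  have "\<not> conn (complement y) (complement x)"
  proof
    assume "conn (complement y) (complement x)"
    from conn_sym[OF complement_conn[OF this]] have "conn x y" using s by (simp add: complement_complement)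
    then show False using assms by (simp add: closest_def disconnected_def)
  qed
  then have "disconnected (complement y) (complement x)"
    using assms complement_states s by (simp add: closest_def disconnected_def complement_diff)
  then show ?thesis using assms unfolding closest_def complement_diff[OF s] by blast
qed

context
  fixes x y m u
  assumes cl: "closest x y" and pv: "pivot (x - y) m u"
begin

lemma pivot_ends: "y (m + u) < x (m + u)" "y (m - u) < x (m - u)" "x m = y m - 1" "m + u \<noteq> m - u"
  "m + u \<noteq> m" "m - u \<noteq> m" "m \<in> D" "m + u \<in> D" "m - u \<in> D"
proof -
  show "y (m + u) < x (m + u)" "y (m - u) < x (m - u)" "x m = y m - 1"
    using pv by (auto simp: pivot_def)
  then show "m \<in> D" "m + u \<in> D" "m - u \<in> D" using diff_in_D[OF cl] by auto
  show "m + u \<noteq> m - u" "m + u \<noteq> m" "m - u \<noteq> m" using pv by (auto simp: pivot_def prod_eq_iff)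
qed

lemma double_distance: "distance (shift (x - y) (m + u) (m - u) m m) < distance (x - y)"
  using pivot_ends by (simp add: distance_shift)

text \<open>
  The virtual move \<open>m + u, m - u \<rightarrow> m, m\<close> would bring \<open>x\<close> and \<open>y\<close> closer; it exceeds the capacity at \<open>m\<close>
  but may be realised by moves of both configurations.
\<close>
lemma no_double:
  assumes "conn x x'" "conn y y'" "x' - y' = shift (x - y) (m + u) (m - u) m m"
  shows False
  using closest_le[OF cl assms(1,2)] double_distance assms(3) by simp

lemma pivot_mid: "n m = 1" "x m = 0" "y m = 1"
proof -
  note pe = pivot_ends
  note bd = closest_bounds[OF cl pe(7)] closest_bounds[OF cl pe(8)] closest_bounds[OF cl pe(9)]
  have s: "m + u + (m - u) = m + m" by simp
  have "\<not> can_shift x (m + u) (m - u) m m" "\<not> can_shift y m m (m + u) (m - u)"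
    using closest_shift_le[OF cl _ s] double_distance by fastforce+
  then have "\<not> x m + 2 \<le> n m" "\<not> 2 \<le> y m"
    using pe bd by (auto simp: can_shift_def)
  then show "n m = 1" "x m = 0" "y m = 1" using pe(3) bd by linarith+
qed

text \<open>
  A unit at \<open>h\<close> and room at \<open>h + u\<close> act as a catalyst. In \<open>x\<close> move \<open>m + u, h \<rightarrow> m, h + u\<close>, in \<open>y\<close> move
  \<open>m, h \<rightarrow> m - u, h + u\<close>: the changes at \<open>h\<close> and \<open>h + u\<close> cancel in the difference, and the virtual move
  of \<open>no_double\<close> remains. If the second move is not possible, \<open>z\<close> is positive at \<open>h\<close> or negative at
  \<open>h + u\<close>, and the first one alone reduces the distance.
\<close>
lemma full_along_u:
  assumes h: "h \<in> D" "h + u \<in> D" "h \<notin> {m, m + u, m - u}" "h + u \<notin> {m, m + u, m - u}" and xh: "1 \<le> x h"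
  shows "x (h + u) = n (h + u)"
proof (rule ccontr)
  assume "x (h + u) \<noteq> n (h + u)"
  then have xhu: "x (h + u) < n (h + u)" using closest_bounds[OF cl h(2)] by simp
  note pe = pivot_ends and mid = pivot_mid
  note bd = closest_bounds[OF cl pe(8)] closest_bounds[OF cl pe(9)]
  have "u \<noteq> 0" using pv by (simp add: pivot_def)
  then have hu: "h \<noteq> h + u" by simp
  have sum: "m + u + h = m + (h + u)" "m + h = m - u + (h + u)" by simp_all
  have cs: "can_shift x (m + u) h m (h + u)"
    using h pe mid bd xh xhu hu by (auto simp: can_shift_def)
  have "\<not> distance (shift (x - y) (m + u) h m (h + u)) < distance (x - y)"
    using closest_shift_le(1)[OF cl cs sum(1)] by simp
  then have "x h \<le> y h" "y (h + u) \<le> x (h + u)"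
    using distance_shift[OF pe(8) h(1) pe(7) h(2), of "x - y"] h pe hu by (auto split: if_splits)
  then have cs': "can_shift y m h (m - u) (h + u)"
    using h pe mid bd xh xhu hu by (auto simp: can_shift_def)
  have "shift x (m + u) h m (h + u) - shift y m h (m - u) (h + u) = shift (x - y) (m + u) (m - u) m m"
    by (simp add: shift_def algebra_simps)
  then show False
    using no_double conn_shift[OF _ cs sum(1)] conn_shift[OF _ cs' sum(2)] closest_states[OF cl] by blast
qed

text \<open>
  Fullness is additive relative to \<open>m\<close>. In \<open>x\<close> the moves \<open>G, H \<rightarrow> m, R\<close> and \<open>m + u, m - u \<rightarrow> G, G'\<close> move
  units from \<open>m + u, m - u, H\<close> to \<open>m, R, G'\<close>, and in \<open>y\<close> the move \<open>m, H \<rightarrow> R, G'\<close> completes the virtual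
  move of \<open>no_double\<close>. When the move of \<open>y\<close> is blocked, the moves of \<open>x\<close> already reduce the distance.
\<close>
lemma full_sum:
  assumes D: "m + g \<in> D" "m + h \<in> D" "m + g + h \<in> D" "m - g \<in> D"
    and new: "g \<notin> {0, u, - u}" "h \<notin> {0, u, - u}" "g + h \<notin> {0, u, - u}"
    and gh: "g \<noteq> h" "g + h \<noteq> - g"
    and xg: "1 \<le> x (m + g)" "1 \<le> x (m + h)" "x (m - g) < n (m - g)"
  shows "x (m + g + h) = n (m + g + h)"
proof (rule ccontr)
  define G H R G' where "G = m + g" and "H = m + h" and "R = m + g + h" and "G' = m - g"
  assume "x (m + g + h) \<noteq> n (m + g + h)"
  then have xR: "x R < n R" using closest_bounds[OF cl D(3)] by (simp add: R_def)
  note pe = pivot_ends and mid = pivot_mid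
  note bd = closest_bounds[OF cl pe(8)] closest_bounds[OF cl pe(9)]
  have inD: "G \<in> D" "H \<in> D" "R \<in> D" "G' \<in> D" using D by (simp_all add: G_def H_def R_def G'_def)
  have GR: "R = m + (g + h)" "G' = m + (- g)" by (simp_all add: R_def G'_def add.assoc)
  have off: "m + w \<noteq> m" "m + w \<noteq> m + u" "m + w \<noteq> m - u" if "w \<notin> {0, u, - u}" for w
    using that by (simp_all add: diff_conv_add_uminus del: add_uminus_conv_diff)
  have "- g \<notin> {0, u, - u}" using new(1) by (metis insert_iff minus_minus neg_0_equal_iff_equal singletonD)
  note ne = off[OF new(1), folded G_def] off[OF new(2), folded H_def] off[OF new(3), folded GR] off[OF this, folded GR]
  have "g \<noteq> - g" using new(1) by (simp add: prod_eq_iff)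
  moreover have "h \<noteq> - g" "g \<noteq> 0" "h \<noteq> 0" using new by (auto simp: add_eq_0_iff)
  ultimately have ne': "G \<noteq> H" "R \<noteq> G" "R \<noteq> H" "R \<noteq> G'" "G \<noteq> G'" "H \<noteq> G'"
    using gh unfolding GR G_def H_def by simp_all
  have sum: "G + H = m + R" "m + u + (m - u) = G + G'" "m + H = R + G'"
    by (simp_all add: G_def H_def R_def G'_def)
  have xx: "1 \<le> x G" "1 \<le> x H" "x G' < n G'" using xg by (simp_all add: G_def H_def G'_def)
  define x1 where "x1 = shift x G H m R"
  have cs: "can_shift x G H m R"
    using inD ne ne' pe mid xx xR by (auto simp: can_shift_def)
  have x1: "x1 G = x G - 1" "x1 G' = x G'" "x1 (m + u) = x (m + u)" "x1 (m - u) = x (m - u)"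
    using ne ne' pe(5,6) by (simp_all add: x1_def shift_def unit_def)
  have cs1: "can_shift x1 (m + u) (m - u) G G'"
    using inD ne ne' pe bd xx closest_bounds[OF cl inD(1)] by (auto simp: can_shift_def x1)
  define x2 where "x2 = shift x1 (m + u) (m - u) G G'"
  have s: "x \<in> states" "y \<in> states" using closest_states[OF cl] by blast+
  have c1: "conn x x1" unfolding x1_def by (rule conn_shift[OF s(1) cs sum(1)])
  have "conn x1 x2" unfolding x2_def by (rule conn_shift[OF conn_states[OF c1 s(1)] cs1 sum(2)])
  with c1 have c2: "conn x x2" by simp
  let ?w = "shift (x - y) (m + u) (m - u) m R"
  have x2: "x2 - y = ?w - unit H + unit G'"
    by (simp add: x2_def x1_def shift_def algebra_simps)
  have "distance (?w - unit H + unit G') = distance (x - y) - 3 + (if (x - y) R \<le> - 1 then - 1 else 1)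
     + (if 1 \<le> (x - y) H then - 1 else 1) + (if (x - y) G' \<le> - 1 then - 1 else 1)"
  proof -
    have "?w H = (x - y) H" "(?w - unit H) G' = (x - y) G'"
      using ne ne' by (simp_all add: shift_def unit_def)
    then show ?thesis
      unfolding distance_plus_unit[OF inD(4)] distance_minus_unit[OF inD(2)]
      using distance_shift[OF pe(8,9,7) inD(3), of "x - y"] pe ne by simp
  qed
  moreover have "distance (x - y) \<le> distance (x2 - y)" using closest_le[OF cl c2] by simp
  ultimately have "y R \<le> x R" "x H \<le> y H" "y G' \<le> x G'"
    unfolding x2 by (auto split: if_splits)
  then have cs2: "can_shift y m H R G'"
    using inD ne ne' pe mid xx xR by (auto simp: can_shift_def)
  have "x2 - shift y m H R G' = shift (x - y) (m + u) (m - u) m m"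
    by (simp add: x2_def x1_def shift_def algebra_simps)
  then show False using no_double[OF c2 conn_shift[OF s(2) cs2 sum(3)]] by simp
qed

end

text \<open>
  A pivot of least length among all pivots of all closest pairs; any rearrangement at equal distance
  that produces a shorter pivot is a contradiction.
\<close>
definition shortest :: "(cell \<Rightarrow> int) \<Rightarrow> (cell \<Rightarrow> int) \<Rightarrow> cell \<Rightarrow> cell \<Rightarrow> bool" where
  "shortest x y m u \<longleftrightarrow> closest x y \<and> pivot (x - y) m u \<and>
     (\<forall>x' y' m' u'. closest x' y' \<longrightarrow> pivot (x' - y') m' u' \<longrightarrow> l1_norm u \<le> l1_norm u')"

lemma shortest_complement:
  assumes "shortest x y m u" shows "shortest (complement y) (complement x) m u"
proof -
  have cl: "closest x y" using assms by (simp add: shortest_def)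
  have s: "x \<in> states" "y \<in> states" using closest_states[OF cl] by blast+
  show ?thesis
    using assms closest_complement[OF cl] unfolding shortest_def complement_diff[OF s] by blast
qed

text \<open>
  Otherwise \<open>m + u, m - u \<rightarrow> m + g, m - g\<close> is possible in \<open>x\<close>, and it either reduces the distance or
  yields the shorter pivot with direction \<open>g\<close>.
\<close>
lemma full_at_one:
  assumes sh: "shortest x y m u" and g: "g \<noteq> 0" "l1_norm g < l1_norm u" "m + g \<in> D" "m - g \<in> D"
  shows "x (m + g) = n (m + g) \<or> x (m - g) = n (m - g)"
proof (rule ccontr)
  assume no: "\<not> ?thesis"
  have cl: "closest x y" and pv: "pivot (x - y) m u" using sh by (simp_all add: shortest_def)
  note pe = pivot_ends[OF cl pv]
  note bd = closest_bounds[OF cl pe(8)] closest_bounds[OF cl pe(9)] closest_bounds[OF cl g(3)] closest_bounds[OF cl g(4)]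
  have "g \<noteq> u" "g \<noteq> - u" using g(2) by (auto simp: l1_norm_def)
  moreover from this have "- g \<noteq> u" by (metis minus_minus)
  ultimately have ne: "m + g \<noteq> m + u" "m + g \<noteq> m - u" "m - g \<noteq> m + u" "m - g \<noteq> m - u"
    by (simp_all add: diff_conv_add_uminus del: add_uminus_conv_diff)
  have "g \<noteq> - g" using g(1) by (simp add: prod_eq_iff)
  then have ne': "m + g \<noteq> m - g" "m + g \<noteq> m" "m - g \<noteq> m"
    using g(1) by (simp_all add: diff_conv_add_uminus del: add_uminus_conv_diff)
  have cs: "can_shift x (m + u) (m - u) (m + g) (m - g)"
    using no g pe ne ne' bd by (auto simp: can_shift_def)
  have sum: "m + u + (m - u) = m + g + (m - g)" by simp
  let ?w = "shift (x - y) (m + u) (m - u) (m + g) (m - g)"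
  have dw: "distance ?w = distance (x - y) - 2 + (if (x - y) (m + g) \<le> - 1 then - 1 else 1)
      + (if (x - y) (m - g) \<le> - 1 then - 1 else 1)"
    using distance_shift[OF pe(8,9) g(3,4), of "x - y"] ne ne' pe by simp
  have "distance (x - y) \<le> distance ?w" by (rule closest_shift_le(1)[OF cl cs sum])
  then have z: "0 \<le> (x - y) (m + g)" "0 \<le> (x - y) (m - g)" and "distance ?w = distance (x - y)"
    using dw by (auto split: if_splits)
  then have "closest (shift x (m + u) (m - u) (m + g) (m - g)) y"
    using closest_conn[OF cl conn_shift[OF _ cs sum], of y] closest_states[OF cl] by (simp add: shift_diff)
  moreover have "pivot ?w m g"
    using z g(1) ne ne' pe by (auto simp: pivot_def shift_def unit_def)
  ultimately show False using sh g(2) unfolding shortest_def by (metis not_less shift_diff(1))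
qed

text \<open>
  By \<open>full_at_one\<close> at least one of the cells \<open>m + g\<close> and \<open>m - g\<close> is full in \<open>x\<close>, and one is empty in \<open>y\<close>.
  If both are full in \<open>x\<close> and both empty in \<open>y\<close>, \<open>z\<close> is positive at both, which is a shorter pivot. So
  \<open>x\<close> or the complement of \<open>y\<close> is full at exactly one of them.
\<close>
lemma definite:
  assumes sh: "shortest x y m u" and g: "g \<noteq> 0" "l1_norm g < l1_norm u" "m + g \<in> D" "m - g \<in> D"
  obtains X Y where "shortest X Y m u"
    "X (m + g) = n (m + g) \<and> X (m - g) < n (m - g) \<or> X (m - g) = n (m - g) \<and> X (m + g) < n (m + g)"
proof -
  have cl: "closest x y" using sh by (simp add: shortest_def)
  note bd = closest_bounds[OF cl g(3)] closest_bounds[OF cl g(4)]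
  show ?thesis
  proof (cases "x (m + g) = n (m + g) \<and> x (m - g) = n (m - g)")
    case False
    then show ?thesis using that[OF sh] full_at_one[OF sh g] bd by linarith
  next
    case True
    have sc: "shortest (complement y) (complement x) m u" by (rule shortest_complement[OF sh])
    have "\<not> (y (m + g) = 0 \<and> y (m - g) = 0)"
    proof
      assume "y (m + g) = 0 \<and> y (m - g) = 0"
      then have "pivot (x - y) m g"
        using True n_pos[OF g(3)] n_pos[OF g(4)] g(1) sh by (simp add: shortest_def pivot_def)
      then show False using sh cl g(2) unfolding shortest_def by (metis not_less)
    qed
    then show ?thesis
      using that[OF sc] full_at_one[OF sc g] bd g by (simp) linarith
  qed
qed

end

section \<open>Lines parallel to a vector\<close>

text \<open>
  The level sets of \<open>level u\<close> are the lines parallel to \<open>u\<close>. For primitive \<open>u\<close> every integer is a level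
  and the cells of a level differ by multiples of \<open>u\<close>.
\<close>
definition level :: "cell \<Rightarrow> cell \<Rightarrow> int" where "level u h = fst u * snd h - snd u * fst h"

lemma level_simps: "level u (p + q) = level u p + level u q" "level u (p - q) = level u p - level u q"
  "level u (- p) = - level u p" "level (- u) p = - level u p" "level u u = 0" "level u (smul k u) = 0"
  by (simp_all add: level_def algebra_simps)

lemma same_level:
  assumes "coprime (fst u) (snd u)" "level u d = 0"
  shows "\<exists>k. d = smul k u"
proof -
  have eq: "fst u * snd d = snd u * fst d" using assms(2) by (simp add: level_def)
  have "fst u dvd snd u * fst d" using eq by (metis dvd_triv_left)
  then have "fst u dvd fst d" using assms(1) by (simp add: coprime_dvd_mult_right_iff)
  then obtain k where k: "fst d = fst u * k" ..
  have "snd u dvd fst u * snd d" using eq by simp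
  then have "snd u dvd snd d" using assms(1) by (simp add: coprime_commute coprime_dvd_mult_right_iff)
  then obtain j where j: "snd d = snd u * j" ..
  have jk: "fst u * snd u * j = fst u * snd u * k" using eq k j by (simp add: mult.assoc mult.left_commute)
  show ?thesis
  proof (cases "fst u = 0 \<or> snd u = 0")
    case False
    then show ?thesis using jk k j by (intro exI[of _ k]) (simp add: prod_eq_iff mult.commute)
  next
    case True
    then show ?thesis
    proof
      assume "fst u = 0"
      then show ?thesis using k j by (intro exI[of _ j]) (simp add: prod_eq_iff mult.commute)
    next
      assume "snd u = 0"
      then show ?thesis using k j by (intro exI[of _ k]) (simp add: prod_eq_iff mult.commute)
    qed
  qed
qed

text \<open>
  \<open>g\<close> lies in the rectangle spanned by \<open>0\<close> and \<open>u\<close>, so that \<open>m + g\<close>, \<open>m - g\<close> and \<open>m - g + u\<close> are in the grid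
  whenever \<open>m + u\<close> and \<open>m - u\<close> are.
\<close>
definition aligned :: "cell \<Rightarrow> cell \<Rightarrow> bool" where
  "aligned u g \<longleftrightarrow> min 0 (fst u) \<le> fst g \<and> fst g \<le> max 0 (fst u) \<and> min 0 (snd u) \<le> snd g \<and> snd g \<le> max 0 (snd u)"

lemma ex_level_one_pos:
  fixes a b :: int
  assumes "coprime a b" "0 < a" "0 < b"
  shows "\<exists>s t. 0 \<le> s \<and> s < a \<and> 0 < t \<and> t \<le> b \<and> a * t - b * s = 1"
proof -
  obtain p q where pq: "p * a + q * b = 1" using assms(1) bezout_int[of a b] by auto
  define s where "s = (- q) mod a"
  define t where "t = p - b * ((- q) div a)"
  have qs: "a * ((- q) div a) = - q - s" by (simp add: s_def minus_mod_eq_mult_div)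
  have "a * t - b * s = a * p - b * (a * ((- q) div a)) - b * s"
    by (simp add: t_def algebra_simps)
  also have "\<dots> = 1" unfolding qs using pq by (simp add: algebra_simps)
  finally have 1: "a * t - b * s = 1" .
  have s: "0 \<le> s" "s < a" using assms(2) by (simp_all add: s_def)
  have "0 \<le> b * s" using s assms(3) by simp
  then have "0 < a * t" using 1 by linarith
  then have "0 < t" using assms(2) by (simp add: zero_less_mult_iff)
  moreover have "b * s \<le> b * (a - 1)" using s assms(3) by (intro mult_left_mono) auto
  then have "a * t \<le> a * b" using 1 assms(3) by (simp add: algebra_simps)
  then have "t \<le> b" using assms(2) by simp
  ultimately show ?thesis using 1 s by blast
qed

text \<open>
  Bezout coefficients reduced modulo \<open>u\<close>. When the coordinates of \<open>u\<close> have different signs, the point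
  opposite in the rectangle spanned by \<open>u\<close> is taken.
\<close>
lemma ex_level_one:
  assumes "coprime (fst u) (snd u)" "fst u \<noteq> 0" "snd u \<noteq> 0"
  obtains g where "level u g = 1" "aligned u g" "l1_norm g < l1_norm u"
proof -
  define a b where "a = \<bar>fst u\<bar>" and "b = \<bar>snd u\<bar>"
  have "coprime a b" "0 < a" "0 < b" using assms by (simp_all add: a_def b_def)
  then obtain s t where st: "0 \<le> s" "s < a" "0 < t" "t \<le> b" "a * t - b * s = 1"
    using ex_level_one_pos by blast
  then have st': "b * (a - s) - a * (b - t) = 1" by (simp add: algebra_simps)
  consider "0 < fst u" "0 < snd u" | "fst u < 0" "snd u < 0" | "0 < fst u" "snd u < 0" | "fst u < 0" "0 < snd u"
    using assms by linarith
  then show ?thesis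
  proof cases
    case 1 then show ?thesis using that[of "(s, t)"] st by (simp add: level_def aligned_def l1_norm_def a_def b_def)
  next
    case 2 then show ?thesis using that[of "(- s, - t)"] st by (simp add: level_def aligned_def l1_norm_def a_def b_def)
  next
    case 3 then show ?thesis using that[of "(a - s, t - b)"] st st'
      by (simp add: level_def aligned_def l1_norm_def a_def b_def algebra_simps)
  next
    case 4 then show ?thesis using that[of "(s - a, b - t)"] st st'
      by (simp add: level_def aligned_def l1_norm_def a_def b_def algebra_simps)
  qed
qed

context grid begin

text \<open>
  Up to a multiple of \<open>u\<close>, a cell of level at least two is a sum of two different cells of positive
  level, one of which has its reflection at \<open>m\<close> in the grid. If \<open>h\<close> points into the quadrant of \<open>u\<close> or of
  \<open>-u\<close>, one summand is \<open>g\<close> or \<open>g - u\<close>; if the two summands coincide, a shift by \<open>u\<close> replaces them by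
  \<open>g\<close> and \<open>g - u\<close>. In the other quadrants one summand is a horizontal unit vector in the direction of \<open>h\<close>.
\<close>
lemma split_level:
  assumes u: "fst u \<noteq> 0" "snd u \<noteq> 0" "m + u \<in> D" "m - u \<in> D" and h: "m + h \<in> D" "2 \<le> level u h"
    and g: "level u g = 1" "aligned u g"
  obtains k p q where "h + smul k u = p + q" "m + p + q \<in> D" "m + p \<in> D" "m - p \<in> D" "m + q \<in> D"
    "1 \<le> level u p" "1 \<le> level u q" "p \<noteq> q"
proof -
  note result = that
  note D = u(3,4) h(1)
  \<comment> \<open>\<open>u\<close> and \<open>h\<close> in neighbouring quadrants: both terms of \<open>level u h\<close> are then positive\<close>
  have mixed: thesis
    if mx: "0 < fst u * fst h \<and> snd u * snd h < 0 \<or> fst u * fst h < 0 \<and> 0 < snd u * snd h"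
  proof -
    have h0: "fst h \<noteq> 0" "snd h \<noteq> 0" using mx by auto
    have "(fst u * fst h) * (snd u * snd h) < 0" using mx by (auto simp: mult_less_0_iff)
    then have "(fst u * snd h) * (snd u * fst h) < 0" by (simp add: ac_simps)
    then have pos: "0 < fst u * snd h" "snd u * fst h < 0"
      using h(2) by (auto simp: mult_less_0_iff[of "fst u * snd h"] level_def)
    define \<sigma> where "\<sigma> = sgn (fst h)"
    have sg: "0 < fst h \<and> \<sigma> = 1 \<and> snd u < 0 \<or> fst h < 0 \<and> \<sigma> = - 1 \<and> 0 < snd u"
      using h0 pos(2) by (auto simp: \<sigma>_def sgn_if mult_less_0_iff)
    have "0 \<le> - (snd u * (fst h - \<sigma>))"
      using sg by (auto simp: mult_le_0_iff)
    then have lq: "1 \<le> fst u * snd h - snd u * (fst h - \<sigma>)" using pos(1) by linarith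
    show thesis
    proof (rule result[of 0 "(\<sigma>, 0)" "h - (\<sigma>, 0)"])
      show "m + (\<sigma>, 0) \<in> D" "m - (\<sigma>, 0) \<in> D" "m + (h - (\<sigma>, 0)) \<in> D"
        using D sg u(1,2) by (auto simp: D_iff)
      show "1 \<le> level u (\<sigma>, 0)" using sg by (auto simp: level_def)
      show "1 \<le> level u (h - (\<sigma>, 0))" using lq by (simp add: level_def)
      show "(\<sigma>, 0) \<noteq> h - (\<sigma>, 0)" using h0 by (auto simp: prod_eq_iff)
    qed (use h in auto)
  qed
  define same where "same i j \<longleftrightarrow> (0 < i \<and> 0 \<le> j) \<or> (i < 0 \<and> j \<le> 0)" for i j :: int
  have pg: "m + g \<in> D" "m - g \<in> D" "m + (g - u) \<in> D" "m - (g - u) \<in> D"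
    using D g(2) by (auto simp: D_iff aligned_def min_def max_def split: if_splits)
  have lg: "level u (g - u) = 1" using g by (simp add: level_simps)
  \<comment> \<open>the replacement of a repeated summand\<close>
  have dbl: thesis if "h + smul k u = g + (g - u)" "m + g + (g - u) \<in> D" for k
  proof (rule result[OF that])
    show "g \<noteq> g - u" using u(1) by (auto simp: prod_eq_iff)
  qed (use pg g lg in auto)
  have tri: "same i j \<and> same i (- j) \<or> same i j \<and> 0 < i * j \<or> same i (- j) \<and> i * j < 0"
    if "i \<noteq> 0" for i j
    using that linorder_less_linear[of 0 i] linorder_less_linear[of 0 j]
    by (elim disjE) (simp_all add: same_def zero_less_mult_iff mult_less_0_iff)
  have "same (fst u) (fst h) \<and> same (snd u) (snd h) \<or> same (fst u) (- fst h) \<and> same (snd u) (- snd h)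
    \<or> 0 < fst u * fst h \<and> snd u * snd h < 0 \<or> fst u * fst h < 0 \<and> 0 < snd u * snd h"
    using tri[OF u(1), of "fst h"] tri[OF u(2), of "snd h"] by blast
  then consider "same (fst u) (fst h)" "same (snd u) (snd h)" | "same (fst u) (- fst h)" "same (snd u) (- snd h)"
    | "0 < fst u * fst h" "snd u * snd h < 0" | "fst u * fst h < 0" "0 < snd u * snd h"
    by blast
  then show thesis
  proof cases
    case 1
    show thesis
    proof (cases "h - g = g")
      case True
      then have hg: "fst h = 2 * fst g" "snd h = 2 * snd g" by (auto simp: prod_eq_iff)
      show thesis
      proof (rule dbl[of "- 1"])
        show "h + smul (- 1) u = g + (g - u)" using hg by (simp add: prod_eq_iff)
        show "m + g + (g - u) \<in> D"
          using D g(2) hg by (auto simp: D_iff aligned_def min_def max_def split: if_splits)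
      qed
    next
      case False
      show thesis
      proof (rule result[of 0 g "h - g"])
        show "m + (h - g) \<in> D"
          using D g(2) 1 by (auto simp: D_iff aligned_def same_def min_def max_def split: if_splits)
      qed (use h g pg False in \<open>auto simp: level_simps\<close>)
    qed
  next
    case 2
    show thesis
    proof (cases "h - (g - u) = g - u")
      case True
      then have hg: "fst h = 2 * (fst g - fst u)" "snd h = 2 * (snd g - snd u)" by (auto simp: prod_eq_iff)
      show thesis
      proof (rule dbl[of 1])
        show "h + smul 1 u = g + (g - u)" using hg by (simp add: prod_eq_iff)
        show "m + g + (g - u) \<in> D"
          using D g(2) hg by (auto simp: D_iff aligned_def min_def max_def split: if_splits)
      qed
    next
      case False
      show thesis
      proof (rule result[of 0 "g - u" "h - (g - u)"])
        show "m + (h - (g - u)) \<in> D"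
          using D g(2) 2 by (auto simp: D_iff aligned_def same_def min_def max_def split: if_splits)
      qed (use h lg pg False in \<open>auto simp: level_simps\<close>)
    qed
  next
    case 3
    then show thesis by (rule mixed[OF disjI1[OF conjI]])
  next
    case 4
    then show thesis by (rule mixed[OF disjI2[OF conjI]])
  qed
qed

end

section \<open>Excluding pivots\<close>

lemma off_line:
  assumes "level u h \<noteq> 0"
  shows "h \<notin> {0, u, - u}" "h + u \<notin> {0, u, - u}"
proof -
  have *: "h \<notin> {0, u, - u}" if "level u h \<noteq> 0" for h
    using that by (auto simp: level_def)
  show "h \<notin> {0, u, - u}" using *[OF assms] .
  have "level u (h + u) \<noteq> 0" using assms by (simp add: level_simps)
  then show "h + u \<notin> {0, u, - u}" by (rule *)
qed

lemma translate_notin: "h \<notin> {0, u, - u} \<Longrightarrow> m + h \<notin> {m, m + u, m - u :: cell}"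
  by (simp add: diff_conv_add_uminus del: add_uminus_conv_diff)

context margins begin

text \<open>
\<open>full_along_u\<close> iterated along a line that avoids \<open>m\<close>.
\<close>
lemma full_along_level_up:
  assumes cl: "closest x y" and pv: "pivot (x - y) m u" and lh: "level u h \<noteq> 0" and xh: "1 \<le> x (m + h)"
    and D: "m + h \<in> D" and k: "1 \<le> k" and Dk: "m + h + smul k u \<in> D"
  shows "x (m + h + smul k u) = n (m + h + smul k u)"
  using k Dk
proof (induction k rule: int_ge_induct)
  case base
  have "x (m + h + u) = n (m + h + u)"
  proof (rule full_along_u[OF cl pv D])
    show "m + h + u \<in> D" using base by simp
    show "m + h \<notin> {m, m + u, m - u}" by (rule translate_notin[OF off_line(1)[OF lh]])
    show "m + h + u \<notin> {m, m + u, m - u}"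
      using translate_notin[OF off_line(2)[OF lh]] by (simp only: add.assoc not_False_eq_True)
  qed (rule xh)
  then show ?case by simp
next
  case (step k)
  let ?h = "h + smul k u"
  have Dk: "m + h + smul k u \<in> D"
    using between_in_D[of "m + h" 0 u "k + 1" k] D step by simp
  then have "x (m + ?h) = n (m + ?h)" using step.IH by (simp add: add.assoc)
  then have x1: "1 \<le> x (m + ?h)" using n_pos Dk by (simp add: add.assoc)
  have l: "level u ?h \<noteq> 0" using lh by (simp add: level_simps)
  have eq: "m + h + smul (k + 1) u = m + ?h + u" by (simp add: smul_add add.assoc)
  have "x (m + ?h + u) = n (m + ?h + u)"
  proof (rule full_along_u[OF cl pv])
    show "m + ?h \<in> D" using Dk by (simp add: add.assoc)
    show "m + ?h + u \<in> D" using step.prems unfolding eq .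
    show "m + ?h \<notin> {m, m + u, m - u}" by (rule translate_notin[OF off_line(1)[OF l]])
    show "m + ?h + u \<notin> {m, m + u, m - u}"
      using translate_notin[OF off_line(2)[OF l]] by (simp only: add.assoc not_False_eq_True)
  qed (rule x1)
  then show ?case unfolding eq .
qed

lemma full_along_level:
  assumes cl: "closest x y" and pv: "pivot (x - y) m u" and lh: "level u h \<noteq> 0" and xh: "1 \<le> x (m + h)"
    and D: "m + h \<in> D" and k: "k \<noteq> 0" and Dk: "m + h + smul k u \<in> D"
  shows "x (m + h + smul k u) = n (m + h + smul k u)"
proof -
  consider "1 \<le> k" | "1 \<le> - k" using k by linarith
  then show ?thesis
  proof cases
    case 1 then show ?thesis using full_along_level_up[OF cl pv lh xh D _ Dk] by blast
  next
    case 2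
    have "level (- u) h \<noteq> 0" using lh by (simp add: level_simps)
    then show ?thesis
      using full_along_level_up[OF cl pivot_uminus[OF pv] _ xh D 2] Dk by (simp add: smul_minus)
  qed
qed

lemma same_level_full:
  assumes "closest x y" "pivot (x - y) m u" "coprime (fst u) (snd u)" "level u h \<noteq> 0" "level u h' = level u h"
    "1 \<le> x (m + h)" "m + h \<in> D" "m + h' \<in> D" "h' \<noteq> h"
  shows "x (m + h') = n (m + h')"
proof -
  have "level u (h' - h) = 0" using assms(5) by (simp add: level_simps)
  then obtain k where k: "h' - h = smul k u" using same_level[OF assms(3)] by blast
  then have "k \<noteq> 0" using assms(9) by auto
  moreover have eq: "m + h + smul k u = m + h'" unfolding k[symmetric] by simp
  ultimately show ?thesis
    using full_along_level[OF assms(1,2,4,6,7), of k, unfolded eq] assms(8) by blast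
qed

text \<open>
  Induction on the distance of the line from \<open>m\<close>, simultaneously on both sides. A line of level at
  least two is split into two lower ones by \<open>split_level\<close>. On the full side, \<open>full_sum\<close> adds the
  summands \<open>p\<close> and \<open>q\<close>. On the empty side, a unit on \<open>p + q\<close> together with the full cell \<open>-p\<close> would make
  \<open>q\<close> full.
\<close>
lemma threshold:
  assumes cl: "closest x y" and pv: "pivot (x - y) m u"
    and u: "coprime (fst u) (snd u)" "fst u \<noteq> 0" "snd u \<noteq> 0"
    and g: "level u g = 1" "aligned u g" and full: "x (m + g) = n (m + g)" and nfull: "x (m - g) < n (m - g)"
  shows "\<forall>h. m + h \<in> D \<longrightarrow> \<bar>level u h\<bar> \<le> int N \<longrightarrow>
     (0 < level u h \<longrightarrow> x (m + h) = n (m + h)) \<and> (level u h < 0 \<longrightarrow> x (m + h) = 0)"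
proof (induction N)
  case 0 then show ?case by auto
next
  case (Suc N)
  note pe = pivot_ends[OF cl pv]
  have x0: "0 \<le> x p" if "p \<in> D" for p using closest_bounds[OF cl that] by simp
  have gD: "m + g \<in> D" "m - g \<in> D" "m - g + u \<in> D"
    using pe(7-9) g(2) by (auto simp: D_iff aligned_def min_def max_def split: if_splits)
  have full1: "x (m + h) = n (m + h)" if "m + h \<in> D" "level u h = 1" for h
    using same_level_full[OF cl pv u(1), of g h] full n_pos[OF gD(1)] g(1) gD that by (cases "h = g") auto
  have zero: "x (m - g) = 0"
  proof (rule ccontr)
    assume "x (m - g) \<noteq> 0"
    then have 1: "1 \<le> x (m + - g)" using x0[OF gD(2)] by simp
    have l: "level u (- g) \<noteq> 0" using g by (simp add: level_simps)
    have "x (m + - g + smul 1 u) = n (m + - g + smul 1 u)"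
      by (rule full_along_level[OF cl pv l 1]) (use gD in simp_all)
    then have 2: "1 \<le> x (m + (u - g))" using n_pos[OF gD(3)] by (simp add: algebra_simps)
    have "level u (u - g) \<noteq> 0" using g by (simp add: level_simps)
    then have "x (m + (u - g) + smul (- 1) u) = n (m + (u - g) + smul (- 1) u)"
      using gD by (intro full_along_level[OF cl pv _ 2]) (simp_all add: algebra_simps)
    then show False using nfull by (simp add: algebra_simps)
  qed
  have zero1: "x (m + h) = 0" if h: "m + h \<in> D" "level u h = - 1" for h
  proof (rule ccontr)
    assume "x (m + h) \<noteq> 0"
    then have 1: "1 \<le> x (m + h)" using x0[OF h(1)] by simp
    then have "h \<noteq> - g" using zero by auto
    then have "x (m + - g) = n (m + - g)"
      using same_level_full[OF cl pv u(1) _ _ 1 h(1), of "- g"] h g gD by (simp add: level_simps)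
    then show False using nfull by simp
  qed
  show ?case
  proof (intro allI impI conjI)
    fix h assume h: "m + h \<in> D" "\<bar>level u h\<bar> \<le> int (Suc N)"
    show "x (m + h) = n (m + h)" if pos: "0 < level u h"
    proof (cases "level u h = 1")
      case True then show ?thesis using full1 h by blast
    next
      case False
      then have "2 \<le> level u h" using pos by simp
      then obtain k p q where s: "h + smul k u = p + q" "m + p + q \<in> D" "m + p \<in> D" "m - p \<in> D" "m + q \<in> D"
        "1 \<le> level u p" "1 \<le> level u q" "p \<noteq> q"
        using split_level[OF u(2,3) pe(8,9) h(1) _ g] by blast
      have lpq: "level u p + level u q = level u h"
        using arg_cong[OF s(1), of "level u"] by (simp add: level_simps)
      have IH: "x (m + p) = n (m + p)" "x (m + q) = n (m + q)" "x (m + - p) = 0"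
        using Suc.IH[rule_format, of p] Suc.IH[rule_format, of q] Suc.IH[rule_format, of "- p"] s lpq h(2)
        by (simp_all add: level_simps)
      have "x (m + p + q) = n (m + p + q)"
      proof (rule full_sum[OF cl pv])
        have "level u (p + q) \<noteq> 0" "level u p \<noteq> 0" "level u q \<noteq> 0" "level u (p + q) \<noteq> level u (- p)"
          using s(6,7) by (simp_all add: level_simps)
        then show "p + q \<notin> {0, u, - u}" "p \<notin> {0, u, - u}" "q \<notin> {0, u, - u}" "p + q \<noteq> - p"
          using off_line(1) by metis+
      qed (use s IH n_pos[OF s(3)] n_pos[OF s(4)] n_pos[OF s(5)] in auto)
      moreover have hk: "m + p + q = m + h + smul k u" using s(1) by (simp add: add.assoc)
      ultimately show ?thesis
      proof (cases "k = 0")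
        case False
        have "h = p + q + smul (- k) u" using s(1) by (simp add: prod_eq_iff)
        then have hh: "m + h = m + (p + q) + smul (- k) u" by (simp add: add.assoc)
        have "x (m + (p + q) + smul (- k) u) = n (m + (p + q) + smul (- k) u)"
        proof (rule full_along_level[OF cl pv])
          show "level u (p + q) \<noteq> 0" using s(6,7) by (simp add: level_simps)
          show "1 \<le> x (m + (p + q))"
            using \<open>x (m + p + q) = n (m + p + q)\<close> n_pos[OF s(2)] by (simp add: add.assoc)
        qed (use s(2) False h(1) hh in \<open>simp_all add: add.assoc\<close>)
        then show ?thesis by (simp only: hh)
      qed simp
    qed
    show "x (m + h) = 0" if neg: "level u h < 0"
    proof (cases "level u h = - 1")
      case True then show ?thesis using zero1 h by blast
    next
      case False
      show ?thesis
      proof (rule ccontr)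
        assume "x (m + h) \<noteq> 0"
        then have xh: "1 \<le> x (m + h)" using x0[OF h(1)] by simp
        have mu: "m + - u \<in> D" "m - - u \<in> D" "fst (- u) \<noteq> 0" "snd (- u) \<noteq> 0" using pe(8,9) u by simp_all
        have "2 \<le> level (- u) h" using neg False by (simp add: level_simps)
        moreover have "level (- u) (- g) = 1" "aligned (- u) (- g)" using g by (auto simp: level_simps aligned_def)
        ultimately obtain k p q where s: "h + smul k (- u) = p + q" "m + p + q \<in> D" "m + p \<in> D" "m - p \<in> D" "m + q \<in> D"
          "1 \<le> level (- u) p" "1 \<le> level (- u) q" "p \<noteq> q"
          using split_level[OF mu(3,4,1,2) h(1)] by blast
        have lp: "level u p \<le> - 1" "level u q \<le> - 1" using s(6,7) by (simp_all add: level_simps)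
        have lpq: "level u p + level u q = level u h"
          using arg_cong[OF s(1), of "level u"] by (simp add: level_simps smul_minus)
        have IH: "x (m + p) = 0" "x (m + q) = 0" "x (m - p) = n (m - p)"
          using Suc.IH[rule_format, of p] Suc.IH[rule_format, of q] Suc.IH[rule_format, of "- p"] s lp lpq h(2) by (simp_all add: level_simps)
        have hk: "m + (p + q) = m + h + smul (- k) u" using s(1) by (simp add: smul_minus add.assoc)
        have xpq: "1 \<le> x (m + (p + q))"
        proof (cases "k = 0")
          case True then show ?thesis using xh hk by simp
        next
          case False
          have "x (m + h + smul (- k) u) = n (m + h + smul (- k) u)"
            using neg False h(1) s(2) hk
            by (intro full_along_level[OF cl pv _ xh]) (simp_all add: add.assoc)
          then show ?thesis using n_pos[OF s(2)] hk by (simp add: add.assoc)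
        qed
        have "x (m + - p + (p + q)) = n (m + - p + (p + q))"
        proof (rule full_sum[OF cl pv])
          have "level u (- p) \<noteq> 0" "level u (p + q) \<noteq> 0" "level u (- p + (p + q)) \<noteq> 0" "level u (- p) \<noteq> level u (p + q)"
            using lp by (simp_all add: level_simps)
          then show "- p \<notin> {0, u, - u}" "p + q \<notin> {0, u, - u}" "- p + (p + q) \<notin> {0, u, - u}" "- p \<noteq> p + q"
            using off_line(1) by metis+
          show "- p + (p + q) \<noteq> - (- p)" using s(8) by simp
        qed (use s IH n_pos[OF s(3)] n_pos[OF s(4)] xpq in \<open>simp_all add: add.assoc\<close>)
        then show False using IH(2) n_pos[OF s(5)] by simp
      qed
    qed
  qed
qed

text \<open>
  Above the line through \<open>m\<close>, \<open>x\<close> is full and \<open>z \<ge> 0\<close>; below it, \<open>x\<close> is empty and \<open>z \<le> 0\<close>. So the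
  moment \<open>t\<close>, whose total is zero, has nonnegative terms only, and \<open>z\<close> is supported on the line.
\<close>
lemma no_definite_primitive:
  assumes cl: "closest x y" and pv: "pivot (x - y) m u"
    and u: "coprime (fst u) (snd u)" "fst u \<noteq> 0" "snd u \<noteq> 0"
    and g: "level u g = 1" "aligned u g" and full: "x (m + g) = n (m + g)" and nfull: "x (m - g) < n (m - g)"
  shows False
proof -
  note st = closest_states[OF cl]
  then have bal: "balanced (x - y)" by blast
  define t where "t p = level u (p - m) * (x - y) p" for p
  have t0: "0 \<le> t p" if "p \<in> D" for p
  proof -
    note th = threshold[OF cl pv u g full nfull, of "nat \<bar>level u (p - m)\<bar>", rule_format, of "p - m"]
    note bd = closest_bounds[OF cl that]
    consider "0 < level u (p - m)" | "level u (p - m) < 0" | "level u (p - m) = 0" by linarith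
    then show ?thesis
    proof cases
      case 1 then show ?thesis using th that bd by (simp add: t_def)
    next
      case 2 then show ?thesis using th that bd by (simp add: t_def mult_nonpos_nonneg)
    next
      case 3 then show ?thesis by (simp add: t_def)
    qed
  qed
  have "(\<Sum>p\<in>D. t p) = 0"
    using balanced_affine[OF bal, of "snd u * fst m - fst u * snd m" "- snd u" "fst u"]
    by (simp add: t_def level_def algebra_simps)
  then have t: "t p = 0" if "p \<in> D" for p
    using t0 that sum_nonneg_eq_0_iff[OF finite_D, of t] by simp
  have "\<exists>k. p = m + smul k u" if z: "(x - y) p \<noteq> 0" for p
  proof -
    have "level u (p - m) = 0" using t[of p] z balanced_in_D[OF bal z] by (simp add: t_def)
    then obtain k where "p - m = smul k u" using same_level[OF u(1)] by blast
    then have "p = m + smul k u" by (metis add.commute diff_add_cancel)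
    then show ?thesis ..
  qed
  then show False using no_pivot_on_line[OF bal closest_nearly_exchange_closed[OF cl] pv] by blast
qed

text \<open>
  On the line itself, \<open>full_along_u\<close> identifies positions \<open>i\<close> and \<open>i - k\<close>. Position \<open>1\<close> is full and
  \<open>k - 1\<close>, identified with \<open>-1\<close>, is not. Adding position \<open>1 - k\<close>, which is full while its reflection
  \<open>k - 1\<close> is not, to a full position \<open>i\<close> makes \<open>i + 1 - k\<close> full, and with it \<open>i + 1\<close>; after finitely
  many steps \<open>k - 1\<close> is full.
\<close>
lemma no_definite_multiple:
  assumes cl: "closest x y" and pv: "pivot (x - y) m (smul k v)" and k: "2 \<le> k"
    and full: "x (m + v) = n (m + v)" and nfull: "x (m - v) < n (m - v)"
  shows False
proof -
  let ?c = "\<lambda>i. m + smul i v"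
  note pe = pivot_ends[OF cl pv]
  have v: "v \<noteq> 0" using pv by (auto simp: pivot_def prod_eq_iff)
  have inj: "smul i v = smul j v \<longleftrightarrow> i = j" for i j by (rule smul_eq_iff[OF v])
  have neg: "- smul i v = smul (- i) v" for i by (simp add: prod_eq_iff)
  have off: "smul i v \<notin> {0, smul k v, - smul k v}" if "i \<noteq> 0" "i \<noteq> k" "i \<noteq> - k" for i
    using that inj[of i 0] by (simp add: neg inj)
  note off' = translate_notin[OF off]
  have ends: "?c k \<in> D" "?c (- k) \<in> D" using pe(8,9) by (simp_all add: neg diff_conv_add_uminus del: add_uminus_conv_diff)
  have cD: "?c i \<in> D" if "- k \<le> i" "i \<le> k" for i
    using between_in_D[OF ends(2,1) that] .
  have eq: "?c i + smul j v = ?c (i + j)" for i j by (simp add: smul_add add.assoc)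
  have up: "x (?c (i + k)) = n (?c (i + k))" if i: "- k < i" "i < 0" "1 \<le> x (?c i)" for i
    by (rule full_along_u[OF cl pv, of "?c i", unfolded eq])
      (use i off'[of i m] off'[of "i + k" m] cD[of i] cD[of "i + k"] in simp_all)
  have down: "x (?c (i - k)) = n (?c (i - k))" if i: "0 < i" "i < k" "1 \<le> x (?c i)" for i
  proof -
    have "pivot (x - y) m (smul (- k) v)" using pivot_uminus[OF pv] by (simp add: neg)
    from full_along_u[OF cl this, of "?c i", unfolded eq]
    show ?thesis
      using i off'[of i m] off'[of "i - k" m] cD[of i] cD[of "i - k"]
      by (simp add: neg[of k, symmetric] insert_commute)
  qed
  have c1: "x (?c 1) = n (?c 1)" "x (?c (- 1)) < n (?c (- 1))" using full nfull by simp_all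
  have nc: "1 \<le> n (?c i)" if "- k \<le> i" "i \<le> k" for i using n_pos cD that by blast
  have g: "1 \<le> x (?c (1 - k))" using down[of 1] c1 nc[of 1] nc[of "1 - k"] k by simp
  have g': "x (?c (k - 1)) < n (?c (k - 1))"
  proof (rule ccontr)
    assume "\<not> ?thesis"
    then have "1 \<le> x (?c (k - 1))" using nc[of "k - 1"] k by simp
    then show False using down[of "k - 1"] c1(2) k by simp
  qed
  have "i \<le> k - 1 \<longrightarrow> x (?c i) = n (?c i)" if "1 \<le> i" for i
    using that
  proof (induction i rule: int_ge_induct)
    case base then show ?case using c1 by simp
  next
    case (step i)
    show ?case
    proof
      assume i: "i + 1 \<le> k - 1"
      have xi: "1 \<le> x (?c i)" using step i nc[of i] by simp
      let ?g = "smul (1 - k) v"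
      have s: "?g + smul i v = smul (i + 1 - k) v" "- ?g = smul (k - 1) v" "m - ?g = ?c (k - 1)"
        by (simp_all add: prod_eq_iff algebra_simps)
      have s': "m + ?g + smul i v = ?c (i + 1 - k)" by (simp add: s add.assoc)
      have "x (m + ?g + smul i v) = n (m + ?g + smul i v)"
      proof (rule full_sum[OF cl pv])
        show "?g \<notin> {0, smul k v, - smul k v}" "smul i v \<notin> {0, smul k v, - smul k v}"
          using k i step.hyps by (intro off; simp)+
        show "?g + smul i v \<notin> {0, smul k v, - smul k v}"
          unfolding s using k i step.hyps by (intro off; simp)
        show "?g \<noteq> smul i v" "?g + smul i v \<noteq> - ?g" unfolding s inj using i step.hyps by simp_all
        show "m + ?g \<in> D" "m + smul i v \<in> D" using k i step.hyps by (intro cD; simp)+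
        show "m + ?g + smul i v \<in> D" unfolding s' using k i step.hyps by (intro cD; simp)
        show "m - ?g \<in> D" unfolding s(3) using k by (intro cD; simp)
        show "x (m - ?g) < n (m - ?g)" unfolding s(3) by (rule g')
      qed (rule g xi)+
      then have "1 \<le> x (?c (i + 1 - k))" unfolding s' using nc[of "i + 1 - k"] i step.hyps k by simp
      then show "x (?c (i + 1)) = n (?c (i + 1))" using up[of "i + 1 - k"] i step.hyps by simp
    qed
  qed
  from this[of "k - 1"] show False using g' k by simp
qed

lemma no_axis_pivot:
  assumes cl: "closest x y" and pv: "pivot (x - y) m u" and u: "fst u = 0 \<or> snd u = 0" "coprime (fst u) (snd u)"
  shows False
proof -
  have b: "balanced (x - y)" and nc: "nearly_exchange_closed (x - y)"
    using closest_states[OF cl] closest_nearly_exchange_closed[OF cl] by blast+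
  have "u = (0, 1) \<or> u = - (0, 1) \<or> u = (1, 0) \<or> u = - (1, 0)"
    using u(1)
  proof
    assume z: "fst u = 0"
    then have "\<bar>snd u\<bar> = 1" using u(2) by simp
    then show ?thesis using z by (auto simp: prod_eq_iff)
  next
    assume z: "snd u = 0"
    then have "\<bar>fst u\<bar> = 1" using u(2) by simp
    then show ?thesis using z by (auto simp: prod_eq_iff)
  qed
  then have "pivot (x - y) m (0, 1) \<or> pivot (x - y) m (1, 0)"
    using pv pivot_uminus[OF pv] by auto
  then show False using no_vertical_pivot[OF b nc] no_horizontal_pivot[OF b nc] by blast
qed

text \<open>
  A direction that is a multiple of \<open>v\<close> is compared with \<open>v\<close>, and a primitive one that is not parallel
  to an axis with a vector \<open>g\<close> of level one. Both are shorter than \<open>u\<close>, so \<open>definite\<close> applies.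
\<close>
lemma not_shortest: "\<not> shortest x y m u"
proof
  assume sh: "shortest x y m u"
  then have cl: "closest x y" and pv: "pivot (x - y) m u" by (simp_all add: shortest_def)
  have u0: "u \<noteq> 0" using pv by (simp add: pivot_def)
  note pe = pivot_ends[OF cl pv]
  show False
  proof (cases "coprime (fst u) (snd u)")
    case False
    define k where "k = gcd (fst u) (snd u)"
    define v where "v = (fst u div k, snd u div k)"
    have "k \<noteq> 0" using u0 by (simp add: k_def prod_eq_iff)
    moreover have "k \<noteq> 1" using False by (simp add: k_def coprime_iff_gcd_eq_1)
    moreover have "0 \<le> k" by (simp add: k_def)
    ultimately have k: "2 \<le> k" by linarith
    have uv: "u = smul k v" by (simp add: v_def k_def prod_eq_iff)
    have v: "v \<noteq> 0" using u0 uv by (auto simp: smul_def zero_prod_def)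
    have "l1_norm u = k * l1_norm v" unfolding uv using k by (simp add: l1_norm_def abs_mult distrib_left)
    moreover have "0 < l1_norm v" using v by (auto simp: l1_norm_def prod_eq_iff)
    then have "2 * l1_norm v \<le> k * l1_norm v" using k by (intro mult_right_mono) auto
    ultimately have lv: "l1_norm v < l1_norm u" using \<open>0 < l1_norm v\<close> by linarith
    have ends: "m + smul (- k) v \<in> D" "m + smul k v \<in> D"
      using pe(8,9) by (simp_all add: uv D_iff)
    have vD: "m + v \<in> D" "m - v \<in> D"
      using between_in_D[OF ends, of 1] between_in_D[OF ends, of "- 1"] k by simp_all
    obtain X Y where XY: "shortest X Y m u"
      "X (m + v) = n (m + v) \<and> X (m - v) < n (m - v) \<or> X (m - v) = n (m - v) \<and> X (m + v) < n (m + v)"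
      using definite[OF sh v lv vD] by blast
    have neg: "smul k (- v) = - u" by (simp add: uv prod_eq_iff)
    have c: "closest X Y" and p: "pivot (X - Y) m (smul k v)" "pivot (X - Y) m (smul k (- v))"
      unfolding neg uv[symmetric] using XY(1) pivot_uminus by (simp_all add: shortest_def)
    show False
      using XY(2) no_definite_multiple[OF c p(1) k] no_definite_multiple[OF c p(2) k] by auto
  next
    case True
    show False
    proof (cases "fst u = 0 \<or> snd u = 0")
      case ax: True
      then show False using no_axis_pivot[OF cl pv _ True] by blast
    next
      case False
      then obtain g where g: "level u g = 1" "aligned u g" "l1_norm g < l1_norm u"
        using ex_level_one[OF True] by blast
      have gD: "m + g \<in> D" "m - g \<in> D"
        using pe(7-9) g(2) by (auto simp: D_iff aligned_def min_def max_def split: if_splits)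
      have "g \<noteq> 0" using g(1) by (auto simp: level_def)
      from definite[OF sh this g(3) gD] obtain X Y where XY: "shortest X Y m u"
        "X (m + g) = n (m + g) \<and> X (m - g) < n (m - g) \<or> X (m - g) = n (m - g) \<and> X (m + g) < n (m + g)"
        by blast
      then have c: "closest X Y" and p: "pivot (X - Y) m u" "pivot (X - Y) m (- u)"
        using pivot_uminus by (auto simp: shortest_def)
      have g': "level (- u) (- g) = 1" "aligned (- u) (- g)" using g by (auto simp: level_simps aligned_def)
      have cu: "coprime (fst (- u)) (snd (- u))" "fst (- u) \<noteq> 0" "snd (- u) \<noteq> 0"
        "fst u \<noteq> 0" "snd u \<noteq> 0" using True False by auto
      show False
        using XY(2) no_definite_primitive[OF c p(1) True cu(4,5) g(1,2)]
          no_definite_primitive[OF c p(2) cu(1-3) g'] by auto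
    qed
  qed
qed

text \<open>
A closest pair has a pivot, and among all pivots of such pairs there is a shortest one.
\<close>
lemma not_closest: "\<not> closest x y"
proof
  assume "closest x y"
  then obtain x y m u where "closest x y" "pivot (x - y) m u" using closest_has_pivot by blast
  then have P: "\<exists>x y m. closest x y \<and> pivot (x - y) m u" by blast
  obtain u where u: "\<exists>x y m. closest x y \<and> pivot (x - y) m u"
    and least: "\<And>u'. \<exists>x y m. closest x y \<and> pivot (x - y) m u' \<Longrightarrow> nat (l1_norm u) \<le> nat (l1_norm u')"
    using ex_has_least_nat[of "\<lambda>u. \<exists>x y m. closest x y \<and> pivot (x - y) m u", OF P, of "\<lambda>u. nat (l1_norm u)"] by blast
  from u obtain x y m where xy: "closest x y" "pivot (x - y) m u" by blast
  have "0 \<le> l1_norm v" for v by (simp add: l1_norm_def)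
  then have "l1_norm u \<le> l1_norm u'" if "closest x' y'" "pivot (x' - y') m' u'" for x' y' m' u'
    using least[of u'] that by (metis nat_le_eq_zle order_le_less)
  then have "shortest x y m u" using xy by (auto simp: shortest_def)
  then show False using not_shortest by blast
qed

lemma balanced_imp_conn:
  assumes "x \<in> states" "y \<in> states" "balanced (x - y)"
  shows "conn x y"
proof (rule ccontr)
  assume "\<not> conn x y"
  then have P: "case (x, y) of (x, y) \<Rightarrow> disconnected x y" using assms by (simp add: disconnected_def)
  obtain q where q: "case q of (x, y) \<Rightarrow> disconnected x y"
    and least: "\<And>q'. (case q' of (x, y) \<Rightarrow> disconnected x y) \<Longrightarrow>
      nat (distance (fst q - snd q)) \<le> nat (distance (fst q' - snd q'))"
    using ex_has_least_nat[of "\<lambda>q. case q of (x, y) \<Rightarrow> disconnected x y", OF P, of "\<lambda>q. nat (distance (fst q - snd q))"]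
    by blast
  have d0: "0 \<le> distance z" for z by (simp add: distance_def sum_nonneg)
  have "distance (fst q - snd q) \<le> distance (x' - y')" if "disconnected x' y'" for x' y'
    using least[of "(x', y')"] that d0 by (simp add: nat_le_eq_zle)
  then have "closest (fst q) (snd q)" using q by (simp add: closest_def case_prod_unfold)
  then show False using not_closest by blast
qed

end

section \<open>From configurations to tables\<close>

text \<open>
  Cells are pairs of integers rather than natural numbers, so that differences of cells make sense.
\<close>
locale table_grid =
  fixes J K :: nat and N :: "nat \<Rightarrow> nat \<Rightarrow> int"
  assumes N_pos: "j \<in> {1..J} \<Longrightarrow> k \<in> {1..K} \<Longrightarrow> 0 < N j k"
begin

sublocale margins 1 "int J" 1 "int K" "\<lambda>p. N (nat (fst p)) (nat (snd p))"
proof unfold_locales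
  fix p :: cell assume "p \<in> grid.D 1 (int J) 1 (int K)"
  then have "nat (fst p) \<in> {1..J}" "nat (snd p) \<in> {1..K}" by (auto simp: grid.D_iff)
  from N_pos[OF this] show "1 \<le> N (nat (fst p)) (nat (snd p))" by simp
qed

lemma int_in_D [simp]: "(int j, int k) \<in> D \<longleftrightarrow> j \<in> {1..J} \<and> k \<in> {1..K}"
  by (auto simp: D_iff)

definition successes :: "array3 \<Rightarrow> cell \<Rightarrow> int" where
  "successes X p = (if p \<in> D then X 1 (nat (fst p)) (nat (snd p)) else 0)"

text \<open>
  The inverse of \<open>successes\<close> for tables with cell totals \<open>N\<close>: the failures are the remaining units.
\<close>
definition table :: "(cell \<Rightarrow> int) \<Rightarrow> array3" where
  "table f = (\<lambda>i j k. if j \<in> {1..J} \<and> k \<in> {1..K} then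
      if i = 1 then f (int j, int k) else if i = 2 then N j k - f (int j, int k) else 0 else 0)"

definition has_totals :: "array3 \<Rightarrow> bool" where
  "has_totals X \<longleftrightarrow> X \<in> tables J K \<and> (\<forall>j\<in>{1..J}. \<forall>k\<in>{1..K}. cell_total X j k = N j k)"

lemma has_totalsD:
  assumes "has_totals X" "j \<in> {1..J}" "k \<in> {1..K}"
  shows "X 1 j k + X 2 j k = N j k"
  using assms unfolding has_totals_def by (auto simp: cell_total_def)

lemma table_successes: assumes "has_totals X" shows "table (successes X) = X"
proof (intro ext)
  fix i j k
  show "table (successes X) i j k = X i j k"
  proof (cases "(i, j, k) \<in> {1, 2} \<times> {1..J} \<times> {1..K}")
    case True
    then have jk: "j \<in> {1..J}" "k \<in> {1..K}" and i: "i = 1 \<or> i = 2" by auto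
    show ?thesis using has_totalsD[OF assms jk] jk i by (auto simp: table_def successes_def)
  next
    case False
    then have "X i j k = 0" using assms by (simp add: has_totals_def tables_def arrays_def)
    then show ?thesis using False by (auto simp: table_def)
  qed
qed

lemma successes_in_states: 
  assumes "has_totals X" shows "successes X \<in> states"
proof -
  have "0 \<le> X 1 (nat (fst p)) (nat (snd p)) \<and> X 1 (nat (fst p)) (nat (snd p)) \<le> N (nat (fst p)) (nat (snd p))"
    if "p \<in> D" for p
  proof -
    have "nat (fst p) \<in> {1..J}" "nat (snd p) \<in> {1..K}" using that by (auto simp: D_iff)
    then have eq: "X 1 (nat (fst p)) (nat (snd p)) + X 2 (nat (fst p)) (nat (snd p)) = N (nat (fst p)) (nat (snd p))"
      by (rule has_totalsD[OF assms])
    have "0 \<le> X i j k" for i j k using assms by (simp add: has_totals_def tables_def)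
    then show ?thesis using eq by (smt (verit))
  qed
  then show ?thesis by (simp add: states_def successes_def)
qed

lemma table_in_tables: "f \<in> states \<Longrightarrow> table f \<in> tables J K"
  by (auto simp: tables_def arrays_def table_def states_def dest!: bspec[of _ _ "(int _, int _)"])

text \<open>
  A move takes \<open>a, c\<close> to \<open>b, d\<close> with \<open>a + c = b + d\<close>, that is \<open>b - a = c - d\<close>, so the difference of the
  tables is \<open>e\<^sub>b - e\<^sub>a - e\<^sub>c + e\<^sub>d\<close>.
\<close>
lemma step_in_moves:
  assumes "step f g" shows "table g - table f \<in> lawrence_moves J K"
proof -
  obtain a c b d where h: "a \<in> D" "c \<in> D" "b \<in> D" "d \<in> D" "a + c = b + d" "g = shift f a c b d"
    using assms unfolding step_def by blast
  have nat_cell: "\<exists>j k. p = (int j, int k) \<and> j \<in> {1..J} \<and> k \<in> {1..K}" if "p \<in> D" for p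
    using that by (intro exI[of _ "nat (fst p)"] exI[of _ "nat (snd p)"]) (auto simp: D_iff prod_eq_iff)
  obtain ja ka where a: "a = (int ja, int ka)" "ja \<in> {1..J}" "ka \<in> {1..K}" using nat_cell[OF h(1)] by blast
  obtain jc kc where c: "c = (int jc, int kc)" "jc \<in> {1..J}" "kc \<in> {1..K}" using nat_cell[OF h(2)] by blast
  obtain jb kb where b: "b = (int jb, int kb)" "jb \<in> {1..J}" "kb \<in> {1..K}" using nat_cell[OF h(3)] by blast
  obtain jd kd where d: "d = (int jd, int kd)" "jd \<in> {1..J}" "kd \<in> {1..K}" using nat_cell[OF h(4)] by blast
  have um: "unit_move j0 k0 i j k = (if i = 1 then unit (int j0, int k0) (int j, int k)
      else if i = 2 then - unit (int j0, int k0) (int j, int k) else 0)" for j0 k0 i j k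
    by (simp add: unit_move_def unit_def)
  have "table g - table f = unit_move jb kb - unit_move ja ka - unit_move jc kc + unit_move jd kd"
  proof (intro ext)
    fix i j k
    show "(table g - table f) i j k = (unit_move jb kb - unit_move ja ka - unit_move jc kc + unit_move jd kd) i j k"
    proof (cases "j \<in> {1..J} \<and> k \<in> {1..K}")
      case True
      then show ?thesis by (simp add: h(6) um table_def shift_def flip: a(1) b(1) c(1) d(1))
    next
      case False
      have "unit p (int j, int k) = 0" if "p \<in> D" for p
      proof -
        have "(int j, int k) \<noteq> p" using that False by auto
        then show ?thesis by simp
      qed
      then have "unit a (int j, int k) = 0" "unit b (int j, int k) = 0" "unit c (int j, int k) = 0"
        "unit d (int j, int k) = 0" using h(1-4) by blast+
      then show ?thesis using False by (auto simp: um table_def simp flip: a(1) b(1) c(1) d(1))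
    qed
  qed
  moreover have "int jb - int ja = int jc - int jd" "int kb - int ka = int kc - int kd"
    using h(5) by (simp_all add: a b c d)
  ultimately show ?thesis
    unfolding lawrence_moves_def using a(2,3) b(2,3) c(2,3) d(2,3) by blast
qed

lemma sum_D: "(\<Sum>p\<in>D. h p) = (\<Sum>j=1..J. \<Sum>k=1..K. h (int j, int k))"
proof -
  have "(\<Sum>p\<in>D. h p) = (\<Sum>q\<in>{1..J} \<times> {1..K}. h (int (fst q), int (snd q)))"
    by (rule sum.reindex_bij_witness[of _ "\<lambda>q. (int (fst q), int (snd q))" "\<lambda>p. (nat (fst p), nat (snd p))"])
      (auto simp: D_iff)
  then show ?thesis by (simp add: sum.cartesian_product case_prod_unfold)
qed

lemma successes_balanced:
  assumes "suff_stat J K X = suff_stat J K Y"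
  shows "balanced (successes X - successes Y)"
proof -
  have s: "(\<Sum>p\<in>D. f p * (successes X - successes Y) p) =
     (\<Sum>j=1..J. \<Sum>k=1..K. f (int j, int k) * X 1 j k) - (\<Sum>j=1..J. \<Sum>k=1..K. f (int j, int k) * Y 1 j k)" for f
  proof -
    have "(\<Sum>p\<in>D. f p * (successes X - successes Y) p) =
        (\<Sum>j=1..J. \<Sum>k=1..K. f (int j, int k) * X 1 j k - f (int j, int k) * Y 1 j k)"
      unfolding sum_D by (intro sum.cong refl) (simp add: successes_def right_diff_distrib)
    then show ?thesis by (simp only: sum_subtractf)
  qed
  have swap: "(\<Sum>j=1..J. \<Sum>k=1..K. int k * X 1 j k) = (\<Sum>k=1..K. int k * (\<Sum>j=1..J. X 1 j k))" for X :: array3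
    by (subst sum.swap) (simp add: sum_distrib_left)
  have "(\<Sum>j=1..J. \<Sum>k=1..K. X 1 j k) = (\<Sum>j=1..J. \<Sum>k=1..K. Y 1 j k)"
    "(\<Sum>j=1..J. int j * (\<Sum>k=1..K. X 1 j k)) = (\<Sum>j=1..J. int j * (\<Sum>k=1..K. Y 1 j k))"
    "(\<Sum>k=1..K. int k * (\<Sum>j=1..J. X 1 j k)) = (\<Sum>k=1..K. int k * (\<Sum>j=1..J. Y 1 j k))"
    using assms unfolding suff_stat_def prod.inject by blast+
  then have "(\<Sum>p\<in>D. 1 * (successes X - successes Y) p) = 0" "(\<Sum>p\<in>D. fst p * (successes X - successes Y) p) = 0"
    "(\<Sum>p\<in>D. snd p * (successes X - successes Y) p) = 0"
    unfolding s fst_conv snd_conv swap by (simp_all add: sum_distrib_left)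
  moreover have "(successes X - successes Y) p = 0" if "p \<notin> D" for p
    using that by (simp add: successes_def)
  ultimately show ?thesis unfolding balanced_def by simp
qed

end

theorem theorem3:
  fixes J K :: nat and t :: "int \<times> int \<times> int \<times> (nat \<times> nat \<Rightarrow> int)"
  assumes "J \<ge> 1" and "K \<ge> 1"
    and "\<forall>X\<in>fiber J K t. \<forall>j\<in>{1..J}. \<forall>k\<in>{1..K}. cell_total X j k > 0"
  shows "connects J K (lawrence_moves J K) (fiber J K t)"
  unfolding connects_def
proof (intro ballI)
  fix x y assume x: "x \<in> fiber J K t" and y: "y \<in> fiber J K t"
  interpret table_grid J K "cell_total x"
    using assms(3) x by unfold_locales blast
  have stat: "suff_stat J K x = suff_stat J K y" using x y by (simp add: fiber_def)
  have "cell_total y j k = cell_total x j k" if "j \<in> {1..J}" "k \<in> {1..K}" for j k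
  proof -
    have "(\<lambda>(j, k). if j \<in> {1..J} \<and> k \<in> {1..K} then cell_total x j k else 0)
        = (\<lambda>(j, k). if j \<in> {1..J} \<and> k \<in> {1..K} then cell_total y j k else 0)"
      using stat unfolding suff_stat_def prod.inject by blast
    from fun_cong[OF this, of "(j, k)"] show ?thesis using that by simp
  qed
  then have tot: "has_totals x" "has_totals y" using x y by (auto simp: has_totals_def fiber_def)
  have "conn (successes x) (successes y)"
    using successes_in_states tot successes_balanced[OF stat] by (intro balanced_imp_conn)
  then obtain N p where p: "p 0 = successes x" "p N = successes y" "\<And>i. i < N \<Longrightarrow> step (p i) (p (Suc i))"
    unfolding rtranclp_power relpowp_fun_conv by blast
  have st: "p s \<in> states" if "s \<le> N" for s
    using p(1,3) that successes_in_states[OF tot(1)] by (cases s) (auto simp: step_def Suc_le_eq)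
  show "\<exists>(N::nat) (p :: nat \<Rightarrow> array3). p 0 = x \<and> p N = y \<and> (\<forall>s\<le>N. p s \<in> tables J K) \<and> (\<forall>s\<in>{1..N}. p s - p (s - 1) \<in> lawrence_moves J K)"
  proof (rule exI[of _ N], rule exI[of _ "\<lambda>s. table (p s)"], intro conjI allI impI ballI)
    show "table (p 0) = x" "table (p N) = y" using p tot by (simp_all add: table_successes)
    show "table (p s) \<in> tables J K" if "s \<le> N" for s using st[OF that] by (rule table_in_tables)
    show "table (p s) - table (p (s - 1)) \<in> lawrence_moves J K" if "s \<in> {1..N}" for s
    proof -
      have "s - 1 < N" "Suc (s - 1) = s" using that by auto
      then show ?thesis using p(3)[of "s - 1"] by (intro step_in_moves) simp
    qed
  qed
qed

end
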